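(* The two-dimensional sphere $S^2$ does not carry any non-Riemannian locally conformally Berwald Finsler metric. In particular, it does not carry any non-Riemannian locally conformally flat Finsler metric.
   Context: A Finsler metric on a manifold $M$ is a continuous function $F\colon TM\to\mathbb{R}$, smooth off the zero section, with $F(tv)=tF(v)$ for $t>0$, such that with $E=\frac12F^2$ the Hessian $g_{ij}=\partial^2E/\partial y^i\partial y^j$ is positive definite at all nonzero vectors. It is Riemannian if $F$ is the norm of a Riemannian metric, non-Riemannian otherwise. Local coordinates $u^i$ on $M$ induce coordinates $x^i=u^i\circ\pi$, $y^i(v)=v(u^i)$ on $TM$, where $\pi\colon TM\to M$ is the projection. Put $G^l=\frac12 g^{lm}\big(y^k\frac{\partial^2E}{\partial y^m\partial x^k}-\frac{\partial E}{\partial x^m}\big)$, with $(g^{ij})=(g_{ij})^{-1}$ and summation over repeated indices. A Berwald manifold is a Finsler manifold whose mixed curvature $P^l_{ijk}=-\partial^3G^l/\partial y^i\partial y^j\partial y^k$ vanishes; equivalently, it admits a torsion-free compatible linear connection, i.e. a torsion-free linear connection on $M$ whose parallel transports preserve $F$. A locally Minkowski manifold is a Berwald manifold whose torsion-free compatible linear connection has zero curvature. Finsler metrics $F$ and $\tilde F$ on the same manifold are conformally equivalent if $\tilde F=e^{\alpha\circ\pi}F$ for some smooth function $\alpha$ on the manifold. A Finsler manifold is locally conformally Berwald (respectively locally conformally flat) if every point has a neighbourhood over which $F$ is conformally equivalent to a Berwald (respectively locally Minkowski) metric.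
   Formalization: Finsler metrics are additionally required to be nonnegative; without this the negative of the norm of a Riemannian metric on the sphere would be a non-Riemannian Berwald Finsler metric and the claim would be false. *)

theory Defs
  imports "HOL-Analysis.Analysis"
begin

section \<open>Smooth maps\<close>

text \<open>Intended for open sets \<open>S\<close> only, since the derivatives are taken in the full space.\<close>

primrec Ck_on :: "nat \<Rightarrow> ('a::real_normed_vector) set \<Rightarrow> ('a \<Rightarrow> 'b::real_normed_vector) \<Rightarrow> bool" where
  "Ck_on 0 S f \<longleftrightarrow> continuous_on S f"
| "Ck_on (Suc k) S f \<longleftrightarrow>
     (\<forall>x\<in>S. f differentiable (at x)) \<and> (\<forall>v. Ck_on k S (\<lambda>x. frechet_derivative f (at x) v))"

definition smooth_on :: "('a::real_normed_vector) set \<Rightarrow> ('a \<Rightarrow> 'b::real_normed_vector) \<Rightarrow> bool" where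
  "smooth_on S f \<longleftrightarrow> (\<forall>k. Ck_on k S f)"


section \<open>Submanifolds of Euclidean spaces and their tangent bundles\<close>

text \<open>
  Manifolds are embedded submanifolds \<open>M\<close> (without boundary) of a Euclidean space, and their open
  subsets are again such submanifolds. Local coordinates \<open>u = (u\<^sup>1,\<dots>,u\<^sup>n)\<close> on \<open>M\<close> are given by their
  inverse \<open>\<phi>\<close>, a regular parametrization of an open subset of \<open>M\<close>. The dimension is the
  cardinality of the index type \<open>'n\<close>; where it cannot be inferred it is passed as \<open>TYPE('n)\<close>.
\<close>

definition local_param :: "('a::euclidean_space) set \<Rightarrow> (real^'n) set \<Rightarrow> (real^'n \<Rightarrow> 'a) \<Rightarrow> bool" where
  "local_param M W \<phi> \<longleftrightarrow>
     open W \<and> smooth_on W \<phi> \<and> (\<forall>x\<in>W. inj (frechet_derivative \<phi> (at x))) \<and>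
     openin (top_of_set M) (\<phi> ` W) \<and> (\<exists>u. homeomorphism W (\<phi> ` W) \<phi> u)"

definition embedded_submanifold :: "'n::finite itself \<Rightarrow> ('a::euclidean_space) set \<Rightarrow> bool" where
  "embedded_submanifold (T :: 'n itself) M \<longleftrightarrow>
     (\<forall>p\<in>M. \<exists>(W :: (real^'n) set) \<phi>. local_param M W \<phi> \<and> p \<in> \<phi> ` W)"

definition smooth_function :: "'n::finite itself \<Rightarrow> ('a::euclidean_space) set \<Rightarrow> ('a \<Rightarrow> real) \<Rightarrow> bool" where
  "smooth_function (T :: 'n itself) M f \<longleftrightarrow>
     (\<forall>(W :: (real^'n) set) \<phi>. local_param M W \<phi> \<longrightarrow> smooth_on W (f \<circ> \<phi>))"

definition tangent_space :: "('a::euclidean_space) set \<Rightarrow> 'a \<Rightarrow> 'a set" where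
  "tangent_space M p = {v. \<exists>\<epsilon>>0. \<exists>c :: real \<Rightarrow> 'a. smooth_on {-\<epsilon><..<\<epsilon>} c \<and> c ` {-\<epsilon><..<\<epsilon>} \<subseteq> M \<and>
     c 0 = p \<and> (c has_vector_derivative v) (at 0)}"

definition tangent_bundle :: "('a::euclidean_space) set \<Rightarrow> ('a \<times> 'a) set" where
  "tangent_bundle M = (SIGMA p:M. tangent_space M p)"

text \<open>
  The inverse of the induced coordinates \<open>(x,y)\<close> on the tangent bundle, and the partial derivatives
  of functions of \<open>(x,y)\<close>.
\<close>

definition tangent_param :: "(real^'n \<Rightarrow> 'a::euclidean_space) \<Rightarrow> (real^'n) \<times> (real^'n) \<Rightarrow> 'a \<times> 'a" where
  "tangent_param \<phi> = (\<lambda>(x, y). (\<phi> x, frechet_derivative \<phi> (at x) y))"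

definition partial_x :: "'n \<Rightarrow> ((real^'n) \<times> (real^'n) \<Rightarrow> real) \<Rightarrow> (real^'n) \<times> (real^'n) \<Rightarrow> real" where
  "partial_x i f z = frechet_derivative f (at z) (axis i 1, 0)"

definition partial_y :: "'n \<Rightarrow> ((real^'n) \<times> (real^'n) \<Rightarrow> real) \<Rightarrow> (real^'n) \<times> (real^'n) \<Rightarrow> real" where
  "partial_y i f z = frechet_derivative f (at z) (0, axis i 1)"

definition partial :: "'n \<Rightarrow> (real^'n \<Rightarrow> real) \<Rightarrow> real^'n \<Rightarrow> real" where
  "partial i f x = frechet_derivative f (at x) (axis i 1)"


section \<open>Finsler and Riemannian metrics\<close>

definition energy :: "('a \<times> 'a \<Rightarrow> real) \<Rightarrow> (real^'n \<Rightarrow> 'a::euclidean_space) \<Rightarrow> (real^'n) \<times> (real^'n) \<Rightarrow> real" where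
  "energy F \<phi> z = (F (tangent_param \<phi> z))\<^sup>2 / 2"

definition fundamental_tensor ::
  "('a \<times> 'a \<Rightarrow> real) \<Rightarrow> (real^'n \<Rightarrow> 'a::euclidean_space) \<Rightarrow> (real^'n) \<times> (real^'n) \<Rightarrow> real^'n^'n" where
  "fundamental_tensor F \<phi> z = (\<chi> i j. partial_y i (partial_y j (energy F \<phi>)) z)"

text \<open>
  Finsler metrics take nonnegative values. This has to be required explicitly: the negative of a
  Riemannian norm satisfies all the other conditions.
\<close>

definition finsler_metric :: "'n::finite itself \<Rightarrow> ('a::euclidean_space) set \<Rightarrow> ('a \<times> 'a \<Rightarrow> real) \<Rightarrow> bool" where
  "finsler_metric (T :: 'n itself) M F \<longleftrightarrow>
     embedded_submanifold T M \<and>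
     continuous_on (tangent_bundle M) F \<and>
     (\<forall>z\<in>tangent_bundle M. F z \<ge> 0) \<and>
     (\<forall>(p, v)\<in>tangent_bundle M. \<forall>t>0. F (p, t *\<^sub>R v) = t * F (p, v)) \<and>
     (\<forall>(W :: (real^'n) set) \<phi>. local_param M W \<phi> \<longrightarrow>
        smooth_on (W \<times> (- {0})) (F \<circ> tangent_param \<phi>) \<and>
        (\<forall>z \<in> W \<times> (- {0}). \<forall>w. w \<noteq> 0 \<longrightarrow> w \<bullet> (fundamental_tensor F \<phi> z *v w) > 0))"

definition riemannian_metric_tensor ::
  "'n::finite itself \<Rightarrow> ('a::euclidean_space) set \<Rightarrow> ('a \<Rightarrow> 'a \<Rightarrow> 'a \<Rightarrow> real) \<Rightarrow> bool" where
  "riemannian_metric_tensor (T :: 'n itself) M g \<longleftrightarrow>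
     embedded_submanifold T M \<and>
     (\<forall>p\<in>M. \<forall>u\<in>tangent_space M p. \<forall>v\<in>tangent_space M p.
        g p u v = g p v u \<and>
        (\<forall>w\<in>tangent_space M p. g p (u + v) w = g p u w + g p v w) \<and>
        (\<forall>t. g p (t *\<^sub>R u) v = t * g p u v) \<and>
        (u \<noteq> 0 \<longrightarrow> g p u u > 0)) \<and>
     (\<forall>(W :: (real^'n) set) \<phi>. local_param M W \<phi> \<longrightarrow>
        (\<forall>i j. smooth_on W (\<lambda>x. g (\<phi> x) (frechet_derivative \<phi> (at x) (axis i 1))
                                        (frechet_derivative \<phi> (at x) (axis j 1)))))"

definition is_riemannian :: "'n::finite itself \<Rightarrow> ('a::euclidean_space) set \<Rightarrow> ('a \<times> 'a \<Rightarrow> real) \<Rightarrow> bool" where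
  "is_riemannian T M F \<longleftrightarrow>
     (\<exists>g. riemannian_metric_tensor T M g \<and> (\<forall>(p, v)\<in>tangent_bundle M. F (p, v) = sqrt (g p v v)))"


section \<open>Berwald and locally Minkowski metrics\<close>

definition spray_coeff ::
  "('a \<times> 'a \<Rightarrow> real) \<Rightarrow> (real^'n \<Rightarrow> 'a::euclidean_space) \<Rightarrow> 'n \<Rightarrow> (real^'n) \<times> (real^'n) \<Rightarrow> real" where
  "spray_coeff F \<phi> l z =
     (1/2) * (\<Sum>m\<in>UNIV. matrix_inv (fundamental_tensor F \<phi> z) $ l $ m *
       ((\<Sum>k\<in>UNIV. snd z $ k * partial_y m (partial_x k (energy F \<phi>)) z) - partial_x m (energy F \<phi>) z))"

definition mixed_curvature ::
  "('a \<times> 'a \<Rightarrow> real) \<Rightarrow> (real^'n \<Rightarrow> 'a::euclidean_space) \<Rightarrow> 'n \<Rightarrow> 'n \<Rightarrow> 'n \<Rightarrow> 'n \<Rightarrow>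
     (real^'n) \<times> (real^'n) \<Rightarrow> real" where
  "mixed_curvature F \<phi> l i j k z = - partial_y i (partial_y j (partial_y k (spray_coeff F \<phi> l))) z"

definition berwald_metric :: "'n::finite itself \<Rightarrow> ('a::euclidean_space) set \<Rightarrow> ('a \<times> 'a \<Rightarrow> real) \<Rightarrow> bool" where
  "berwald_metric (T :: 'n itself) M F \<longleftrightarrow>
     finsler_metric T M F \<and>
     (\<forall>(W :: (real^'n) set) \<phi>. local_param M W \<phi> \<longrightarrow>
        (\<forall>z \<in> W \<times> (- {0}). \<forall>l i j k. mixed_curvature F \<phi> l i j k z = 0))"

text \<open>
  A linear connection is given by its Christoffel symbols, where \<open>\<Gamma> \<phi> x l i j\<close> is the
  \<open>l\<close>-th coordinate of the covariant derivative of the \<open>j\<close>-th coordinate field in the direction of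
  the \<open>i\<close>-th one, at the point \<open>\<phi> x\<close>. The last clause is the transformation rule under the change
  of coordinates \<open>\<tau>\<close>.
\<close>

definition linear_connection ::
  "('a::euclidean_space) set \<Rightarrow> ((real^'n \<Rightarrow> 'a) \<Rightarrow> real^'n \<Rightarrow> 'n \<Rightarrow> 'n \<Rightarrow> 'n \<Rightarrow> real) \<Rightarrow> bool" where
  "linear_connection M \<Gamma> \<longleftrightarrow>
     (\<forall>W \<phi>. local_param M W \<phi> \<longrightarrow> (\<forall>l i j. smooth_on W (\<lambda>x. \<Gamma> \<phi> x l i j))) \<and>
     (\<forall>W \<phi> W' \<phi>'. local_param M W \<phi> \<longrightarrow> local_param M W' \<phi>' \<longrightarrow>
        (\<forall>x\<in>W. \<phi> x \<in> \<phi>' ` W' \<longrightarrow>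
          (let \<tau> = (\<lambda>s. inv_into W' \<phi>' (\<phi> s)) in
            \<forall>m i j.
              (\<Sum>l\<in>UNIV. \<Gamma> \<phi> x l i j * partial l (\<lambda>s. \<tau> s $ m) x) =
              partial i (partial j (\<lambda>s. \<tau> s $ m)) x +
              (\<Sum>a\<in>UNIV. \<Sum>b\<in>UNIV. \<Gamma> \<phi>' (\<tau> x) m a b *
                 partial i (\<lambda>s. \<tau> s $ a) x * partial j (\<lambda>s. \<tau> s $ b) x))))"

definition torsion_free ::
  "('a::euclidean_space) set \<Rightarrow> ((real^'n \<Rightarrow> 'a) \<Rightarrow> real^'n \<Rightarrow> 'n \<Rightarrow> 'n \<Rightarrow> 'n \<Rightarrow> real) \<Rightarrow> bool" where
  "torsion_free M \<Gamma> \<longleftrightarrow>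
     (\<forall>W \<phi>. local_param M W \<phi> \<longrightarrow> (\<forall>x\<in>W. \<forall>l i j. \<Gamma> \<phi> x l i j = \<Gamma> \<phi> x l j i))"

definition zero_curvature ::
  "('a::euclidean_space) set \<Rightarrow> ((real^'n \<Rightarrow> 'a) \<Rightarrow> real^'n \<Rightarrow> 'n \<Rightarrow> 'n \<Rightarrow> 'n \<Rightarrow> real) \<Rightarrow> bool" where
  "zero_curvature M \<Gamma> \<longleftrightarrow>
     (\<forall>W \<phi>. local_param M W \<phi> \<longrightarrow> (\<forall>x\<in>W. \<forall>l i j k.
        partial i (\<lambda>s. \<Gamma> \<phi> s l j k) x - partial j (\<lambda>s. \<Gamma> \<phi> s l i k) x +
        (\<Sum>m\<in>UNIV. \<Gamma> \<phi> x l i m * \<Gamma> \<phi> x m j k - \<Gamma> \<phi> x l j m * \<Gamma> \<phi> x m i k) = 0))"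

text \<open>
  \<open>V\<close> is a parallel vector field along the curve \<open>c\<close>; \<open>x\<close> and \<open>y\<close> are the coordinates of the curve
  and of the field.
\<close>

definition parallel_along ::
  "('a::euclidean_space) set \<Rightarrow> ((real^'n \<Rightarrow> 'a) \<Rightarrow> real^'n \<Rightarrow> 'n \<Rightarrow> 'n \<Rightarrow> 'n \<Rightarrow> real) \<Rightarrow>
     real set \<Rightarrow> (real \<Rightarrow> 'a) \<Rightarrow> (real \<Rightarrow> 'a) \<Rightarrow> bool" where
  "parallel_along M \<Gamma> I c V \<longleftrightarrow>
     smooth_on I c \<and> smooth_on I V \<and> (\<forall>t\<in>I. c t \<in> M \<and> V t \<in> tangent_space M (c t)) \<and>
     (\<forall>W \<phi>. local_param M W \<phi> \<longrightarrow> (\<forall>t\<in>I. c t \<in> \<phi> ` W \<longrightarrow>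
        (let x = (\<lambda>s. inv_into W \<phi> (c s));
             y = (\<lambda>s. inv (frechet_derivative \<phi> (at (x s))) (V s))
         in \<forall>l. vector_derivative y (at t) $ l +
              (\<Sum>i\<in>UNIV. \<Sum>j\<in>UNIV. \<Gamma> \<phi> (x t) l i j * vector_derivative x (at t) $ i * y t $ j) = 0)))"

definition compatible ::
  "('a::euclidean_space) set \<Rightarrow> ((real^'n \<Rightarrow> 'a) \<Rightarrow> real^'n \<Rightarrow> 'n \<Rightarrow> 'n \<Rightarrow> 'n \<Rightarrow> real) \<Rightarrow>
     ('a \<times> 'a \<Rightarrow> real) \<Rightarrow> bool" where
  "compatible M \<Gamma> F \<longleftrightarrow>
     (\<forall>a b c V. parallel_along M \<Gamma> {a<..<b} c V \<longrightarrow>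
        (\<forall>s\<in>{a<..<b}. \<forall>t\<in>{a<..<b}. F (c s, V s) = F (c t, V t)))"

text \<open>The torsion-free compatible connection of a Berwald metric is unique.\<close>

definition locally_minkowski :: "'n::finite itself \<Rightarrow> ('a::euclidean_space) set \<Rightarrow> ('a \<times> 'a \<Rightarrow> real) \<Rightarrow> bool" where
  "locally_minkowski (T :: 'n itself) M F \<longleftrightarrow>
     berwald_metric T M F \<and>
     (\<exists>\<Gamma> :: (real^'n \<Rightarrow> 'a) \<Rightarrow> real^'n \<Rightarrow> 'n \<Rightarrow> 'n \<Rightarrow> 'n \<Rightarrow> real.
        linear_connection M \<Gamma> \<and> torsion_free M \<Gamma> \<and> compatible M \<Gamma> F \<and> zero_curvature M \<Gamma>)"


section \<open>Conformal equivalence\<close>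

definition conformally_equivalent ::
  "'n::finite itself \<Rightarrow> ('a::euclidean_space) set \<Rightarrow> ('a \<times> 'a \<Rightarrow> real) \<Rightarrow> ('a \<times> 'a \<Rightarrow> real) \<Rightarrow> bool" where
  "conformally_equivalent T M F F' \<longleftrightarrow>
     finsler_metric T M F \<and> finsler_metric T M F' \<and>
     (\<exists>\<alpha>. smooth_function T M \<alpha> \<and> (\<forall>(p, v)\<in>tangent_bundle M. F' (p, v) = exp (\<alpha> p) * F (p, v)))"

definition locally_conformally_berwald ::
  "'n::finite itself \<Rightarrow> ('a::euclidean_space) set \<Rightarrow> ('a \<times> 'a \<Rightarrow> real) \<Rightarrow> bool" where
  "locally_conformally_berwald T M F \<longleftrightarrow>
     (\<forall>p\<in>M. \<exists>U F'. openin (top_of_set M) U \<and> p \<in> U \<and>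
        conformally_equivalent T U F F' \<and> berwald_metric T U F')"

definition locally_conformally_flat ::
  "'n::finite itself \<Rightarrow> ('a::euclidean_space) set \<Rightarrow> ('a \<times> 'a \<Rightarrow> real) \<Rightarrow> bool" where
  "locally_conformally_flat T M F \<longleftrightarrow>
     (\<forall>p\<in>M. \<exists>U F'. openin (top_of_set M) U \<and> p \<in> U \<and>
        conformally_equivalent T U F F' \<and> locally_minkowski T U F')"

end

theory Submission
  imports Defs
begin

text \<open>
  The argument compares the Finsler norms of the tangent planes at different points of the sphere.

  \<^item> In a Berwald space the spray coefficients are quadratic in the velocity, and the energy is
  constant along the parallel transports of the resulting linear connection
  (\<open>berwald_energy_derivative\<close>, \<open>parallel_transport_preserves\<close>). Hence, for a locally
  conformally Berwald metric, the norms of nearby tangent planes differ only by a linear isomorphism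
  (\<open>locally_conformally_berwald_equivalence\<close>; the conformal factor is absorbed in the isomorphism).

  \<^item> Every norm of a plane determines, up to a factor, a scalar product in which the second moments of
  a density built from the norm are isotropic. An oriented isometry with \<open>\<complex>\<close>, unique up to a complex factor, is
  the \<open>iso_frame\<close>. The moments \<open>frame_moment k l\<close> of \<open>z\<^sup>k cnj z\<^sup>l\<close> in this
  frame are multiplied by a nonzero number, and possibly conjugated, under linear isomorphisms of norms.
  So each of them vanishes either everywhere or nowhere (\<open>frame_moment_vanish_locally_constant\<close>).

  \<^item> If all moments with \<open>k \<noteq> l\<close> vanish, then by the Weierstrass approximation theorem the
  norm is invariant under the rotations of its frame, hence Euclidean
  (\<open>frame_moment_vanish_imp_euclidean\<close>), and the metric is Riemannian.

  \<^item> Otherwise some \<open>frame_moment k l\<close> with \<open>k > l\<close> has no zero. In the two stereographic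
  charts, whose transition map is \<open>z \<mapsto> 1/z\<close> with derivative the multiplication by
  \<open>- 1/z\<^sup>2\<close>, its direction is a nowhere vanishing section of the power of order
  \<open>k - l\<close> of the tangent line bundle of the Riemann sphere. That bundle has degree
  \<open>2 (k - l) \<noteq> 0\<close>, so there is no such section (\<open>no_nonvanishing_section\<close>).

  Locally Minkowski metrics are Berwald metrics, so the second claim follows from the first.
\<close>

section \<open>Calculus of smooth maps\<close>

lemma Ck_on_cong:
  assumes "open S" "\<And>x. x \<in> S \<Longrightarrow> f x = g x" "Ck_on k S f"
  shows "Ck_on k S g"
  using assms(2,3)
proof (induction k arbitrary: f g)
  case 0
  then show ?case by (simp cong: continuous_on_cong)
next
  case (Suc k)
  have d: "(g has_derivative frechet_derivative f (at x)) (at x)" if "x \<in> S" for x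
  proof (rule has_derivative_transform_within_open[OF _ assms(1) that])
    show "(f has_derivative frechet_derivative f (at x)) (at x)"
      using Suc.prems(2) that by (simp add: frechet_derivative_works[symmetric])
  qed (use Suc.prems(1) in auto)
  have eq: "frechet_derivative g (at x) = frechet_derivative f (at x)" if "x \<in> S" for x
    using d[OF that] by (simp add: frechet_derivative_at[symmetric])
  show ?case
    unfolding Ck_on.simps
  proof (intro conjI ballI allI)
    show "g differentiable at x" if "x \<in> S" for x using d[OF that] differentiableI by blast
    show "Ck_on k S (\<lambda>x. frechet_derivative g (at x) v)" for v
      using Suc.IH[of "\<lambda>x. frechet_derivative f (at x) v"] Suc.prems eq by auto
  qed
qed

lemma Ck_on_SucD: "Ck_on (Suc k) S f \<Longrightarrow> Ck_on k S f"
proof (induction k arbitrary: f)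
  case 0
  then show ?case
    by (auto intro!: continuous_at_imp_continuous_on differentiable_imp_continuous_within)
next
  case (Suc k)
  then show ?case by (metis Ck_on.simps(2))
qed

lemma Ck_on_subset: "Ck_on k S f \<Longrightarrow> S' \<subseteq> S \<Longrightarrow> Ck_on k S' f"
  by (induction k arbitrary: f) (auto intro: continuous_on_subset)

lemma Ck_on_SucI:
  assumes "open S" "\<And>x. x \<in> S \<Longrightarrow> (f has_derivative f' x) (at x)" "\<And>v. Ck_on k S (\<lambda>x. f' x v)"
  shows "Ck_on (Suc k) S f"
  unfolding Ck_on.simps
proof (intro conjI ballI allI)
  show "f differentiable at x" if "x \<in> S" for x using assms(2)[OF that] differentiableI by blast
  show "Ck_on k S (\<lambda>x. frechet_derivative f (at x) v)" for v
    by (rule Ck_on_cong[OF assms(1) _ assms(3)[of v]]) (simp add: frechet_derivative_at[OF assms(2), symmetric])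
qed

lemma Ck_on_has_derivative:
  "Ck_on (Suc k) S f \<Longrightarrow> x \<in> S \<Longrightarrow> (f has_derivative frechet_derivative f (at x)) (at x)"
  using frechet_derivative_works by auto

lemma Ck_on_const: "Ck_on k S (\<lambda>x. c)"
  by (induction k arbitrary: c) auto

lemma Ck_on_bounded_linear:
  assumes "open S" "bounded_linear L" shows "Ck_on k S (\<lambda>x. L x)"
proof (cases k)
  case 0
  then show ?thesis using assms by (simp add: linear_continuous_on)
next
  case (Suc j)
  show ?thesis unfolding Suc
    by (rule Ck_on_SucI[OF assms(1), where f' = "\<lambda>_. L"])
       (auto intro: bounded_linear_imp_has_derivative assms Ck_on_const)
qed

lemma Ck_on_add:
  assumes "open S" "Ck_on k S f" "Ck_on k S g" shows "Ck_on k S (\<lambda>x. f x + g x)"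
  using assms(2,3)
proof (induction k arbitrary: f g)
  case 0
  then show ?case by (simp add: continuous_on_add)
next
  case (Suc k)
  show ?case
    by (rule Ck_on_SucI[OF assms(1) has_derivative_add[OF Ck_on_has_derivative[OF Suc.prems(1)]
          Ck_on_has_derivative[OF Suc.prems(2)]]])
       (use Suc in auto)
qed

lemma Ck_on_scaleR:
  assumes "open S" "Ck_on k S f" "Ck_on k S g" shows "Ck_on k S (\<lambda>x. f x *\<^sub>R g x)"
  using assms(2,3)
proof (induction k arbitrary: f g)
  case 0
  then show ?case by (simp add: continuous_on_scaleR)
next
  case (Suc k)
  show ?case
  proof (rule Ck_on_SucI[OF assms(1) has_derivative_scaleR[OF Ck_on_has_derivative[OF Suc.prems(1)]
          Ck_on_has_derivative[OF Suc.prems(2)]]])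
    show "Ck_on k S (\<lambda>x. f x *\<^sub>R frechet_derivative g (at x) v + frechet_derivative f (at x) v *\<^sub>R g x)" for v
      using Suc.prems Suc.prems[THEN Ck_on_SucD] by (intro Ck_on_add assms Suc.IH) auto
  qed
qed

lemma Ck_on_inverse:
  fixes f :: "'a::real_normed_vector \<Rightarrow> real"
  assumes "open S" "Ck_on k S f" "\<And>x. x \<in> S \<Longrightarrow> f x \<noteq> 0" shows "Ck_on k S (\<lambda>x. inverse (f x))"
  using assms(2)
proof (induction k)
  case 0
  then show ?case using assms(3) by (auto intro: continuous_on_inverse)
next
  case (Suc k)
  have i: "Ck_on k S (\<lambda>x. inverse (f x))" using Suc by (metis Ck_on_SucD)
  show ?case
  proof (rule Ck_on_SucI[OF assms(1)])
    show "((\<lambda>x. inverse (f x)) has_derivative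
       (\<lambda>v. (inverse (f x) * inverse (f x)) *\<^sub>R ((-1) *\<^sub>R frechet_derivative f (at x) v))) (at x)"
      if "x \<in> S" for x
      using Deriv.has_derivative_inverse[OF assms(3)[OF that] Ck_on_has_derivative[OF Suc.prems that]]
      by (simp add: algebra_simps)
    show "Ck_on k S (\<lambda>x. (inverse (f x) * inverse (f x)) *\<^sub>R ((-1) *\<^sub>R frechet_derivative f (at x) v))" for v
      using Suc.prems i Ck_on_scaleR[OF assms(1) i i]
      by (intro Ck_on_scaleR assms Ck_on_const) auto
  qed
qed

lemma Ck_on_affine_compose:
  assumes "open S" "open T" "bounded_linear L" "\<And>x. x \<in> S \<Longrightarrow> c + L x \<in> T" "Ck_on k T f"
  shows "Ck_on k S (\<lambda>x. f (c + L x))"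
  using assms(5)
proof (induction k arbitrary: f)
  case 0
  have "continuous_on S (\<lambda>x. c + L x)"
    by (intro continuous_intros linear_continuous_on assms)
  then show ?case using 0 assms(4) continuous_on_compose2[of T f S "\<lambda>x. c + L x"] by auto
next
  case (Suc k)
  show ?case
  proof (rule Ck_on_SucI[OF assms(1)])
    show "((\<lambda>x. f (c + L x)) has_derivative (\<lambda>v. frechet_derivative f (at (c + L x)) (L v))) (at x)"
      if "x \<in> S" for x
    proof -
      have "((\<lambda>x. c + L x) has_derivative L) (at x)"
        using has_derivative_add[OF has_derivative_const bounded_linear_imp_has_derivative[OF assms(3)]] by simp
      from has_derivative_compose[OF this Ck_on_has_derivative[OF Suc.prems assms(4)[OF that]]]
      show ?thesis .
    qed
    show "Ck_on k S (\<lambda>x. frechet_derivative f (at (c + L x)) (L v))" for v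
      using Suc by auto
  qed
qed

lemma smooth_on_cong:
  "open S \<Longrightarrow> (\<And>x. x \<in> S \<Longrightarrow> f x = g x) \<Longrightarrow> smooth_on S f \<Longrightarrow> smooth_on S g"
  unfolding smooth_on_def using Ck_on_cong by blast

lemma smooth_on_subset: "smooth_on S f \<Longrightarrow> S' \<subseteq> S \<Longrightarrow> smooth_on S' f"
  unfolding smooth_on_def using Ck_on_subset by blast

lemma smooth_on_const: "smooth_on S (\<lambda>x. c)"
  unfolding smooth_on_def using Ck_on_const by blast

lemma smooth_on_bounded_linear: "open S \<Longrightarrow> bounded_linear L \<Longrightarrow> smooth_on S (\<lambda>x. L x)"
  unfolding smooth_on_def using Ck_on_bounded_linear by blast

lemma smooth_on_add: "open S \<Longrightarrow> smooth_on S f \<Longrightarrow> smooth_on S g \<Longrightarrow> smooth_on S (\<lambda>x. f x + g x)"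
  unfolding smooth_on_def using Ck_on_add by blast

lemma smooth_on_scaleR:
  "open S \<Longrightarrow> smooth_on S f \<Longrightarrow> smooth_on S g \<Longrightarrow> smooth_on S (\<lambda>x. f x *\<^sub>R g x)"
  unfolding smooth_on_def using Ck_on_scaleR by blast

lemma smooth_on_mult:
  fixes f g :: "_ \<Rightarrow> real"
  shows "open S \<Longrightarrow> smooth_on S f \<Longrightarrow> smooth_on S g \<Longrightarrow> smooth_on S (\<lambda>x. f x * g x)"
  using smooth_on_scaleR[of S f g] by simp

lemma smooth_on_diff:
  "open S \<Longrightarrow> smooth_on S f \<Longrightarrow> smooth_on S g \<Longrightarrow> smooth_on S (\<lambda>x. f x - g x)"
  using smooth_on_add[of S f "\<lambda>x. (-1) *\<^sub>R g x"] smooth_on_scaleR[of S "\<lambda>x. -1" g] smooth_on_const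
  by force

lemma smooth_on_sum:
  "open S \<Longrightarrow> (\<And>i. i \<in> I \<Longrightarrow> smooth_on S (f i)) \<Longrightarrow> smooth_on S (\<lambda>x. \<Sum>i\<in>I. f i x)"
  by (induction I rule: infinite_finite_induct) (auto intro: smooth_on_const smooth_on_add)

lemma smooth_on_prod:
  fixes f :: "_ \<Rightarrow> _ \<Rightarrow> real"
  shows "open S \<Longrightarrow> (\<And>i. i \<in> I \<Longrightarrow> smooth_on S (f i)) \<Longrightarrow> smooth_on S (\<lambda>x. \<Prod>i\<in>I. f i x)"
  by (induction I rule: infinite_finite_induct) (auto intro: smooth_on_const smooth_on_mult)

lemma smooth_on_inverse:
  fixes f :: "_ \<Rightarrow> real"
  shows "open S \<Longrightarrow> smooth_on S f \<Longrightarrow> (\<And>x. x \<in> S \<Longrightarrow> f x \<noteq> 0) \<Longrightarrow> smooth_on S (\<lambda>x. inverse (f x))"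
  unfolding smooth_on_def using Ck_on_inverse by blast

lemma smooth_on_affine_compose:
  "open S \<Longrightarrow> open T \<Longrightarrow> bounded_linear L \<Longrightarrow> (\<And>x. x \<in> S \<Longrightarrow> c + L x \<in> T) \<Longrightarrow> smooth_on T f \<Longrightarrow>
    smooth_on S (\<lambda>x. f (c + L x))"
  unfolding smooth_on_def using Ck_on_affine_compose by blast

lemma smooth_on_has_derivative:
  "smooth_on S f \<Longrightarrow> x \<in> S \<Longrightarrow> (f has_derivative frechet_derivative f (at x)) (at x)"
  unfolding smooth_on_def using Ck_on_has_derivative[of 0] by blast

lemma smooth_on_imp_continuous_on: "smooth_on S f \<Longrightarrow> continuous_on S f"
  unfolding smooth_on_def using Ck_on.simps(1) by blast

lemma smooth_on_frechet_derivative: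
  "smooth_on S f \<Longrightarrow> smooth_on S (\<lambda>x. frechet_derivative f (at x) v)"
  unfolding smooth_on_def using Ck_on.simps(2) by blast

lemmas smooth_intros = smooth_on_const smooth_on_add smooth_on_mult smooth_on_diff smooth_on_sum
  smooth_on_prod smooth_on_inverse smooth_on_frechet_derivative smooth_on_scaleR

lemma smooth_on_partial_x: "smooth_on S f \<Longrightarrow> smooth_on S (partial_x i f)"
  using smooth_on_frechet_derivative[of S f] unfolding partial_x_def[abs_def] .

lemma smooth_on_partial_y: "smooth_on S f \<Longrightarrow> smooth_on S (partial_y i f)"
  using smooth_on_frechet_derivative[of S f] unfolding partial_y_def[abs_def] .

section \<open>The spray of a Finsler metric and the Berwald condition\<close>

lemma frechet_derivative_expand:
  fixes f :: "(real^'n) \<times> (real^'n) \<Rightarrow> real"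
  assumes "f differentiable (at z)"
  shows "frechet_derivative f (at z) (u, v) =
    (\<Sum>i\<in>UNIV. u $ i * partial_x i f z) + (\<Sum>i\<in>UNIV. v $ i * partial_y i f z)"
proof -
  let ?D = "frechet_derivative f (at z)"
  interpret linear ?D
    using assms frechet_derivative_works has_derivative_linear by blast
  have "(u, v) = (\<Sum>i\<in>UNIV. u $ i *\<^sub>R (axis i 1, 0)) + (\<Sum>i\<in>UNIV. v $ i *\<^sub>R (0, axis i 1))"
    using basis_expansion[of u] basis_expansion[of v]
    by (simp add: sum_prod scaleR_vec_def[symmetric] scalar_mult_eq_scaleR)
  then have "?D (u, v) = ?D ((\<Sum>i\<in>UNIV. u $ i *\<^sub>R (axis i 1, 0)) + (\<Sum>i\<in>UNIV. v $ i *\<^sub>R (0, axis i 1)))"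
    by simp
  also have "\<dots> = (\<Sum>i\<in>UNIV. u $ i * partial_x i f z) + (\<Sum>i\<in>UNIV. v $ i * partial_y i f z)"
    by (simp only: add sum scale partial_x_def partial_y_def real_scaleR_def)
  finally show ?thesis .
qed

lemma euler_identity:
  fixes f :: "(real^'n) \<times> (real^'n) \<Rightarrow> real"
  assumes "f differentiable (at (x, y))" "\<And>t. t > 0 \<Longrightarrow> f (x, t *\<^sub>R y) = t ^ d * f (x, y)"
  shows "(\<Sum>i\<in>UNIV. y $ i * partial_y i f (x, y)) = d * f (x, y)"
proof -
  let ?D = "frechet_derivative f (at (x, y))"
  have D: "(f has_derivative ?D) (at (x, 1 *\<^sub>R y))"
    using assms(1) unfolding frechet_derivative_works by simp
  have c: "((\<lambda>t. (x, t *\<^sub>R y)) has_derivative (\<lambda>t. (0, t *\<^sub>R y))) (at (1::real))"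
    by (auto intro!: derivative_eq_intros)
  have 1: "((\<lambda>t. f (x, t *\<^sub>R y)) has_derivative (\<lambda>t. ?D (0, t *\<^sub>R y))) (at 1)"
    by (rule has_derivative_compose[OF c D])
  have "((\<lambda>t::real. t ^ d * f (x, y)) has_derivative (\<lambda>t. t * (d * f (x, y)))) (at 1)"
    by (auto intro!: derivative_eq_intros)
  then have 2: "((\<lambda>t. f (x, t *\<^sub>R y)) has_derivative (\<lambda>t. t * (d * f (x, y)))) (at 1)"
    by (rule has_derivative_transform_within_open[OF _ open_greaterThan[of 0]]) (auto simp: assms(2))
  have "?D (0, 1 *\<^sub>R y) = 1 * (d * f (x, y))"
    using has_derivative_unique[OF 1 2] by metis
  then show ?thesis
    using frechet_derivative_expand[OF assms(1), of 0 y] by simp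
qed

lemma derivative_homogeneous:
  fixes f :: "('a::real_normed_vector) \<times> ('b::real_normed_vector) \<Rightarrow> real"
  assumes "open S" "\<And>z. z \<in> S \<Longrightarrow> f differentiable (at z)"
    and "\<And>x y. (x, y) \<in> S \<Longrightarrow> (x, t *\<^sub>R y) \<in> S \<and> f (x, t *\<^sub>R y) = c * f (x, y)"
    and "(x, y) \<in> S"
  shows "frechet_derivative f (at (x, t *\<^sub>R y)) (u, t *\<^sub>R v) = c * frechet_derivative f (at (x, y)) (u, v)"
proof -
  have D: "(f has_derivative frechet_derivative f (at z)) (at z)" if "z \<in> S" for z
    using assms(2)[OF that] frechet_derivative_works by blast
  have s: "((\<lambda>z. (fst z, t *\<^sub>R snd z)) has_derivative (\<lambda>w. (fst w, t *\<^sub>R snd w))) (at (x, y))"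
    by (auto intro!: derivative_eq_intros)
  have 1: "((\<lambda>z. f (fst z, t *\<^sub>R snd z)) has_derivative
      (\<lambda>w. frechet_derivative f (at (x, t *\<^sub>R y)) (fst w, t *\<^sub>R snd w))) (at (x, y))"
    by (rule has_derivative_compose[OF s]) (use D assms(3,4) in auto)
  have "((\<lambda>z. c * f z) has_derivative (\<lambda>w. c * frechet_derivative f (at (x, y)) w)) (at (x, y))"
    by (rule has_derivative_mult_right[OF D[OF assms(4)]])
  then have 2: "((\<lambda>z. f (fst z, t *\<^sub>R snd z)) has_derivative (\<lambda>w. c * frechet_derivative f (at (x, y)) w)) (at (x, y))"
    by (rule has_derivative_transform_within_open[OF _ assms(1,4)]) (use assms(3) in auto)
  from has_derivative_unique[OF 1 2] show ?thesis by (metis fst_conv snd_conv)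
qed

lemma partial_homogeneous:
  fixes f :: "(real^'n) \<times> (real^'n) \<Rightarrow> real"
  assumes W: "open W" and sm: "smooth_on (W \<times> (-{0})) f"
    and hom: "\<And>x y t. x \<in> W \<Longrightarrow> y \<noteq> 0 \<Longrightarrow> t > 0 \<Longrightarrow> f (x, t *\<^sub>R y) = t ^ d * f (x, y)"
    and xy: "x \<in> W" "y \<noteq> 0" "t > 0"
  shows "partial_x k f (x, t *\<^sub>R y) = t ^ d * partial_x k f (x, y)"
    and "t * partial_y k f (x, t *\<^sub>R y) = t ^ d * partial_y k f (x, y)"
proof -
  let ?S = "W \<times> (-{0 :: real^'n})"
  have oS: "open ?S" using W by (intro open_Times) auto
  have "f differentiable (at z)" if "z \<in> ?S" for z
    using smooth_on_has_derivative[OF sm that] differentiableI by blast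
  then have D: "frechet_derivative f (at (x, t *\<^sub>R y)) (u, t *\<^sub>R v) = t ^ d * frechet_derivative f (at (x, y)) (u, v)" for u v
    by (rule derivative_homogeneous[OF oS]) (use hom xy in auto)
  show "partial_x k f (x, t *\<^sub>R y) = t ^ d * partial_x k f (x, y)"
    using D[of "axis k 1" 0] by (simp add: partial_x_def)
  have "(x, t *\<^sub>R y) \<in> ?S" using xy by auto
  then show "t * partial_y k f (x, t *\<^sub>R y) = t ^ d * partial_y k f (x, y)"
    using D[of 0 "axis k 1"]
      linear_scale[OF has_derivative_linear[OF smooth_on_has_derivative[OF sm]], of "(x, t *\<^sub>R y)" t "(0, axis k 1)"]
    by (simp add: partial_y_def)
qed

lemma smooth_on_det:
  fixes A :: "'a::real_normed_vector \<Rightarrow> real^'n^'n"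
  assumes "open S" "\<And>i j. smooth_on S (\<lambda>z. A z $ i $ j)"
  shows "smooth_on S (\<lambda>z. det (A z))"
  unfolding det_def using assms by (intro smooth_intros) auto

lemma pos_def_invertible:
  fixes A :: "real^'n^'n"
  assumes "\<And>w. w \<noteq> 0 \<Longrightarrow> w \<bullet> (A *v w) > 0"
  shows "invertible A"
proof -
  have "inj ((*v) A)"
  proof (rule injI)
    fix u v assume "A *v u = A *v v"
    then have "A *v (u - v) = 0" by (simp add: matrix_vector_mult_diff_distrib)
    then show "u = v" using assms[of "u - v"] by force
  qed
  then show ?thesis
    by (metis invertible_left_inverse matrix_left_invertible_injective)
qed

lemma matrix_inv_solve:
  fixes A :: "real^'n^'n"
  assumes "invertible A" shows "A *v (matrix_inv A *v b) = b"
proof -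
  have "A ** matrix_inv A = mat 1"
    using assms unfolding invertible_def matrix_inv_def by (metis (mono_tags, lifting) someI_ex)
  then show ?thesis by (simp add: matrix_vector_mul_assoc)
qed

text \<open>
  The horizontal derivatives of the energy \<open>E\<close> vanish. The Euler-Lagrange equation \<open>EL\<close>, contracted
  with \<open>y\<close>, says that the spray with coefficients \<open>G\<close> annihilates \<open>E\<close>;
  differentiating this in \<open>y\<close> and subtracting \<open>EL\<close> gives the claim.
\<close>

lemma energy_horizontally_constant:
  fixes E :: "(real^'n) \<times> (real^'n) \<Rightarrow> real"
  assumes "open W" and sm: "smooth_on (W \<times> (-{0})) E"
    and hom: "\<And>x y t. x \<in> W \<Longrightarrow> y \<noteq> 0 \<Longrightarrow> t > 0 \<Longrightarrow> E (x, t *\<^sub>R y) = t\<^sup>2 * E (x, y)"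
    and G: "\<And>l. smooth_on (W \<times> (-{0})) (G l)"
    and EL: "\<And>z m. z \<in> W \<times> (-{0}) \<Longrightarrow> 2 * (\<Sum>l\<in>UNIV. partial_y m (partial_y l E) z * G l z) =
        (\<Sum>k\<in>UNIV. snd z $ k * partial_y m (partial_x k E) z) - partial_x m E z"
    and z: "z \<in> W \<times> (-{0})"
  shows "partial_x m E z = (\<Sum>l\<in>UNIV. partial_y m (G l) z * partial_y l E z)"
proof -
  let ?S = "W \<times> (-{0 :: real^'n})"
  have oS: "open ?S" using assms(1) by (intro open_Times) auto
  have diff: "f differentiable (at z)" if "smooth_on ?S f" "z \<in> ?S" for f :: "_ \<Rightarrow> real" and z
    using smooth_on_has_derivative[OF that] differentiableI by blast
  have hx: "partial_x k E (x, t *\<^sub>R y) = t\<^sup>2 * partial_x k E (x, y)" if "(x, y) \<in> ?S" "t > 0" for x y t k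
    using partial_homogeneous(1)[OF assms(1) sm hom] that by auto
  have hy: "partial_y k E (x, t *\<^sub>R y) = t ^ 1 * partial_y k E (x, y)" if "(x, y) \<in> ?S" "t > 0" for x y t k
    using partial_homogeneous(2)[OF assms(1) sm hom, of x y t] that by (auto simp: power2_eq_square)
  have zero: "(\<Sum>k\<in>UNIV. snd z $ k * partial_x k E z) - 2 * (\<Sum>l\<in>UNIV. G l z * partial_y l E z) = 0"
    if z: "z \<in> ?S" for z
  proof -
    obtain x y where xy: "z = (x, y)" by force
    have e1: "(\<Sum>i\<in>UNIV. y $ i * partial_y i (partial_x k E) z) = 2 * partial_x k E z" for k
      using euler_identity[of "partial_x k E" x y 2] diff[OF smooth_on_partial_x[OF sm]] hx z xy by simp
    have e2: "(\<Sum>i\<in>UNIV. y $ i * partial_y i (partial_y l E) z) = partial_y l E z" for l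
      using euler_identity[of "partial_y l E" x y 1] diff[OF smooth_on_partial_y[OF sm]] hy z xy by simp
    have "2 * (\<Sum>l\<in>UNIV. G l z * partial_y l E z) =
        2 * (\<Sum>l\<in>UNIV. G l z * (\<Sum>m\<in>UNIV. y $ m * partial_y m (partial_y l E) z))"
      by (simp add: e2)
    also have "\<dots> = (\<Sum>m\<in>UNIV. y $ m * (2 * (\<Sum>l\<in>UNIV. partial_y m (partial_y l E) z * G l z)))"
      unfolding sum_distrib_left by (subst sum.swap) (simp add: mult_ac)
    also have "\<dots> = (\<Sum>m\<in>UNIV. y $ m * ((\<Sum>k\<in>UNIV. y $ k * partial_y m (partial_x k E) z) - partial_x m E z))"
      unfolding EL[OF z] by (simp add: xy)
    also have "\<dots> = (\<Sum>k\<in>UNIV. y $ k * (\<Sum>m\<in>UNIV. y $ m * partial_y m (partial_x k E) z))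
        - (\<Sum>m\<in>UNIV. y $ m * partial_x m E z)"
      unfolding right_diff_distrib sum_subtractf sum_distrib_left by (subst sum.swap) (simp add: mult_ac)
    also have "\<dots> = (\<Sum>k\<in>UNIV. y $ k * partial_x k E z)"
      unfolding e1 by (simp add: sum_subtractf[symmetric])
    finally show ?thesis by (simp add: xy)
  qed
  let ?\<Phi> = "\<lambda>z. (\<Sum>k\<in>UNIV. snd z $ k * partial_x k E z) - 2 * (\<Sum>l\<in>UNIV. G l z * partial_y l E z)"
  let ?D = "\<lambda>f. frechet_derivative f (at z)"
  have 1: "(?\<Phi> has_derivative (\<lambda>h.
      (\<Sum>k\<in>UNIV. snd z $ k * ?D (partial_x k E) h + snd h $ k * partial_x k E z)
      - 2 * (\<Sum>l\<in>UNIV. G l z * ?D (partial_y l E) h + ?D (G l) h * partial_y l E z))) (at z)"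
    by (intro has_derivative_diff has_derivative_sum has_derivative_mult has_derivative_mult_right
        smooth_on_has_derivative[OF smooth_on_partial_x[OF sm] z]
        smooth_on_has_derivative[OF smooth_on_partial_y[OF sm] z]
        smooth_on_has_derivative[OF G z] bounded_linear_imp_has_derivative
        bounded_linear_compose[OF bounded_linear_vec_nth bounded_linear_snd])
  have 2: "(?\<Phi> has_derivative (\<lambda>h. 0)) (at z)"
    by (rule has_derivative_transform_within_open[OF has_derivative_const oS z])
       (use zero in auto)
  have "(\<Sum>k\<in>UNIV. snd z $ k * partial_y m (partial_x k E) z + axis m 1 $ k * partial_x k E z)
      - 2 * (\<Sum>l\<in>UNIV. G l z * partial_y m (partial_y l E) z + partial_y m (G l) z * partial_y l E z) = 0"
    using fun_cong[OF has_derivative_unique[OF 1 2], of "(0, axis m 1)"]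
    by (simp add: partial_y_def)
  moreover have "(\<Sum>k\<in>UNIV. axis m 1 $ k * partial_x k E z) = partial_x m E z"
    by (simp add: axis_def if_distrib[of "\<lambda>a. a * _"] cong: if_cong)
  ultimately show ?thesis
    using EL[OF z, of m] by (simp add: sum.distrib mult.commute)
qed

text \<open>
  In a Berwald space the second derivatives in \<open>y\<close> of the spray coefficients are functions
  \<open>\<Gamma>\<close> of the base point only: the horizontal derivatives are those of a linear connection.
\<close>

lemma berwald_energy_derivative:
  fixes F :: "'a::euclidean_space \<times> 'a \<Rightarrow> real" and \<phi> :: "real^'n \<Rightarrow> 'a"
  assumes W: "open W" and sm: "smooth_on (W \<times> (-{0})) (energy F \<phi>)"
    and hom: "\<And>x y t. x \<in> W \<Longrightarrow> y \<noteq> 0 \<Longrightarrow> t > 0 \<Longrightarrow> energy F \<phi> (x, t *\<^sub>R y) = t\<^sup>2 * energy F \<phi> (x, y)"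
    and pos: "\<And>z w. z \<in> W \<times> (-{0}) \<Longrightarrow> w \<noteq> 0 \<Longrightarrow> w \<bullet> (fundamental_tensor F \<phi> z *v w) > 0"
    and mixed: "\<And>z l i j k. z \<in> W \<times> (-{0}) \<Longrightarrow> mixed_curvature F \<phi> l i j k z = 0"
    and dim: "CARD('n) \<ge> 2"
  obtains \<Gamma> where "\<And>l j m. continuous_on W (\<Gamma> l j m)"
    "\<And>x y m. x \<in> W \<Longrightarrow> y \<noteq> 0 \<Longrightarrow> partial_x m (energy F \<phi>) (x, y) =
       (\<Sum>l\<in>UNIV. \<Sum>j\<in>UNIV. \<Gamma> l j m x * y $ j * partial_y l (energy F \<phi>) (x, y))"
proof -
  let ?S = "W \<times> (-{0 :: real^'n})"
  define E where "E = energy F \<phi>"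
  define g where "g = fundamental_tensor F \<phi>"
  define G where "G = spray_coeff F \<phi>"
  define w where "w z = (\<chi> m. (1/2) * ((\<Sum>k\<in>UNIV. snd z $ k * partial_y m (partial_x k E) z) - partial_x m E z))" for z
  note sm = sm[folded E_def] and hom = hom[folded E_def] and pos = pos[folded g_def]
  have oS: "open ?S" using W by (intro open_Times) auto
  have diff: "f differentiable (at z)" if "smooth_on ?S f" "z \<in> ?S" for f :: "_ \<Rightarrow> real" and z
    using smooth_on_has_derivative[OF that] differentiableI by blast
  have g: "g z $ i $ j = partial_y i (partial_y j E) z" for z i j
    by (simp add: g_def fundamental_tensor_def E_def)
  have inv: "invertible (g z)" if "z \<in> ?S" for z
    using pos_def_invertible pos[OF that] by blast
  have det: "det (g z) \<noteq> 0" if "z \<in> ?S" for z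
    using inv[OF that] invertible_det_nz by blast
  have Gw: "(\<chi> l. G l z) = matrix_inv (g z) *v w z" for z
    by (simp add: vec_eq_iff G_def spray_coeff_def matrix_vector_mult_def w_def g_def E_def sum_distrib_left mult_ac)
  have gG: "g z *v (\<chi> l. G l z) = w z" if "z \<in> ?S" for z
    unfolding Gw by (rule matrix_inv_solve[OF inv[OF that]])
  have smG: "smooth_on ?S (G l)" for l
  proof -
    \<comment> \<open>Cramer's rule expresses the spray coefficients by determinants of smooth functions.\<close>
    have eq: "G l z = det (\<chi> i j. if j = l then w z $ i else g z $ i $ j) * inverse (det (g z))"
      if "z \<in> ?S" for z
      using gG[OF that] unfolding cramer[OF det[OF that]] by (simp add: vec_eq_iff divide_inverse)
    have smw: "smooth_on ?S (\<lambda>z. w z $ i)" for i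
      unfolding w_def vec_lambda_beta
      by (intro smooth_intros oS smooth_on_partial_x smooth_on_partial_y sm smooth_on_bounded_linear
          bounded_linear_compose[OF bounded_linear_vec_nth bounded_linear_snd])
    have smg: "smooth_on ?S (\<lambda>z. g z $ i $ j)" for i j
      unfolding g using sm by (intro smooth_on_partial_y)
    have "smooth_on ?S (\<lambda>z. det (\<chi> i j. if j = l then w z $ i else g z $ i $ j) * inverse (det (g z)))"
    proof (intro smooth_on_mult smooth_on_inverse smooth_on_det oS smg det)
      show "smooth_on ?S (\<lambda>z. (\<chi> i j. if j = l then w z $ i else g z $ i $ j) $ i $ j)" for i j
        using smw smg by (cases "j = l") auto
    qed auto
    then show ?thesis
      by (rule smooth_on_cong[OF oS, rotated]) (use eq in auto)
  qed
  have EL: "2 * (\<Sum>l\<in>UNIV. partial_y m (partial_y l E) z * G l z) =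
        (\<Sum>k\<in>UNIV. snd z $ k * partial_y m (partial_x k E) z) - partial_x m E z" if "z \<in> ?S" for z m
    using arg_cong[OF gG[OF that], of "\<lambda>v. v $ m"]
    by (simp add: matrix_vector_mult_def g w_def)
  have horiz: "partial_x m E z = (\<Sum>l\<in>UNIV. partial_y m (G l) z * partial_y l E z)" if "z \<in> ?S" for z m
    by (rule energy_horizontally_constant[OF W sm hom smG EL that])
  \<comment> \<open>The spray coefficients are homogeneous of degree two, so their first derivatives can be
    recovered from the second ones by Euler's identity.\<close>
  note hx = partial_homogeneous(1)[OF W] and hy = partial_homogeneous(2)[OF W]
  have hEx: "partial_x k E (x, t *\<^sub>R y) = t ^ 2 * partial_x k E (x, y)" if "x \<in> W" "y \<noteq> 0" "t > 0" for x y t k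
    using hx[OF sm hom that] by blast
  have hExy: "partial_y m (partial_x k E) (x, t *\<^sub>R y) = t * partial_y m (partial_x k E) (x, y)"
    if "x \<in> W" "y \<noteq> 0" "t > 0" for x y t k m
    using hy[OF smooth_on_partial_x[OF sm] hEx that] that by (simp add: power2_eq_square)
  have hEy: "partial_y k E (x, t *\<^sub>R y) = t ^ 1 * partial_y k E (x, y)" if "x \<in> W" "y \<noteq> 0" "t > 0" for x y t k
    using hy[OF sm hom that] that by (simp add: power2_eq_square)
  have hg: "g (x, t *\<^sub>R y) = g (x, y)" if "x \<in> W" "y \<noteq> 0" "t > 0" for x y t
    using hy[OF smooth_on_partial_y[OF sm] hEy that] that by (simp add: vec_eq_iff g)
  have hw: "w (x, t *\<^sub>R y) = t\<^sup>2 *\<^sub>R w (x, y)" if "x \<in> W" "y \<noteq> 0" "t > 0" for x y t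
    using that by (simp add: vec_eq_iff w_def hEx hExy sum_distrib_left algebra_simps power2_eq_square)
  have hG: "G l (x, t *\<^sub>R y) = t ^ 2 * G l (x, y)" if "x \<in> W" "y \<noteq> 0" "t > 0" for x y t l
  proof -
    have "(\<chi> l. G l (x, t *\<^sub>R y)) = t\<^sup>2 *\<^sub>R (\<chi> l. G l (x, y))"
      unfolding Gw hg[OF that] hw[OF that] by (simp add: matrix_vector_mult_scaleR)
    then show ?thesis by (simp add: vec_eq_iff)
  qed
  have hGy: "partial_y k (G l) (x, t *\<^sub>R y) = t ^ 1 * partial_y k (G l) (x, y)" if "x \<in> W" "y \<noteq> 0" "t > 0" for x y t k l
    using hy[OF smG hG that] that by (simp add: power2_eq_square)
  define H where "H l j k = partial_y j (partial_y k (G l))" for l j k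
  have smH: "smooth_on ?S (H l j k)" for l j k
    unfolding H_def by (intro smooth_on_partial_y smG)
  have euler: "partial_y k (G l) (x, y) = (\<Sum>j\<in>UNIV. y $ j * H l j k (x, y))" if "(x, y) \<in> ?S" for x y k l
    using euler_identity[of "partial_y k (G l)" x y 1] diff[OF smooth_on_partial_y[OF smG] that] hGy that
    by (simp add: H_def)
  have H0: "partial_y i (H l j k) z = 0" if "z \<in> ?S" for i l j k z
    using mixed[OF that, of l i j k] by (simp add: mixed_curvature_def H_def G_def)
  \<comment> \<open>The punctured space is connected because the dimension is at least two.\<close>
  obtain e :: "real^'n" where e: "e \<noteq> 0" by (metis axis_eq_0_iff one_neq_zero)
  have const: "H l j k (x, y) = H l j k (x, e)" if "x \<in> W" "y \<noteq> 0" for x y l j k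
  proof (rule has_derivative_zero_unique_connected[of "-{0}" "\<lambda>y. H l j k (x, y)"])
    show "connected (- {0 :: real^'n})"
      by (rule connected_punctured_universe) (use dim in simp)
    show "((\<lambda>y. H l j k (x, y)) has_derivative (\<lambda>x. 0)) (at y)" if "y \<in> - {0}" for y
    proof -
      have xy: "(x, y) \<in> ?S" using \<open>x \<in> W\<close> that by auto
      have "((\<lambda>y. (x, y)) has_derivative (\<lambda>v. (0, v))) (at y)"
        by (auto intro!: derivative_eq_intros)
      from has_derivative_compose[OF this smooth_on_has_derivative[OF smH xy]]
      have "((\<lambda>y. H l j k (x, y)) has_derivative (\<lambda>v. frechet_derivative (H l j k) (at (x, y)) (0, v))) (at y)" .
      moreover have "frechet_derivative (H l j k) (at (x, y)) (0, v) = 0" for v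
        using frechet_derivative_expand[OF diff[OF smH xy], of l j k 0 v] H0[OF xy] by simp
      ultimately show ?thesis by simp
    qed
  qed (use that e in auto)
  show ?thesis
  proof (rule that[of "\<lambda>l j m x. H l j m (x, e)"])
    show "continuous_on W (\<lambda>x. H l j m (x, e))" for l j m
      by (rule continuous_on_compose2[OF smooth_on_imp_continuous_on[OF smH]])
         (use e in \<open>auto intro!: continuous_intros\<close>)
    show "partial_x m (energy F \<phi>) (x, y) =
       (\<Sum>l\<in>UNIV. \<Sum>j\<in>UNIV. H l j m (x, e) * y $ j * partial_y l (energy F \<phi>) (x, y))"
      if "x \<in> W" "y \<noteq> 0" for x y m
      unfolding E_def[symmetric] using that
      by (subst horiz) (simp_all add: euler const sum_distrib_right sum_distrib_left mult_ac)
  qed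
qed

section \<open>Parallel transport\<close>

text \<open>
  A linear differential equation with small coefficients on the unit interval, solved by Picard
  iteration. As its distance from the identity is less than \<open>1\<close>, the solution stays injective.
\<close>

lemma linear_ode_solution:
  fixes B :: "real \<Rightarrow> 'a::banach \<Rightarrow>\<^sub>L 'a"
  assumes B: "continuous_on {0..1} B" and Bn: "\<And>t. t \<in> {0..1} \<Longrightarrow> norm (B t) \<le> 1/4"
  obtains A where "A 0 = id_blinfun"
    "\<And>t. t \<in> {0..1} \<Longrightarrow> (A has_vector_derivative (B t o\<^sub>L A t)) (at t within {0..1})"
    "\<And>t. t \<in> {0..1} \<Longrightarrow> norm (A t - id_blinfun) < 1"
proof -
  \<comment> \<open>Clamping the time to the unit interval turns paths into bounded continuous functions on the line.\<close>
  define K :: "real \<Rightarrow> real" where "K t = max 0 (min 1 t)" for t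
  have K: "K t \<in> {0..1}" for t by (auto simp: K_def)
  have Kid: "K t = t" if "t \<in> {0..1}" for t using that by (auto simp: K_def)
  define I where "I A t = id_blinfun + integral {0..t} (\<lambda>s. B s o\<^sub>L A s)"
    for A :: "real \<Rightarrow> 'a \<Rightarrow>\<^sub>L 'a" and t
  have cont: "continuous_on {0..1} (\<lambda>s. B s o\<^sub>L A s)" if "continuous_on {0..1} A" for A :: "real \<Rightarrow> 'a \<Rightarrow>\<^sub>L 'a"
    by (rule bounded_bilinear.continuous_on[OF bounded_bilinear_blinfun_compose B that])
  have contI: "continuous_on {0..1} (I A)" if "continuous_on {0..1} A" for A
    unfolding I_def
    by (intro continuous_on_add continuous_on_const indefinite_integral_continuous_1
        integrable_continuous_interval cont that)
  have bc: "(\<lambda>t. I A (K t)) \<in> bcontfun" if "continuous_on {0..1} A" for A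
  proof -
    have "continuous_on UNIV (\<lambda>t. I A (K t))"
      by (rule continuous_on_compose2[OF contI[OF that]]) (auto simp: K_def intro!: continuous_intros)
    moreover have "bounded (range (\<lambda>t. I A (K t)))"
      using compact_imp_bounded[OF compact_continuous_image[OF contI[OF that] compact_Icc]]
      by (rule bounded_subset) (use K in auto)
    ultimately show ?thesis by (simp add: bcontfun_def)
  qed
  define P where "P A = Bcontfun (\<lambda>t. I (apply_bcontfun A) (K t))" for A
  have P: "apply_bcontfun (P A) t = I (apply_bcontfun A) (K t)" for A t
    unfolding P_def by (subst Bcontfun_inverse) (auto intro: bc)
  have ib: "norm (integral {0..K t} (\<lambda>s. B s o\<^sub>L A s)) \<le> 1/4 * c"
    if "continuous_on {0..1} A" "\<And>s. norm (A s) \<le> c" for A :: "real \<Rightarrow> 'a \<Rightarrow>\<^sub>L 'a" and c t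
  proof -
    have c: "c \<ge> 0" using that(2)[of 0] norm_ge_zero order_trans by blast
    have "norm (integral {0..K t} (\<lambda>s. B s o\<^sub>L A s)) \<le> (1/4 * c) * (K t - 0)"
    proof (rule integral_bound)
      show "continuous_on {0..K t} (\<lambda>s. B s o\<^sub>L A s)"
        using cont[OF that(1)] by (rule continuous_on_subset) (use K in auto)
      show "norm (B s o\<^sub>L A s) \<le> 1/4 * c" if "s \<in> {0..K t}" for s
      proof -
        have "norm (B s) \<le> 1/4" by (rule Bn) (use that K[of t] in auto)
        then show ?thesis
          using norm_blinfun_compose[of "B s" "A s"] mult_mono[of "norm (B s)" "1/4" "norm (A s)" c]
            \<open>\<And>s. norm (A s) \<le> c\<close>[of s] by simp
      qed
    qed (use K in auto)
    also have "\<dots> \<le> (1/4 * c) * 1" using K[of t] c by (intro mult_left_mono) auto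
    finally show ?thesis by simp
  qed
  have "\<exists>!A. P A = A"
  proof (rule banach_fix_type)
    show "0 \<le> (1/4::real)" "(1/4::real) < 1" by auto
    show "\<forall>A A'. dist (P A) (P A') \<le> 1/4 * dist A A'"
    proof (intro allI dist_bound)
      fix A A' t
      have i: "(\<lambda>s. B s o\<^sub>L apply_bcontfun A s) integrable_on {0..K t}"
        for A :: "real \<Rightarrow>\<^sub>C ('a \<Rightarrow>\<^sub>L 'a)"
        by (rule integrable_continuous_interval, rule continuous_on_subset[OF cont]) (use K in auto)
      have "dist (apply_bcontfun (P A) t) (apply_bcontfun (P A') t)
          = norm (integral {0..K t} (\<lambda>s. B s o\<^sub>L (apply_bcontfun A s - apply_bcontfun A' s)))"
        by (simp add: P I_def dist_norm integral_diff[OF i i, symmetric]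
            bounded_bilinear.diff_right[OF bounded_bilinear_blinfun_compose])
      also have "\<dots> \<le> 1/4 * dist A A'"
        by (rule ib) (auto intro!: continuous_intros simp: dist_norm[symmetric] dist_bounded)
      finally show "dist (apply_bcontfun (P A) t) (apply_bcontfun (P A') t) \<le> 1/4 * dist A A'" .
    qed
  qed
  then obtain A where A: "P A = A" by blast
  have Aeq: "apply_bcontfun A t = I (apply_bcontfun A) (K t)" for t
    using P[of A t] A by simp
  have close: "norm (apply_bcontfun A t - id_blinfun) \<le> 1/4 * norm A" for t
    unfolding Aeq[of t] I_def using ib[of "apply_bcontfun A" "norm A"] norm_bounded by auto
  have "norm (apply_bcontfun A t) \<le> 1 + 1/4 * norm A" for t
    using norm_triangle_ineq[of "apply_bcontfun A t - id_blinfun" id_blinfun] close[of t] norm_blinfun_id_le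
    by (metis (no_types, opaque_lifting) add.commute add_mono diff_add_cancel order_trans)
  then have "norm A \<le> 1 + 1/4 * norm A" by (rule norm_bound)
  then have nA: "norm A \<le> 4/3" by simp
  show ?thesis
  proof (rule that[of "apply_bcontfun A"])
    show "apply_bcontfun A 0 = id_blinfun"
      by (subst Aeq) (simp add: I_def K_def)
    show "norm (apply_bcontfun A t - id_blinfun) < 1" if "t \<in> {0..1}" for t
      using close[of t] nA by linarith
    show "(apply_bcontfun A has_vector_derivative (B t o\<^sub>L apply_bcontfun A t)) (at t within {0..1})"
      if t: "t \<in> {0..1}" for t
    proof -
      have "((\<lambda>t. I (apply_bcontfun A) t) has_vector_derivative (0 + (B t o\<^sub>L apply_bcontfun A t))) (at t within {0..1})"
        unfolding I_def
        by (intro has_vector_derivative_add has_vector_derivative_const integral_has_vector_derivative cont t) auto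
      moreover have "apply_bcontfun A s = I (apply_bcontfun A) s" if "s \<in> {0..1}" for s
        using Aeq[of s] Kid[OF that] by simp
      ultimately show ?thesis
        using has_vector_derivative_transform[OF t, of "apply_bcontfun A" "I (apply_bcontfun A)"] by simp
    qed
  qed
qed

text \<open>
  Along the straight segment from \<open>x0\<close> to a nearby point \<open>x\<close>, the parallel transport
  \<open>A\<close> of the linear connection \<open>\<Gamma>\<close> solves a linear equation with small coefficients.
  The energy is differentiable off the zero section only, so it matters that \<open>A\<close> stays close to the identity.
\<close>

lemma parallel_transport_preserves:
  fixes E :: "(real^'n) \<times> (real^'n) \<Rightarrow> real"
  assumes W: "open W" "x0 \<in> W" and diff: "\<And>z. z \<in> W \<times> (-{0}) \<Longrightarrow> E differentiable (at z)"
    and \<Gamma>: "\<And>l j m. continuous_on W (\<Gamma> l j m)"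
    and EG: "\<And>x y m. x \<in> W \<Longrightarrow> y \<noteq> 0 \<Longrightarrow> partial_x m E (x, y) =
       (\<Sum>l\<in>UNIV. \<Sum>j\<in>UNIV. \<Gamma> l j m x * y $ j * partial_y l E (x, y))"
  shows "\<exists>\<delta>>0. \<forall>x\<in>ball x0 \<delta>. x \<in> W \<and> (\<exists>A. linear A \<and> (\<forall>y. y \<noteq> 0 \<longrightarrow> E (x, A y) = E (x0, y)))"
proof -
  define M :: "'n \<Rightarrow> 'n \<Rightarrow> (real^'n) \<Rightarrow>\<^sub>L (real^'n)" where "M l j = Blinfun (\<lambda>y. y $ j *\<^sub>R axis l 1)" for l j
  have M: "blinfun_apply (M l j) y = y $ j *\<^sub>R axis l 1" for l j y
    unfolding M_def by (subst bounded_linear_Blinfun_apply)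
      (auto intro: bounded_linear_scaleR_const bounded_linear_vec_nth)
  \<comment> \<open>The velocity of the transported vector \<open>y\<close>, when the base point \<open>x\<close> moves with velocity
    \<open>v\<close>, is \<open>N x v y\<close>.\<close>
  define N where "N x v = (\<Sum>l\<in>UNIV. \<Sum>j\<in>UNIV. \<Sum>m\<in>UNIV. (- \<Gamma> l j m x * v $ m) *\<^sub>R M l j)" for x v
  have Napp: "blinfun_apply (N x v) y $ l = - (\<Sum>j\<in>UNIV. \<Sum>m\<in>UNIV. \<Gamma> l j m x * v $ m * y $ j)" for x v y l
  proof -
    have "blinfun_apply (N x v) y $ l =
        (\<Sum>k\<in>UNIV. \<Sum>j\<in>UNIV. \<Sum>m\<in>UNIV. - (\<Gamma> k j m x * v $ m * y $ j) * (if l = k then 1 else 0))"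
      unfolding N_def blinfun.sum_left blinfun.scaleR_left M sum_component vector_scaleR_component axis_def vec_lambda_beta
      by (intro sum.cong refl) auto
    also have "\<dots> = (\<Sum>k\<in>UNIV. if l = k then - (\<Sum>j\<in>UNIV. \<Sum>m\<in>UNIV. \<Gamma> k j m x * v $ m * y $ j) else 0)"
      by (intro sum.cong refl) (simp add: sum_negf)
    finally show ?thesis by simp
  qed
  have contN: "continuous_on (W \<times> UNIV) (\<lambda>(x, v). N x v)"
    unfolding N_def split_def
    by (intro continuous_intros continuous_on_compose2[OF \<Gamma>]) auto
  have "open (W \<times> (UNIV :: (real^'n) set))" using W by (intro open_Times) auto
  with contN W have "isCont (\<lambda>(x, v). N x v) (x0, 0)"
    by (simp add: continuous_on_eq_continuous_at)
  then have "\<forall>e>0. \<exists>d>0. \<forall>z\<in>UNIV. dist z (x0, 0) < d \<longrightarrow> dist (case z of (x, v) \<Rightarrow> N x v) (N x0 0) < e"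
    unfolding continuous_within_eps_delta by simp
  from this[rule_format, of "1/4"]
  obtain d where d: "d > 0" "\<And>z. dist z (x0, 0) < d \<Longrightarrow> norm ((case z of (x, v) \<Rightarrow> N x v) - N x0 0) < 1/4"
    by (auto simp: dist_norm)
  have N0: "N x0 0 = 0" by (simp add: N_def)
  obtain r where r: "r > 0" "ball x0 r \<subseteq> W" using W open_contains_ball by blast
  have dp: "dist (x, v) (x0, 0) \<le> norm (x - x0) + norm v" for x v :: "real^'n"
    using norm_Pair_le[of "x - x0" v] by (simp add: dist_norm)
  show ?thesis
  proof (intro exI[of _ "min r (d/2)"] conjI ballI)
    show "min r (d/2) > 0" using r d by simp
    fix x assume x: "x \<in> ball x0 (min r (d/2))"
    then show "x \<in> W" using r by auto
    define v where "v = x - x0"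
    have nv: "norm v < r" "norm v < d / 2" using x by (auto simp: v_def dist_norm norm_minus_commute)
    have seg: "x0 + t *\<^sub>R v \<in> W" "norm (N (x0 + t *\<^sub>R v) v) \<le> 1/4" if "t \<in> {0..1}" for t
    proof -
      have le: "norm (t *\<^sub>R v) \<le> norm v" using that by (simp add: mult_left_le_one_le)
      then show "x0 + t *\<^sub>R v \<in> W" using nv r(2) by (auto simp: dist_norm subset_iff)
      have "dist (x0 + t *\<^sub>R v, v) (x0, 0) < d" using dp[of "x0 + t *\<^sub>R v" v] le nv by simp
      from d(2)[OF this] show "norm (N (x0 + t *\<^sub>R v) v) \<le> 1/4" by (simp add: N0)
    qed
    have "continuous_on {0..1} (\<lambda>t. N (x0 + t *\<^sub>R v) v)"
      using continuous_on_compose2[OF contN, of "{0..1}" "\<lambda>t. (x0 + t *\<^sub>R v, v)"] seg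
      by (force intro!: continuous_intros)
    then obtain A where A: "A 0 = id_blinfun"
      "\<And>t. t \<in> {0..1} \<Longrightarrow> (A has_vector_derivative (N (x0 + t *\<^sub>R v) v o\<^sub>L A t)) (at t within {0..1})"
      "\<And>t. t \<in> {0..1} \<Longrightarrow> norm (A t - id_blinfun) < 1"
      using linear_ode_solution[of "\<lambda>t. N (x0 + t *\<^sub>R v) v"] seg by blast
    have "E (x, blinfun_apply (A 1) y) = E (x0, y)" if y: "y \<noteq> 0" for y
    proof -
      have nz: "blinfun_apply (A t) y \<noteq> 0" if "t \<in> {0..1}" for t
      proof
        assume "blinfun_apply (A t) y = 0"
        then have "norm y = norm (blinfun_apply (A t - id_blinfun) y)"
          by (simp add: blinfun.diff_left)
        also have "\<dots> \<le> norm (A t - id_blinfun) * norm y" by (rule norm_blinfun)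
        also have "\<dots> < 1 * norm y" using A(3)[OF that] y by (intro mult_strict_right_mono) auto
        finally show False by simp
      qed
      have "\<exists>c. \<forall>t\<in>{0..1}. E (x0 + t *\<^sub>R v, blinfun_apply (A t) y) = c"
      proof (rule has_derivative_zero_constant)
        fix t :: real assume t: "t \<in> {0..1}"
        let ?z = "(x0 + t *\<^sub>R v, blinfun_apply (A t) y)"
        let ?u = "blinfun_apply (N (x0 + t *\<^sub>R v) v) (blinfun_apply (A t) y)"
        have z: "?z \<in> W \<times> (-{0})" using seg(1)[OF t] nz[OF t] by auto
        have "(A has_derivative (\<lambda>s. s *\<^sub>R (N (x0 + t *\<^sub>R v) v o\<^sub>L A t))) (at t within {0..1})"
          using A(2)[OF t] by (simp add: has_vector_derivative_def)
        from bounded_linear.has_derivative[OF blinfun.bounded_linear_left this]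
        have "((\<lambda>t. (x0 + t *\<^sub>R v, blinfun_apply (A t) y)) has_derivative (\<lambda>s. (s *\<^sub>R v, s *\<^sub>R ?u))) (at t within {0..1})"
          by (intro has_derivative_Pair) (auto intro!: derivative_eq_intros simp: blinfun.scaleR_left)
        from has_derivative_compose[OF this]
        have D: "((\<lambda>t. E (x0 + t *\<^sub>R v, blinfun_apply (A t) y)) has_derivative
            (\<lambda>s. frechet_derivative E (at ?z) (s *\<^sub>R v, s *\<^sub>R ?u))) (at t within {0..1})"
          using diff[OF z] frechet_derivative_works by blast
        have "frechet_derivative E (at ?z) (s *\<^sub>R v, s *\<^sub>R ?u) = 0" for s
        proof -
          have "frechet_derivative E (at ?z) (s *\<^sub>R v, s *\<^sub>R ?u) =
            (\<Sum>m\<in>UNIV. (s * v $ m) * partial_x m E ?z) + (\<Sum>l\<in>UNIV. (s * ?u $ l) * partial_y l E ?z)"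
            using frechet_derivative_expand[OF diff[OF z], of "s *\<^sub>R v" "s *\<^sub>R ?u"] by simp
          also have "(\<Sum>m\<in>UNIV. (s * v $ m) * partial_x m E ?z) =
             (\<Sum>m\<in>UNIV. \<Sum>l\<in>UNIV. \<Sum>j\<in>UNIV. s * v $ m * (\<Gamma> l j m (x0 + t *\<^sub>R v) * (blinfun_apply (A t) y) $ j * partial_y l E ?z))"
            using z by (simp add: EG sum_distrib_left)
          also have "\<dots> = (\<Sum>l\<in>UNIV. \<Sum>j\<in>UNIV. \<Sum>m\<in>UNIV. s * v $ m * (\<Gamma> l j m (x0 + t *\<^sub>R v) * (blinfun_apply (A t) y) $ j * partial_y l E ?z))"
            by (rule trans[OF sum.swap sum.cong[OF refl sum.swap]])
          also have "\<dots> = - (\<Sum>l\<in>UNIV. (s * ?u $ l) * partial_y l E ?z)"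
            by (simp add: Napp sum_distrib_left sum_distrib_right sum_negf mult_ac)
          finally show ?thesis by simp
        qed
        then show "((\<lambda>t. E (x0 + t *\<^sub>R v, blinfun_apply (A t) y)) has_derivative (\<lambda>h. 0)) (at t within {0..1})"
          using D by simp
      qed auto
      then obtain c where "\<And>t. t \<in> {0..1} \<Longrightarrow> E (x0 + t *\<^sub>R v, blinfun_apply (A t) y) = c" by blast
      from this[of 0] this[of 1] show ?thesis by (simp add: A(1) v_def)
    qed
    moreover have "linear (blinfun_apply (A 1))"
      by (simp add: blinfun.bounded_linear_right bounded_linear.linear)
    ultimately show "\<exists>A. linear A \<and> (\<forall>y. y \<noteq> 0 \<longrightarrow> E (x, A y) = E (x0, y))" by blast
  qed
qed

section \<open>Moments of gauges on the plane\<close>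

text \<open>The identification of the coordinate plane with the complex numbers, and its inverse.\<close>

definition cpx :: "real^2 \<Rightarrow> complex" where "cpx y = Complex (y $ 1) (y $ 2)"

definition vec2 :: "complex \<Rightarrow> real^2" where "vec2 z = (\<chi> i. if i = 1 then Re z else Im z)"

lemma cpx_vec2 [simp]: "cpx (vec2 z) = z"
  by (simp add: cpx_def vec2_def)

lemma vec2_cpx [simp]: "vec2 (cpx y) = y"
  by (simp add: cpx_def vec2_def vec_eq_iff forall_2)

lemma norm_cpx [simp]: "cmod (cpx y) = norm y"
  by (simp add: cpx_def cmod_def norm_vec_def L2_set_def sum_2)

lemma norm_vec2 [simp]: "norm (vec2 z) = cmod z"
  by (metis cpx_vec2 norm_cpx)

lemma bounded_linear_cpx: "bounded_linear cpx"
  by (rule bounded_linear_intro[of _ 1]) (auto simp: cpx_def complex_eq_iff norm_cpx[unfolded cpx_def])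

lemma bounded_linear_vec2: "bounded_linear vec2"
proof (rule bounded_linear_intro[of _ 1])
  show "norm (vec2 z) \<le> norm z * 1" for z
    using norm_cpx[of "vec2 z"] by simp
qed (auto simp: vec2_def vec_eq_iff)

lemmas continuous_on_cpx [continuous_intros] = bounded_linear.continuous_on[OF bounded_linear_cpx]
lemmas continuous_on_vec2 [continuous_intros] = bounded_linear.continuous_on[OF bounded_linear_vec2]

lemma cpx_eq_0_iff [simp]: "cpx y = 0 \<longleftrightarrow> y = 0"
  by (metis norm_cpx norm_eq_zero)

lemma cpx_0 [simp]: "cpx 0 = 0" by simp

lemma cpx_scaleR: "cpx (t *\<^sub>R y) = of_real t * cpx y"
  by (simp add: cpx_def complex_eq_iff)

lemma real_linear_to_complex:
  fixes L :: "real^2 \<Rightarrow> complex"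
  assumes "linear L"
  shows "\<exists>p q. \<forall>y. L y = p * cpx y + q * cnj (cpx y)"
proof (intro exI allI)
  let ?a = "L (axis 1 1)" and ?b = "L (axis 2 1)"
  fix y :: "real^2"
  have y: "y = y $ 1 *\<^sub>R axis 1 1 + y $ 2 *\<^sub>R axis 2 1"
    by (simp add: vec_eq_iff forall_2 axis_def)
  have "L y = y $ 1 *\<^sub>R ?a + y $ 2 *\<^sub>R ?b"
    by (subst y) (simp only: linear_add[OF assms] linear_scale[OF assms])
  then show "L y = ((?a - \<i> * ?b) / 2) * cpx y + ((?a + \<i> * ?b) / 2) * cnj (cpx y)"
    by (simp add: cpx_def complex_eq_iff scaleR_conv_of_real) (simp add: field_simps)
qed

text \<open>
  What is used of the restriction of a Finsler metric to a tangent plane; neither convexity nor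
  smoothness is needed.
\<close>

definition plane_gauge :: "(real^2 \<Rightarrow> real) \<Rightarrow> bool" where
  "plane_gauge f \<longleftrightarrow> continuous_on UNIV f \<and> (\<forall>t>0. \<forall>y. f (t *\<^sub>R y) = t * f y) \<and> (\<forall>y. y \<noteq> 0 \<longrightarrow> f y > 0)"

lemma plane_gaugeD:
  assumes "plane_gauge f"
  shows "continuous_on S f" "t > 0 \<Longrightarrow> f (t *\<^sub>R y) = t * f y" "y \<noteq> 0 \<Longrightarrow> f y > 0" "f 0 = 0"
proof -
  show "continuous_on S f" "t > 0 \<Longrightarrow> f (t *\<^sub>R y) = t * f y" "y \<noteq> 0 \<Longrightarrow> f y > 0"
    using assms by (auto simp: plane_gauge_def intro: continuous_on_subset)
  have "f (2 *\<^sub>R 0) = 2 * f 0" using assms unfolding plane_gauge_def by (metis zero_less_numeral)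
  then show "f 0 = 0" by simp
qed

lemma plane_gauge_uniform_lower_bound:
  fixes f :: "'x::metric_space \<Rightarrow> real^2 \<Rightarrow> real"
  assumes "compact K" "continuous_on (K \<times> UNIV) (\<lambda>(x, y). f x y)" "\<And>x. x \<in> K \<Longrightarrow> plane_gauge (f x)"
  obtains m where "m > 0" "\<And>x y. x \<in> K \<Longrightarrow> m * norm y \<le> f x y"
proof (cases "K = {}")
  case True
  then show ?thesis using that[of 1] by simp
next
  case False
  let ?S = "K \<times> sphere (0 :: real^2) 1"
  have "axis 1 1 \<in> sphere (0::real^2) 1" by simp
  then have ne: "?S \<noteq> {}" using False by blast
  have "compact ?S" using assms(1) by (intro compact_Times) auto
  moreover have "continuous_on ?S (\<lambda>(x, y). f x y)"
    using assms(2) by (rule continuous_on_subset) auto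
  ultimately obtain x0 y0 where xy: "x0 \<in> K" "norm y0 = 1" "\<And>x y. x \<in> K \<Longrightarrow> norm y = 1 \<Longrightarrow> f x0 y0 \<le> f x y"
    using continuous_attains_inf[of ?S "\<lambda>(x, y). f x y"] ne by fastforce
  show ?thesis
  proof (rule that[of "f x0 y0"])
    show "f x0 y0 > 0" using plane_gaugeD(3)[OF assms(3)[OF xy(1)], of y0] xy(2) by force
    show "f x0 y0 * norm y \<le> f x y" if x: "x \<in> K" for x y
    proof (cases "y = 0")
      case True
      then show ?thesis using plane_gaugeD(4)[OF assms(3)[OF x]] by simp
    next
      case False
      let ?u = "(1 / norm y) *\<^sub>R y"
      have "norm ?u = 1" using False by simp
      then have "f x0 y0 \<le> f x ?u" using xy(3) x by blast
      then have "f x0 y0 * norm y \<le> f x ?u * norm y" by (simp add: mult_right_mono)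
      also have "\<dots> = f x (norm y *\<^sub>R ?u)"
        using plane_gaugeD(2)[OF assms(3)[OF x], of "norm y" ?u] False by simp
      finally show ?thesis using False by simp
    qed
  qed
qed

lemma plane_gauge_lower_bound:
  assumes "plane_gauge f" obtains m where "m > 0" "\<And>y. m * norm y \<le> f y"
proof (rule plane_gauge_uniform_lower_bound[of "{0::real}" "\<lambda>_. f"])
  show "continuous_on ({0::real} \<times> UNIV) (\<lambda>(x, y). f y)"
    unfolding split_def by (intro continuous_on_compose2[OF plane_gaugeD(1)[OF assms, of UNIV]] continuous_intros) auto
qed (use assms that in auto)

text \<open>
  Moments are taken with respect to a density that is supported in the unit ball of \<open>f\<close> and
  determines \<open>f\<close>. It is continuous, unlike the indicator function of the ball, which makes the moments
  depend continuously on parameters and allows approximation by polynomials.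
\<close>

definition weight :: "(real^2 \<Rightarrow> real) \<Rightarrow> real^2 \<Rightarrow> real" where
  "weight f y = max 0 (1 - f y)"

definition moment :: "(real^2 \<Rightarrow> real) \<Rightarrow> (real^2 \<Rightarrow> complex) \<Rightarrow> complex" where
  "moment f u = integral UNIV (\<lambda>y. of_real (weight f y) * u y)"

lemma continuous_on_weight: "plane_gauge f \<Longrightarrow> continuous_on S (weight f)"
  unfolding weight_def[abs_def] by (intro continuous_intros plane_gaugeD)

lemma weight_nonneg: "weight f y \<ge> 0"
  by (simp add: weight_def)

lemma ball_subset_box:
  obtains a :: "real^2" where "box (-a) a \<noteq> {}" "{y. norm y \<le> R} \<subseteq> box (-a) a"
proof -
  obtain a where a: "cball (0::real^2) (max R 0) \<subseteq> box (-a) a"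
    using bounded_subset_box_symmetric[OF bounded_cball] by blast
  moreover have "0 \<in> cball (0::real^2) (max R 0)" by simp
  ultimately show ?thesis using that[of a] by fastforce
qed

lemma compact_support_integrable:
  fixes g :: "real^2 \<Rightarrow> 'b::euclidean_space"
  assumes "continuous_on UNIV g" "\<And>y. y \<notin> cbox a b \<Longrightarrow> g y = 0"
  shows "g absolutely_integrable_on UNIV" "integral UNIV g = integral (cbox a b) g"
proof -
  have eq: "g = (\<lambda>y. if y \<in> cbox a b then g y else 0)" using assms(2) by auto
  show "g absolutely_integrable_on UNIV"
    by (subst eq, subst absolutely_integrable_restrict_UNIV, rule absolutely_integrable_continuous)
      (rule continuous_on_subset[OF assms(1)], simp)
  show "integral UNIV g = integral (cbox a b) g"
    by (subst eq, rule integral_restrict_UNIV)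
qed

lemma weight_support:
  assumes "plane_gauge f"
  obtains a where "box (-a) a \<noteq> {}" "\<And>y. y \<notin> box (-a) a \<Longrightarrow> weight f y = 0"
proof -
  obtain m where m: "m > 0" "\<And>y. m * norm y \<le> f y" using plane_gauge_lower_bound[OF assms] by blast
  obtain a :: "real^2" where a: "box (-a) a \<noteq> {}" "{y. norm y \<le> 1/m} \<subseteq> box (-a) a"
    using ball_subset_box by blast
  have "weight f y = 0" if "y \<notin> box (-a) a" for y
  proof -
    have "norm y > 1/m" using that a(2) by force
    then have "m * norm y > 1" using m(1) by (simp add: field_simps)
    then show ?thesis using m(2)[of y] by (simp add: weight_def)
  qed
  with a(1) show ?thesis using that by blast
qed

lemma weight_integrable:
  fixes u :: "real^2 \<Rightarrow> 'b::euclidean_space"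
  assumes "plane_gauge f" "continuous_on UNIV u"
  shows "(\<lambda>y. weight f y *\<^sub>R u y) absolutely_integrable_on UNIV"
proof -
  obtain a where a: "\<And>y. y \<notin> box (-a) a \<Longrightarrow> weight f y = 0" using weight_support[OF assms(1)] by blast
  show ?thesis
    by (rule compact_support_integrable[of _ "-a" a])
      (use a box_subset_cbox[of "-a" a] in \<open>auto intro!: continuous_intros continuous_on_weight assms\<close>)
qed

lemma moment_integrable:
  assumes "plane_gauge f" "continuous_on UNIV u"
  shows "(\<lambda>y. of_real (weight f y) * u y :: complex) absolutely_integrable_on UNIV"
  using weight_integrable[OF assms] by (simp add: scaleR_conv_of_real)

lemma moment_add:
  assumes "plane_gauge f" "continuous_on UNIV u" "continuous_on UNIV v"
  shows "moment f (\<lambda>y. u y + v y) = moment f u + moment f v"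
  unfolding moment_def distrib_left
  by (intro integral_add set_lebesgue_integral_eq_integral(1) moment_integrable assms)

lemma moment_cmult: "moment f (\<lambda>y. c * u y) = c * moment f u"
  unfolding moment_def by (subst mult.left_commute) simp

lemma moment_cnj: "moment f (\<lambda>y. cnj (u y)) = cnj (moment f u)"
  unfolding moment_def integral_cnj by simp

lemma Re_moment:
  assumes "plane_gauge f" "continuous_on UNIV u"
  shows "Re (moment f u) = integral UNIV (\<lambda>y. weight f y * Re (u y))"
  using integral_linear[OF set_lebesgue_integral_eq_integral(1)[OF moment_integrable[OF assms]] bounded_linear_Re]
  by (simp add: moment_def o_def)

lemma Re_moment_pos:
  assumes "plane_gauge f" "continuous_on UNIV u" "\<And>y. Re (u y) \<ge> 0" "Re (u y0) > 0" "f y0 < 1"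
  shows "Re (moment f u) > 0"
proof -
  obtain a where a: "box (-a) a \<noteq> {}" "\<And>y. y \<notin> box (-a) a \<Longrightarrow> weight f y = 0"
    using weight_support[OF assms(1)] by blast
  let ?g = "\<lambda>y. weight f y * Re (u y)"
  have c: "continuous_on UNIV ?g"
    by (intro continuous_intros continuous_on_weight assms)
  have eq: "Re (moment f u) = integral (cbox (-a) a) ?g"
    unfolding Re_moment[OF assms(1,2)]
    by (rule compact_support_integrable(2)[OF c]) (use a box_subset_cbox[of "-a" a] in auto)
  have c': "continuous_on (cbox (-a) a) ?g" using c by (rule continuous_on_subset) simp
  have ge: "integral (cbox (-a) a) ?g \<ge> 0"
    by (intro integral_nonneg integrable_continuous c') (simp add: assms weight_nonneg)
  have w: "weight f y0 > 0" using assms(5) by (simp add: weight_def)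
  then have y0: "y0 \<in> cbox (-a) a" using a(2) box_subset_cbox[of "-a" a] by force
  have "integral (cbox (-a) a) ?g \<noteq> 0"
    using integral_cbox_eq_0_iff[OF c' a(1)] assms w y0 weight_nonneg by force
  with ge eq show ?thesis by simp
qed

text \<open>The factor is the absolute value of the determinant; only its independence of \<open>g\<close> matters below.\<close>

lemma integral_linear_substitution:
  fixes A :: "real^2 \<Rightarrow> real^2"
  assumes "linear A" "inj A"
  obtains c :: real where "c > 0" "\<And>g :: real^2 \<Rightarrow> complex. g absolutely_integrable_on UNIV \<Longrightarrow>
    integral UNIV g = of_real c * integral UNIV (\<lambda>y. g (A y))"
proof (rule that[of "\<bar>det (matrix A)\<bar>"])
  have d: "det (matrix A) \<noteq> 0" using assms det_nz_iff_inj by blast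
  then show "\<bar>det (matrix A)\<bar> > 0" by simp
  have sA: "A ` UNIV = UNIV" using assms linear_injective_imp_surjective by blast
  fix g :: "real^2 \<Rightarrow> complex" assume g: "g absolutely_integrable_on UNIV"
  define h where "h = vec2 \<circ> g"
  have h: "h absolutely_integrable_on UNIV"
    unfolding h_def by (rule absolutely_integrable_linear[OF g bounded_linear_vec2])
  have hA: "(h \<circ> A) absolutely_integrable_on UNIV"
    using absolutely_integrable_on_linear_image[OF assms(1), where f = h and S = UNIV] h d sA by simp
  have g': "g = cpx \<circ> h" by (auto simp: h_def)
  have "integral UNIV g = cpx (integral UNIV h)"
    unfolding g' by (rule integral_linear[OF set_lebesgue_integral_eq_integral(1)[OF h] bounded_linear_cpx])
  also have "integral UNIV h = \<bar>det (matrix A)\<bar> *\<^sub>R integral UNIV (h \<circ> A)"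
    using integral_change_of_variables_linear[OF assms(1), where f = h and S = UNIV] h sA by simp
  also have "cpx \<dots> = of_real \<bar>det (matrix A)\<bar> * cpx (integral UNIV (h \<circ> A))"
    by (rule cpx_scaleR)
  also have "cpx (integral UNIV (h \<circ> A)) = integral UNIV (cpx \<circ> (h \<circ> A))"
    by (rule integral_linear[symmetric, OF set_lebesgue_integral_eq_integral(1)[OF hA] bounded_linear_cpx])
  also have "cpx \<circ> (h \<circ> A) = (\<lambda>y. g (A y))" by (auto simp: h_def)
  finally show "integral UNIV g = of_real \<bar>det (matrix A)\<bar> * integral UNIV (\<lambda>y. g (A y))" .
qed

lemma moment_linear_substitution:
  assumes "linear A" "inj A"
  obtains c :: real where "c > 0" "\<And>f f' u. plane_gauge f \<Longrightarrow> (\<And>y. f (A y) = f' y) \<Longrightarrow> continuous_on UNIV u \<Longrightarrow>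
    moment f u = of_real c * moment f' (\<lambda>y. u (A y))"
proof -
  obtain c :: real where c: "c > 0" "\<And>g :: real^2 \<Rightarrow> complex. g absolutely_integrable_on UNIV \<Longrightarrow>
    integral UNIV g = of_real c * integral UNIV (\<lambda>y. g (A y))"
    using integral_linear_substitution[OF assms] by blast
  show ?thesis
  proof (rule that[OF c(1)])
    fix f f' and u :: "real^2 \<Rightarrow> complex"
    assume f: "plane_gauge f" "\<And>y. f (A y) = f' y" "continuous_on UNIV u"
    have "weight f (A y) = weight f' y" for y by (simp add: weight_def f(2))
    then show "moment f u = of_real c * moment f' (\<lambda>y. u (A y))"
      unfolding moment_def using c(2)[OF moment_integrable[OF f(1,3)]] by simp
  qed
qed

lemma continuous_on_moment:
  fixes f :: "'x::heine_borel \<Rightarrow> real^2 \<Rightarrow> real"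
  assumes f: "continuous_on UNIV (\<lambda>(x, y). f x y)" "\<And>x. plane_gauge (f x)"
    and u: "continuous_on UNIV (\<lambda>(x, y). u x y)"
  shows "continuous_on UNIV (\<lambda>x. moment (f x) (u x))"
proof -
  have "isCont (\<lambda>x. moment (f x) (u x)) x0" for x0
  proof -
    obtain m where m: "m > 0" "\<And>x y. x \<in> cball x0 1 \<Longrightarrow> m * norm y \<le> f x y"
      using plane_gauge_uniform_lower_bound[of "cball x0 1" f] f continuous_on_subset by (metis compact_cball subset_UNIV)
    obtain a :: "real^2" where a: "{y. norm y \<le> 1/m} \<subseteq> box (-a) a"
      using ball_subset_box by blast
    have w: "weight (f x) y = 0" if "x \<in> cball x0 1" "y \<notin> cbox (-a) a" for x y
    proof -
      have "norm y > 1/m" using that a box_subset_cbox[of "-a" a] by force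
      then have "m * norm y > 1" using m(1) by (simp add: field_simps)
      then show ?thesis using m(2)[OF that(1), of y] by (simp add: weight_def)
    qed
    have eq: "moment (f x) (u x) = integral (cbox (-a) a) (\<lambda>y. of_real (weight (f x) y) * u x y)"
      if "x \<in> cball x0 1" for x
      unfolding moment_def
    proof (rule compact_support_integrable(2))
      have "continuous_on UNIV (u x)"
        using continuous_on_compose2[OF u, of UNIV "\<lambda>y. (x, y)"]
        by (simp add: continuous_on_Pair continuous_on_const continuous_on_id)
      then show "continuous_on UNIV (\<lambda>y. of_real (weight (f x) y) * u x y)"
        by (intro continuous_intros continuous_on_weight f)
    qed (use w that in auto)
    have "continuous_on (cball x0 1) (\<lambda>x. integral (cbox (-a) a) (\<lambda>y. of_real (weight (f x) y) * u x y))"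
      using f(1) u unfolding weight_def
      by (intro integral_continuous_on_param)
        (auto simp: split_def intro!: continuous_intros intro: continuous_on_subset)
    then have "continuous_on (cball x0 1) (\<lambda>x. moment (f x) (u x))"
      by (rule continuous_on_eq) (simp add: eq)
    moreover have "x0 \<in> interior (cball x0 1)"
      using interior_maximal[OF ball_subset_cball open_ball, of x0 1] by auto
    ultimately show ?thesis by (rule continuous_on_interior)
  qed
  then show ?thesis by (simp add: continuous_at_imp_continuous_on)
qed

text \<open>
  The second moments of \<open>f\<close> are encoded by the integrals \<open>mom_a\<close> of \<open>z\<^sup>2\<close> and
  \<open>mom_b\<close> of \<open>z cnj z\<close>. They are isotropic in the coordinate \<open>z + \<mu> cnj z\<close>
  if and only if \<open>mom_a + 2 \<mu> mom_b + \<mu>\<^sup>2 cnj mom_a = 0\<close>, and the coordinate preserves the orientation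
  if and only if \<open>\<bar>\<mu>\<bar> < 1\<close>. There is exactly one such root, called \<open>iso_mu\<close>; the coordinate
  is the \<open>iso_frame\<close>.
\<close>

definition mom_a :: "(real^2 \<Rightarrow> real) \<Rightarrow> complex" where "mom_a f = moment f (\<lambda>y. cpx y ^ 2)"
definition mom_b :: "(real^2 \<Rightarrow> real) \<Rightarrow> real" where "mom_b f = Re (moment f (\<lambda>y. cpx y * cnj (cpx y)))"

definition iso_mu :: "(real^2 \<Rightarrow> real) \<Rightarrow> complex" where
  "iso_mu f = - mom_a f / of_real (mom_b f + sqrt ((mom_b f)\<^sup>2 - (cmod (mom_a f))\<^sup>2))"

definition iso_frame :: "(real^2 \<Rightarrow> real) \<Rightarrow> real^2 \<Rightarrow> complex" where
  "iso_frame f y = cpx y + iso_mu f * cnj (cpx y)"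

lemma moment_norm_square: "moment f (\<lambda>y. cpx y * cnj (cpx y)) = of_real (mom_b f)"
proof -
  have "cnj (moment f (\<lambda>y. cpx y * cnj (cpx y))) = moment f (\<lambda>y. cpx y * cnj (cpx y))"
    unfolding moment_cnj[symmetric] by (simp add: mult.commute)
  then show ?thesis unfolding mom_b_def
    by (metis complex_cnj_cancel_iff complex_is_Real_iff Reals_cnj_iff of_real_Re)
qed

lemma mom_a_less_mom_b:
  assumes f: "plane_gauge f"
  shows "cmod (mom_a f) < mom_b f"
proof -
  \<comment> \<open>The claim says that the integral of \<open>\<bar>z\<bar>\<^sup>2 - Re (c z\<^sup>2)\<close> is positive.\<close>
  obtain c where c: "cmod c = 1" "c * mom_a f = of_real (cmod (mom_a f))"
  proof (cases "mom_a f = 0")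
    case True
    then show ?thesis using that[of 1] by simp
  next
    case False
    then show ?thesis
      using that[of "of_real (cmod (mom_a f)) / mom_a f"] by (simp add: norm_divide)
  qed
  let ?u = "\<lambda>y. cpx y * cnj (cpx y) + (- c) * cpx y ^ 2"
  have Reu: "Re (?u y) = (norm y)\<^sup>2 - Re (c * cpx y ^ 2)" for y
    by (simp add: complex_norm_square[symmetric] flip: of_real_power)
  have "Re (moment f ?u) > 0"
  proof -
    \<comment> \<open>At \<open>e\<close> the value of \<open>c z\<^sup>2\<close> is \<open>- 1\<close> if \<open>c = 1\<close>, and \<open>c\<close>
      otherwise; so its real part is less than \<open>1\<close>.\<close>
    define e where "e = (if c = 1 then vec2 \<i> else vec2 1)"
    have n: "norm e = 1" by (simp add: e_def)
    have "Re c \<noteq> 1" if "c \<noteq> 1"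
    proof
      assume "Re c = 1"
      then have "Im c = 0" using c(1) by (auto simp: cmod_def)
      then show False using \<open>Re c = 1\<close> that by (simp add: complex_eq_iff)
    qed
    moreover have "Re c \<le> 1" using c(1) complex_Re_le_cmod[of c] by simp
    ultimately have e: "Re (?u e) > 0"
      unfolding Reu n by (auto simp: e_def)
    have e0: "e \<noteq> 0" using n by auto
    then have fe: "f e > 0" using plane_gaugeD[OF f] by blast
    define s where "s = 1 / (2 * f e)"
    have s: "s > 0" using fe by (simp add: s_def)
    show ?thesis
    proof (rule Re_moment_pos[OF f, of _ "s *\<^sub>R e"])
      show "continuous_on UNIV ?u" by (intro continuous_intros)
      show "Re (?u y) \<ge> 0" for y
        unfolding Reu using complex_Re_le_cmod[of "c * cpx y ^ 2"] c(1) by (simp add: norm_mult norm_power)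
      have "c * cpx (s *\<^sub>R e) ^ 2 = of_real (s\<^sup>2) * (c * cpx e ^ 2)"
        by (simp add: cpx_scaleR power_mult_distrib)
      then have "Re (?u (s *\<^sub>R e)) = s\<^sup>2 * Re (?u e)"
        unfolding Reu by (simp only: times_complex.sel Re_complex_of_real Im_complex_of_real norm_scaleR power_mult_distrib power2_abs right_diff_distrib mult_zero_left diff_0_right)
      then show "Re (?u (s *\<^sub>R e)) > 0" using e s by simp
      show "f (s *\<^sub>R e) < 1" using plane_gaugeD(2)[OF f s] fe by (simp add: s_def)
    qed
  qed
  moreover have "moment f ?u = of_real (mom_b f) - c * mom_a f"
    by (subst moment_add[OF f], (intro continuous_intros)+)
      (simp only: moment_cmult moment_norm_square mom_a_def, simp)
  ultimately show ?thesis by (simp add: c(2))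
qed

lemma second_moment:
  assumes f: "plane_gauge f"
  shows "moment f (\<lambda>y. (p * cpx y + q * cnj (cpx y))\<^sup>2) =
    p\<^sup>2 * mom_a f + 2 * p * q * of_real (mom_b f) + q\<^sup>2 * cnj (mom_a f)"
proof -
  have eq: "(\<lambda>y. (p * cpx y + q * cnj (cpx y))\<^sup>2) =
    (\<lambda>y. (p\<^sup>2 * cpx y ^ 2 + (2 * p * q) * (cpx y * cnj (cpx y))) + q\<^sup>2 * cnj (cpx y ^ 2))"
    by (auto simp: power2_eq_square algebra_simps)
  show ?thesis
    unfolding eq
    by (subst moment_add[OF f] moment_cmult, (intro continuous_intros)+)+
      (simp add: moment_cmult moment_norm_square mom_a_def moment_cnj del: complex_cnj_power)
qed

lemma iso_mu:
  assumes f: "plane_gauge f"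
  shows "cmod (iso_mu f) < 1"
    "mom_a f + 2 * iso_mu f * of_real (mom_b f) + (iso_mu f)\<^sup>2 * cnj (mom_a f) = 0"
proof -
  define a b s where "a = mom_a f" and "b = mom_b f" and "s = sqrt (b\<^sup>2 - (cmod a)\<^sup>2)"
  have ab: "cmod a < b" using mom_a_less_mom_b[OF f] by (simp add: a_def b_def)
  then have s: "s > 0" "s\<^sup>2 = b\<^sup>2 - (cmod a)\<^sup>2"
    by (auto simp: s_def power_strict_mono real_sqrt_pow2 less_imp_le)
  have bs: "b + s > 0" using ab s norm_ge_zero[of a] by linarith
  have mu: "iso_mu f = - a / of_real (b + s)" by (simp add: iso_mu_def a_def b_def s_def)
  have "cmod (iso_mu f) = cmod a / (b + s)"
    unfolding mu using bs by (simp add: norm_divide del: of_real_add)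
  also have "\<dots> < 1" using bs ab s by simp
  finally show "cmod (iso_mu f) < 1" .
  have "of_real (b + s) \<noteq> (0::complex)" using bs by (simp del: of_real_add)
  then have "(a + 2 * iso_mu f * of_real b + (iso_mu f)\<^sup>2 * cnj a) * of_real (b + s)^2
      = a * (of_real (b + s))\<^sup>2 - 2 * a * of_real b * of_real (b + s) + a * (a * cnj a)"
    unfolding mu by (simp add: field_simps power2_eq_square del: of_real_add)
  also have "\<dots> = a * of_real ((b + s)\<^sup>2 - 2 * b * (b + s) + (cmod a)\<^sup>2)"
    unfolding complex_norm_square[symmetric] by (simp add: algebra_simps)
  also have "(b + s)\<^sup>2 - 2 * b * (b + s) + (cmod a)\<^sup>2 = 0"
    using s(2) by (simp add: power2_eq_square algebra_simps)
  finally show "mom_a f + 2 * iso_mu f * of_real (mom_b f) + (iso_mu f)\<^sup>2 * cnj (mom_a f) = 0"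
    using bs by (simp add: a_def b_def del: of_real_add)
qed

lemma iso_frame_unique:
  assumes f: "plane_gauge f" and pq: "cmod q < cmod p"
    and 0: "p\<^sup>2 * mom_a f + 2 * p * q * of_real (mom_b f) + q\<^sup>2 * cnj (mom_a f) = 0"
  shows "p * cpx y + q * cnj (cpx y) = p * iso_frame f y"
proof -
  define a b \<mu> r where "a = mom_a f" and "b = mom_b f" and "\<mu> = iso_mu f" and "r = q / p"
  have p: "p \<noteq> 0" using pq by auto
  have r1: "cmod r < 1" using pq p by (simp add: r_def norm_divide)
  have "p\<^sup>2 * (a + 2 * r * of_real b + r\<^sup>2 * cnj a) = 0"
    using 0 p by (simp add: r_def a_def b_def field_simps power2_eq_square)
  then have "a + 2 * r * of_real b + r\<^sup>2 * cnj a = 0" using p by simp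
  moreover have "a + 2 * \<mu> * of_real b + \<mu>\<^sup>2 * cnj a = 0" "cmod \<mu> < 1"
    using iso_mu[OF f] by (simp_all add: a_def b_def \<mu>_def)
  moreover have "(r - \<mu>) * (2 * of_real b + cnj a * (r + \<mu>)) =
      (a + 2 * r * of_real b + r\<^sup>2 * cnj a) - (a + 2 * \<mu> * of_real b + \<mu>\<^sup>2 * cnj a)"
    by (simp add: algebra_simps power2_eq_square)
  ultimately have "(r - \<mu>) * (2 * of_real b + cnj a * (r + \<mu>)) = 0" by simp
  moreover have "2 * of_real b + cnj a * (r + \<mu>) \<noteq> 0"
  proof
    assume "2 * of_real b + cnj a * (r + \<mu>) = 0"
    then have "cmod (2 * of_real b) = cmod (cnj a * (r + \<mu>))"
      by (metis add_eq_0_iff norm_minus_cancel)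
    also have "\<dots> \<le> cmod a * 2"
      unfolding norm_mult complex_mod_cnj
      using norm_triangle_ineq[of r \<mu>] r1 \<open>cmod \<mu> < 1\<close> by (intro mult_left_mono) auto
    also have "\<dots> < 2 * b" using mom_a_less_mom_b[OF f] by (simp add: a_def b_def)
    finally show False by (simp add: norm_mult)
  qed
  ultimately have "r = \<mu>" by simp
  then have "q = p * \<mu>" using p by (simp add: r_def field_simps)
  then show ?thesis by (simp add: iso_frame_def \<mu>_def algebra_simps)
qed

lemma iso_frame_second_moment: "plane_gauge f \<Longrightarrow> moment f (\<lambda>y. (iso_frame f y)\<^sup>2) = 0"
  using second_moment[of f 1 "iso_mu f"] iso_mu(2)[of f] by (simp add: iso_frame_def)

lemma bounded_linear_iso_frame: "bounded_linear (iso_frame f)"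
  unfolding iso_frame_def[abs_def]
  by (intro bounded_linear_add bounded_linear_cpx bounded_linear_const_mult
      bounded_linear_compose[OF bounded_linear_cnj bounded_linear_cpx])

lemma continuous_on_iso_frame: "continuous_on S (iso_frame f)"
  using bounded_linear_iso_frame by (rule linear_continuous_on)

lemma iso_frame_eq_0:
  assumes "plane_gauge f" "iso_frame f y = 0" shows "y = 0"
proof (rule ccontr)
  assume y: "y \<noteq> 0"
  have "cpx y = - iso_mu f * cnj (cpx y)" using assms(2) by (simp add: iso_frame_def eq_neg_iff_add_eq_0)
  then have "norm y = cmod (iso_mu f) * norm y"
    by (metis complex_mod_cnj norm_cpx norm_minus_cancel norm_mult)
  then show False using iso_mu(1)[OF assms(1)] y by simp
qed

text \<open>The moments of a gauge in its isotropic frame; up to a nonzero factor and conjugation they are linear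
  invariants of the gauge.\<close>

definition frame_moment :: "nat \<Rightarrow> nat \<Rightarrow> (real^2 \<Rightarrow> real) \<Rightarrow> complex" where
  "frame_moment k l f = moment f (\<lambda>y. iso_frame f y ^ k * cnj (iso_frame f y) ^ l)"

lemma frame_moment_swap: "frame_moment l k f = cnj (frame_moment k l f)"
  unfolding frame_moment_def moment_cnj[symmetric] by (simp add: mult.commute)

lemma gauge_equivalence_inj:
  assumes "linear A" "plane_gauge f" "plane_gauge f'" "\<And>y. f (A y) = f' y"
  shows "inj A"
  unfolding linear_injective_0[OF assms(1)]
  using assms(4) plane_gaugeD(4)[OF assms(2)] plane_gaugeD(3)[OF assms(3)] by (metis less_irrefl)

text \<open>
  Under complex linear maps the moments transform by a definite rule, because the isotropic frame does.
\<close>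

lemma frame_moment_complex_linear:
  assumes f: "plane_gauge f" "plane_gauge f'" and A: "\<And>y. cpx (A y) = d * cpx y" and eq: "\<And>y. f (A y) = f' y"
  shows "\<exists>c::real>0. frame_moment k l f = of_real c * d ^ k * cnj d ^ l * frame_moment k l f'"
proof -
  have A': "A = (\<lambda>y. vec2 (d * cpx y))" using A by (metis vec2_cpx)
  have lin: "linear A"
    unfolding A' by (intro bounded_linear.linear bounded_linear_compose[OF bounded_linear_vec2]
      bounded_linear_const_mult bounded_linear_cpx)
  have inj: "inj A" by (rule gauge_equivalence_inj[OF lin f eq])
  have d: "d \<noteq> 0"
  proof
    assume "d = 0"
    then have "A (vec2 1) = A 0" by (simp add: A')
    then show False using inj by (metis cpx_vec2 cpx_0 injD one_neq_zero)
  qed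
  obtain c :: real where c: "c > 0" "\<And>f f' u. plane_gauge f \<Longrightarrow> (\<And>y. f (A y) = f' y) \<Longrightarrow> continuous_on UNIV u \<Longrightarrow>
    moment f u = of_real c * moment f' (\<lambda>y. u (A y))"
    using moment_linear_substitution[OF lin inj] by metis
  note sub = c(2)[OF f(1) eq]
  have TA: "iso_frame f (A y) = d * cpx y + (iso_mu f * cnj d) * cnj (cpx y)" for y
    by (simp add: iso_frame_def A)
  have "moment f' (\<lambda>y. (iso_frame f (A y))\<^sup>2) = 0"
    using sub[of "\<lambda>y. (iso_frame f y)\<^sup>2"] iso_frame_second_moment[OF f(1)] c(1)
    by (simp add: continuous_on_iso_frame continuous_on_power)
  then have T: "iso_frame f (A y) = d * iso_frame f' y" for y
    unfolding TA using iso_frame_unique[OF f(2), of "iso_mu f * cnj d" d y] second_moment[OF f(2)]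
      iso_mu(1)[OF f(1)] d by (simp add: norm_mult)
  have "frame_moment k l f = of_real c * moment f' (\<lambda>y. iso_frame f (A y) ^ k * cnj (iso_frame f (A y)) ^ l)"
    unfolding frame_moment_def by (rule sub) (intro continuous_intros continuous_on_iso_frame)
  also have "(\<lambda>y. iso_frame f (A y) ^ k * cnj (iso_frame f (A y)) ^ l) =
      (\<lambda>y. (d ^ k * cnj d ^ l) * (iso_frame f' y ^ k * cnj (iso_frame f' y) ^ l))"
    by (simp add: T power_mult_distrib mult_ac)
  finally show ?thesis using c(1) by (auto simp: moment_cmult frame_moment_def mult.assoc)
qed

text \<open>
  A real linear map takes the isotropic frame to a complex multiple of the isotropic frame if it preserves
  the orientation, and to a multiple of its conjugate if it does not.
\<close>

lemma frame_moment_vanish_invariant: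
  assumes A: "linear A" and f: "plane_gauge f" "plane_gauge f'" and eq: "\<And>y. f (A y) = f' y"
  shows "frame_moment k l f = 0 \<longleftrightarrow> frame_moment k l f' = 0"
proof -
  have inj: "inj A" by (rule gauge_equivalence_inj[OF A f eq])
  obtain c :: real where c: "c > 0" "\<And>f f' u. plane_gauge f \<Longrightarrow> (\<And>y. f (A y) = f' y) \<Longrightarrow> continuous_on UNIV u \<Longrightarrow>
    moment f u = of_real c * moment f' (\<lambda>y. u (A y))"
    using moment_linear_substitution[OF A inj] by metis
  note sub = c(2)[OF f(1) eq]
  have "linear (\<lambda>y. iso_frame f (A y))"
    using linear_compose[OF A bounded_linear.linear[OF bounded_linear_iso_frame[of f]]] by (simp add: o_def)
  then obtain p q where TA: "\<And>y. iso_frame f (A y) = p * cpx y + q * cnj (cpx y)"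
    using real_linear_to_complex by blast
  have "moment f' (\<lambda>y. (iso_frame f (A y))\<^sup>2) = 0"
    using sub[of "\<lambda>y. (iso_frame f y)\<^sup>2"] iso_frame_second_moment[OF f(1)] c(1)
    by (simp add: continuous_on_iso_frame continuous_on_power)
  then have 0: "p\<^sup>2 * mom_a f' + 2 * p * q * of_real (mom_b f') + q\<^sup>2 * cnj (mom_a f') = 0"
    unfolding TA second_moment[OF f(2)] .
  have H: "frame_moment k l f = of_real c * moment f' (\<lambda>y. iso_frame f (A y) ^ k * cnj (iso_frame f (A y)) ^ l)"
    unfolding frame_moment_def by (rule sub) (intro continuous_intros continuous_on_iso_frame)
  have ne: "iso_frame f (A y) \<noteq> 0" if "y \<noteq> 0" for y
    using iso_frame_eq_0[OF f(1)] inj that linear_injective_0[OF A] by blast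
  consider "cmod q < cmod p" | "cmod p < cmod q" | "cmod p = cmod q" by linarith
  then show ?thesis
  proof cases
    case 1
    then have p: "p \<noteq> 0" by auto
    have T: "iso_frame f (A y) = p * iso_frame f' y" for y
      unfolding TA by (rule iso_frame_unique[OF f(2) 1 0])
    have "(\<lambda>y. iso_frame f (A y) ^ k * cnj (iso_frame f (A y)) ^ l) =
      (\<lambda>y. (p ^ k * cnj p ^ l) * (iso_frame f' y ^ k * cnj (iso_frame f' y) ^ l))"
      by (simp add: T power_mult_distrib mult_ac)
    then show ?thesis unfolding H using c(1) p by (simp add: moment_cmult frame_moment_def)
  next
    case 2
    then have q: "q \<noteq> 0" by auto
    have "(cnj q)\<^sup>2 * mom_a f' + 2 * cnj q * cnj p * of_real (mom_b f') + (cnj p)\<^sup>2 * cnj (mom_a f') = 0"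
      using arg_cong[OF 0, of cnj] by (simp add: algebra_simps)
    then have "cnj q * cpx y + cnj p * cnj (cpx y) = cnj q * iso_frame f' y" for y
      using iso_frame_unique[OF f(2), of "cnj p" "cnj q"] 2 by simp
    then have "cnj (iso_frame f (A y)) = cnj q * iso_frame f' y" for y
      unfolding TA by (simp add: add.commute)
    then have T: "iso_frame f (A y) = q * cnj (iso_frame f' y)" for y
      by (metis complex_cnj_cnj complex_cnj_mult)
    have "(\<lambda>y. iso_frame f (A y) ^ k * cnj (iso_frame f (A y)) ^ l) =
      (\<lambda>y. (q ^ k * cnj q ^ l) * cnj (iso_frame f' y ^ k * cnj (iso_frame f' y) ^ l))"
      by (simp add: T power_mult_distrib mult_ac)
    then show ?thesis unfolding H using c(1) q by (simp add: moment_cmult frame_moment_def moment_cnj del: complex_cnj_mult complex_cnj_power)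
  next
    case 3
    \<comment> \<open>A real linear map with \<open>\<bar>p\<bar> = \<bar>q\<bar>\<close> is not injective.\<close>
    have "\<exists>z. z \<noteq> 0 \<and> p * z + q * cnj z = 0"
    proof (cases "p = 0")
      case True
      then show ?thesis using 3 by (intro exI[of _ 1]) auto
    next
      case False
      define z where "z = csqrt (- q / p)"
      have z2: "z\<^sup>2 = - q / p" by (simp add: z_def)
      then have "cmod (z\<^sup>2) = 1" using 3 False by (auto simp: norm_divide)
      then have zz: "z * cnj z = 1" by (simp add: norm_power complex_norm_square[symmetric])
      have "p * z + q * cnj z = p * (z * (z * cnj z)) + q * cnj z" by (simp add: zz)
      also have "\<dots> = cnj z * (p * z\<^sup>2 + q)" by (simp add: power2_eq_square algebra_simps)
      also have "\<dots> = 0" using False by (simp add: z2)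
      finally show ?thesis using zz by (intro exI[of _ z]) auto
    qed
    then obtain z where "z \<noteq> 0" "p * z + q * cnj z = 0" by blast
    then have "iso_frame f (A (vec2 z)) = 0" "vec2 z \<noteq> 0" by (simp_all add: TA flip: cpx_eq_0_iff)
    then show ?thesis using ne by blast
  qed
qed

lemma continuous_on_frame_moment:
  fixes f :: "'x::heine_borel \<Rightarrow> real^2 \<Rightarrow> real"
  assumes f: "continuous_on UNIV (\<lambda>(x, y). f x y)" "\<And>x. plane_gauge (f x)"
  shows "continuous_on UNIV (\<lambda>x. frame_moment k l (f x))"
proof -
  have a: "continuous_on UNIV (\<lambda>x. mom_a (f x))"
    unfolding mom_a_def by (rule continuous_on_moment[OF f]) (auto simp: split_def intro!: continuous_intros)
  have b: "continuous_on UNIV (\<lambda>x. mom_b (f x))"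
    unfolding mom_b_def by (intro continuous_intros continuous_on_moment[OF f]) (auto simp: split_def intro!: continuous_intros)
  have nz: "mom_b (f x) + sqrt ((mom_b (f x))\<^sup>2 - (cmod (mom_a (f x)))\<^sup>2) \<noteq> 0" for x
  proof -
    have ab: "cmod (mom_a (f x)) < mom_b (f x)" using mom_a_less_mom_b[OF f(2)] by blast
    then have "(cmod (mom_a (f x)))\<^sup>2 \<le> (mom_b (f x))\<^sup>2" by (simp add: power_mono)
    then have "sqrt ((mom_b (f x))\<^sup>2 - (cmod (mom_a (f x)))\<^sup>2) \<ge> 0" by simp
    then show ?thesis using ab norm_ge_zero[of "mom_a (f x)"] by linarith
  qed
  have m: "continuous_on UNIV (\<lambda>x. iso_mu (f x))"
    unfolding iso_mu_def by (intro continuous_on_divide continuous_on_minus continuous_on_of_real continuous_on_add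
        continuous_on_real_sqrt continuous_on_diff continuous_on_power continuous_on_norm a b)
      (use nz in \<open>auto simp del: of_real_add\<close>)
  have m': "continuous_on UNIV (\<lambda>z :: 'x \<times> (real^2). iso_mu (f (fst z)))"
    by (rule continuous_on_compose2[OF m]) (auto intro!: continuous_intros)
  show ?thesis
    unfolding frame_moment_def
    by (rule continuous_on_moment[OF f, of "\<lambda>x y. iso_frame (f x) y ^ k * cnj (iso_frame (f x) y) ^ l"])
      (auto simp: split_def iso_frame_def intro!: continuous_intros m')
qed

section \<open>Gauges with rotation invariant moments\<close>

text \<open>The complex polynomial functions in \<open>T y\<close> and its conjugate.\<close>

inductive frame_polynomial :: "(real^2 \<Rightarrow> complex) \<Rightarrow> (real^2 \<Rightarrow> complex) \<Rightarrow> bool" for T where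
  mono: "frame_polynomial T (\<lambda>y. c * T y ^ k * cnj (T y) ^ l)"
| add: "frame_polynomial T g \<Longrightarrow> frame_polynomial T h \<Longrightarrow> frame_polynomial T (\<lambda>y. g y + h y)"

lemma frame_polynomial_mult:
  assumes "frame_polynomial T g" "frame_polynomial T h" shows "frame_polynomial T (\<lambda>y. g y * h y)"
  using assms(1)
proof induction
  case (mono c k l)
  show ?case using assms(2)
  proof induction
    case (mono c' k' l')
    have "(\<lambda>y. c * T y ^ k * cnj (T y) ^ l * (c' * T y ^ k' * cnj (T y) ^ l')) =
      (\<lambda>y. (c * c') * T y ^ (k + k') * cnj (T y) ^ (l + l'))"
      by (simp add: power_add mult_ac)
    then show ?case by (simp only: frame_polynomial.mono)
  next
    case (add g h)
    then show ?case using frame_polynomial.add by (simp add: distrib_left)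
  qed
next
  case (add g h)
  then show ?case using frame_polynomial.add by (simp add: distrib_right)
qed

lemma continuous_on_frame_polynomial:
  "frame_polynomial T g \<Longrightarrow> continuous_on UNIV T \<Longrightarrow> continuous_on UNIV g"
  by (induction rule: frame_polynomial.induct) (auto intro!: continuous_intros)

lemma frame_polynomial_linear:
  "frame_polynomial T (\<lambda>y. a * T y + b * cnj (T y))"
  using frame_polynomial.add[OF frame_polynomial.mono[of T a 1 0] frame_polynomial.mono[of T b 0 1]] by simp

text \<open>The inverse of the isotropic frame.\<close>

definition iso_frame_inv :: "(real^2 \<Rightarrow> real) \<Rightarrow> complex \<Rightarrow> real^2" where
  "iso_frame_inv f w = vec2 ((w - iso_mu f * cnj w) / of_real (1 - (cmod (iso_mu f))\<^sup>2))"

lemma iso_frame_det: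
  assumes "plane_gauge f" shows "1 - (cmod (iso_mu f))\<^sup>2 > 0"
  using iso_mu(1)[OF assms] by (simp add: abs_square_less_1)

lemma iso_frame_inv:
  assumes "plane_gauge f" shows "iso_frame f (iso_frame_inv f w) = w"
proof -
  define \<mu> d where "\<mu> = iso_mu f" and "d = complex_of_real (1 - (cmod \<mu>)\<^sup>2)"
  have d: "d \<noteq> 0" using iso_frame_det[OF assms] by (simp add: d_def \<mu>_def del: of_real_diff)
  have cd: "cnj d = d" by (simp add: d_def)
  have d': "d = 1 - \<mu> * cnj \<mu>" unfolding d_def using complex_norm_square[of \<mu>] by simp
  have "iso_frame f (iso_frame_inv f w) = (w - \<mu> * cnj w) / d + \<mu> * ((cnj w - cnj \<mu> * w) / d)"
    by (simp add: iso_frame_def iso_frame_inv_def \<mu>_def[symmetric] d_def[symmetric] cd del: of_real_diff)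
  also have "\<dots> = w * (1 - \<mu> * cnj \<mu>) / d"
    by (simp add: add_divide_distrib[symmetric] diff_divide_distrib[symmetric] algebra_simps)
  finally show ?thesis using d by (simp add: d')
qed

lemma inj_iso_frame:
  assumes "plane_gauge f" shows "inj (iso_frame f)"
  unfolding linear_injective_0[OF bounded_linear.linear[OF bounded_linear_iso_frame]]
  using iso_frame_eq_0[OF assms] by blast

lemma iso_frame_inv_iso_frame:
  assumes "plane_gauge f" shows "iso_frame_inv f (iso_frame f y) = y"
  using iso_frame_inv[OF assms] inj_iso_frame[OF assms] by (metis injD)

lemma bounded_linear_iso_frame_inv: "bounded_linear (iso_frame_inv f)"
  unfolding iso_frame_inv_def[abs_def]
  by (intro bounded_linear_compose[OF bounded_linear_vec2] bounded_linear_compose[OF bounded_linear_divide]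
     bounded_linear_sub bounded_linear_ident bounded_linear_const_mult bounded_linear_cnj)

lemma frame_polynomial_real_polynomial:
  assumes f: "plane_gauge f" and "real_polynomial_function p"
  shows "frame_polynomial (iso_frame f) (\<lambda>y. of_real (p y))"
  using assms(2)
proof induction
  case (linear p)
  \<comment> \<open>A real linear function of \<open>y\<close> is a real linear function of \<open>iso_frame f y\<close>.\<close>
  have "linear (\<lambda>y. complex_of_real (p y))"
    using bounded_linear.linear[OF bounded_linear_compose[OF bounded_linear_of_real linear]] .
  then obtain a b where ab: "\<And>y. complex_of_real (p y) = a * cpx y + b * cnj (cpx y)"
    using real_linear_to_complex by blast
  define \<mu> d where "\<mu> = iso_mu f" and "d = complex_of_real (1 - (cmod \<mu>)\<^sup>2)"
  have cd: "cnj d = d" by (simp add: d_def)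
  have y: "cpx y = (iso_frame f y - \<mu> * cnj (iso_frame f y)) / d" for y
    using arg_cong[OF iso_frame_inv_iso_frame[OF f, of y], of cpx] by (simp add: iso_frame_inv_def \<mu>_def d_def)
  have "complex_of_real (p y) = (a / d - b * cnj \<mu> / d) * iso_frame f y + (b / d - a * \<mu> / d) * cnj (iso_frame f y)" for y
    unfolding ab y by (simp add: cd algebra_simps diff_divide_distrib)
  then show ?case by (simp only: frame_polynomial_linear)
next
  case (const c)
  show ?case using frame_polynomial.mono[of _ "of_real c" 0 0] by simp
qed (auto intro: frame_polynomial.add frame_polynomial_mult)

text \<open>
  If all moments of different degrees in \<open>z\<close> and \<open>cnj z\<close> vanish, then the weight and its
  rotations have the same moments, hence coincide by the Weierstrass approximation theorem.
\<close>

lemma frame_moment_vanish_rotation: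
  assumes f: "plane_gauge f" and h: "\<And>k l. k \<noteq> l \<Longrightarrow> frame_moment k l f = 0" and c: "cmod c = 1"
  shows "f (iso_frame_inv f (c * iso_frame f y)) = f y"
proof -
  define T where "T = iso_frame f"
  define R where "R y = iso_frame_inv f (c * T y)" for y
  define f' where "f' y = f (R y)" for y
  have cc: "c * cnj c = 1" using c by (simp add: complex_norm_square[symmetric])
  then have c0: "c \<noteq> 0" by auto
  have TR: "T (R y) = c * T y" for y
    by (simp add: R_def T_def iso_frame_inv[OF f])
  have contT: "continuous_on UNIV T" unfolding T_def by (rule continuous_on_iso_frame)
  have T0: "T y = 0 \<longleftrightarrow> y = 0" for y
    using iso_frame_eq_0[OF f] linear_0[OF bounded_linear.linear[OF bounded_linear_iso_frame[of f]]]
    by (auto simp: T_def)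
  have blR: "bounded_linear R"
    unfolding R_def[abs_def] T_def
    by (intro bounded_linear_compose[OF bounded_linear_iso_frame_inv] bounded_linear_const_mult bounded_linear_iso_frame)
  have linR: "linear R" by (rule bounded_linear.linear[OF blR])
  have R0: "R y = 0 \<longleftrightarrow> y = 0" for y using TR[of y] T0 c0 by (metis mult_eq_0_iff)
  have injR: "inj R" unfolding linear_injective_0[OF linR] using R0 by blast
  have f': "plane_gauge f'"
    unfolding plane_gauge_def f'_def
    using plane_gaugeD[OF f] R0 linear_scale[OF linR]
    by (auto intro: continuous_on_compose2[OF plane_gaugeD(1)[OF f, of UNIV] linear_continuous_on[OF blR]])
  obtain s :: real where s: "s > 0" "\<And>f f' u. plane_gauge f \<Longrightarrow> (\<And>y. f (R y) = f' y) \<Longrightarrow> continuous_on UNIV u \<Longrightarrow>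
    moment f u = of_real s * moment f' (\<lambda>y. u (R y))"
    using moment_linear_substitution[OF linR injR] by metis
  \<comment> \<open>The frame rotation \<open>R\<close> preserves areas: it preserves the gauge \<open>\<bar>T y\<bar>\<close>.\<close>
  have "s = 1"
  proof -
    let ?g = "\<lambda>y. cmod (T y)"
    have g: "plane_gauge ?g"
      unfolding plane_gauge_def using T0 linear_scale[OF bounded_linear.linear[OF bounded_linear_iso_frame[of f]]]
      by (auto intro!: continuous_intros continuous_on_iso_frame simp: T_def)
    have 1: "moment ?g (\<lambda>_. 1) = of_real s * moment ?g (\<lambda>_. 1)"
      by (rule s(2)[OF g]) (auto simp: TR norm_mult c)
    have "Re (moment ?g (\<lambda>_. 1)) > 0"
      using T0[of 0] by (intro Re_moment_pos[OF g, of _ 0]) auto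
    then have "moment ?g (\<lambda>_. 1) \<noteq> 0" by auto
    with 1 show ?thesis by simp
  qed
  have mono: "moment f (\<lambda>y. T y ^ k * cnj (T y) ^ l) = moment f' (\<lambda>y. T y ^ k * cnj (T y) ^ l)" for k l
  proof -
    have "moment f (\<lambda>y. T y ^ k * cnj (T y) ^ l) = of_real s * moment f' (\<lambda>y. T (R y) ^ k * cnj (T (R y)) ^ l)"
      by (rule s(2)[OF f]) (auto simp: f'_def intro!: continuous_intros contT)
    also have "(\<lambda>y. T (R y) ^ k * cnj (T (R y)) ^ l) = (\<lambda>y. (c ^ k * cnj c ^ l) * (T y ^ k * cnj (T y) ^ l))"
      by (simp add: TR power_mult_distrib mult_ac)
    finally have eq: "moment f (\<lambda>y. T y ^ k * cnj (T y) ^ l) = (c ^ k * cnj c ^ l) * moment f' (\<lambda>y. T y ^ k * cnj (T y) ^ l)"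
      by (simp only: moment_cmult \<open>s = 1\<close> of_real_1 mult_1)
    show ?thesis
    proof (cases "k = l")
      case True
      then have "c ^ k * cnj c ^ l = 1" by (simp add: cc flip: power_mult_distrib)
      with eq show ?thesis by simp
    next
      case False
      then have "moment f (\<lambda>y. T y ^ k * cnj (T y) ^ l) = 0" using h by (simp add: frame_moment_def T_def)
      with eq c0 show ?thesis by simp
    qed
  qed
  have poly: "moment f g = moment f' g" if "frame_polynomial T g" for g
    using that
  proof induction
    case (mono c k l)
    then show ?case
      using \<open>moment f (\<lambda>y. T y ^ k * cnj (T y) ^ l) = _\<close> by (simp only: mult.assoc moment_cmult)
  next
    case (add g h)
    then show ?case
      by (simp add: moment_add[OF f] moment_add[OF f'] continuous_on_frame_polynomial[OF _ contT])
  qed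
  \<comment> \<open>The difference of the two densities is orthogonal to all polynomials.\<close>
  define D where "D y = weight f y - weight f' y" for y
  have contD: "continuous_on S D" for S
    unfolding D_def[abs_def] by (intro continuous_intros continuous_on_weight f f')
  obtain a1 where a1: "box (-a1) a1 \<noteq> {}" "\<And>y. y \<notin> box (-a1) a1 \<Longrightarrow> weight f y = 0"
    using weight_support[OF f] by blast
  obtain a2 where a2: "\<And>y. y \<notin> box (-a2) a2 \<Longrightarrow> weight f' y = 0"
    using weight_support[OF f'] by blast
  obtain a :: "real^2" where a: "box (-a1) a1 \<union> box (-a2) a2 \<subseteq> box (-a) a"
    using bounded_subset_box_symmetric[of "box (-a1) a1 \<union> box (-a2) a2"] by (auto simp: bounded_box)
  let ?B = "cbox (-a) a"
  have ne: "box (-a) a \<noteq> {}" using a a1(1) by blast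
  have D0: "D y = 0" if "y \<notin> ?B" for y
    using that a a1(2) a2 box_subset_cbox[of "-a" a] unfolding D_def by (metis Un_subset_iff diff_self subsetD)
  have DP: "integral ?B (\<lambda>y. D y * p y) = 0" if p: "real_polynomial_function p" for p
  proof -
    have cp: "continuous_on S p" for S
      using continuous_on_polymonial_function p by (simp add: real_polynomial_function_eq)
    have "moment f (\<lambda>y. of_real (p y)) = moment f' (\<lambda>y. of_real (p y))"
      using poly frame_polynomial_real_polynomial[OF f p] by (simp add: T_def)
    then have "integral UNIV (\<lambda>y. weight f y * p y) = integral UNIV (\<lambda>y. weight f' y * p y)"
      using Re_moment[OF f, of "\<lambda>y. of_real (p y)"] Re_moment[OF f', of "\<lambda>y. of_real (p y)"] cp
      by (simp add: continuous_on_of_real)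
    moreover have "(\<lambda>y. weight f y * p y) integrable_on UNIV" "(\<lambda>y. weight f' y * p y) integrable_on UNIV"
      using set_lebesgue_integral_eq_integral(1)[OF weight_integrable[OF f cp]]
        set_lebesgue_integral_eq_integral(1)[OF weight_integrable[OF f' cp]] by simp_all
    ultimately have "integral UNIV (\<lambda>y. D y * p y) = 0"
      by (simp add: D_def left_diff_distrib integral_diff)
    moreover have "integral UNIV (\<lambda>y. D y * p y) = integral ?B (\<lambda>y. D y * p y)"
      by (rule compact_support_integrable(2)) (auto simp: D0 intro!: continuous_intros contD cp)
    ultimately show ?thesis by simp
  qed
  have i1: "(\<lambda>y. D y * D y) integrable_on ?B" "(\<lambda>y. \<bar>D y\<bar> * e) integrable_on ?B" for e
    by (intro integrable_continuous continuous_intros contD)+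
  have le: "integral ?B (\<lambda>y. D y * D y) \<le> e * integral ?B (\<lambda>y. \<bar>D y\<bar>)" if e: "e > 0" for e
  proof -
    obtain p where p: "real_polynomial_function p" "\<And>y. y \<in> ?B \<Longrightarrow> \<bar>D y - p y\<bar> < e"
      using Stone_Weierstrass_real_polynomial_function[OF compact_cbox contD e] by blast
    have i2: "(\<lambda>y. D y * p y) integrable_on ?B"
      by (intro integrable_continuous continuous_intros contD continuous_on_polymonial_function) (use p(1) in \<open>simp add: real_polynomial_function_eq\<close>)
    have "integral ?B (\<lambda>y. D y * D y) = integral ?B (\<lambda>y. D y * D y - D y * p y)"
      by (simp add: integral_diff[OF i1(1) i2] DP[OF p(1)])
    also have "\<dots> \<le> integral ?B (\<lambda>y. \<bar>D y\<bar> * e)"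
    proof (rule integral_le[OF integrable_diff[OF i1(1) i2] i1(2)])
      fix y assume y: "y \<in> ?B"
      have "D y * D y - D y * p y \<le> \<bar>D y\<bar> * \<bar>D y - p y\<bar>"
        by (metis abs_ge_self abs_mult right_diff_distrib)
      also have "\<dots> \<le> \<bar>D y\<bar> * e" using p(2)[OF y] by (intro mult_left_mono) auto
      finally show "D y * D y - D y * p y \<le> \<bar>D y\<bar> * e" .
    qed
    finally show ?thesis by (simp add: mult.commute)
  qed
  have "integral ?B (\<lambda>y. D y * D y) \<le> 0"
  proof (rule field_le_epsilon)
    fix e :: real assume "e > 0"
    let ?K = "integral ?B (\<lambda>y. \<bar>D y\<bar>)"
    have "?K \<ge> 0" by (intro integral_nonneg integrable_continuous continuous_intros contD) auto
    then have "e / (?K + 1) * ?K \<le> e" "e / (?K + 1) > 0" using \<open>e > 0\<close> by (simp_all add: field_simps)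
    then show "integral ?B (\<lambda>y. D y * D y) \<le> 0 + e"
      using le[of "e / (?K + 1)"] by linarith
  qed
  moreover have "integral ?B (\<lambda>y. D y * D y) \<ge> 0" by (rule integral_nonneg[OF i1(1)]) auto
  ultimately have "integral ?B (\<lambda>y. D y * D y) = 0" by linarith
  moreover have "continuous_on ?B (\<lambda>y. D y * D y)" by (intro continuous_intros contD)
  ultimately have DD: "\<forall>y\<in>?B. D y * D y = 0"
    using integral_cbox_eq_0_iff[of "-a" a "\<lambda>y. D y * D y"] ne by simp
  have "D y = 0" for y
  proof (cases "y \<in> ?B")
    case True
    then have "D y * D y = 0" using DD by blast
    then show ?thesis by simp
  qed (rule D0)
  moreover have "weight f' y = weight f (R y)" for y by (simp only: weight_def f'_def)
  ultimately have D: "weight f y = weight f (R y)" for y by (metis D_def eq_iff_diff_eq_0)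
  show ?thesis
  proof (cases "y = 0")
    case True
    then show ?thesis using R0 by (metis R_def T_def)
  next
    case False
    then have fy: "f y > 0" using plane_gaugeD[OF f] by blast
    define s where "s = 1 / (2 * f y)"
    have s: "s > 0" using fy by (simp add: s_def)
    have "f (s *\<^sub>R y) = s * f y" "f (R (s *\<^sub>R y)) = s * f (R y)"
      using plane_gaugeD(2)[OF f s] linear_scale[OF linR] by simp_all
    with D[of "s *\<^sub>R y"] have "max 0 (1 - s * f y) = max 0 (1 - s * f (R y))"
      by (simp add: weight_def)
    moreover have "s * f y = 1/2" using fy by (simp add: s_def)
    ultimately have "s * f (R y) = s * f y" by (auto simp only: max_def split: if_splits)
    then show ?thesis using s by (simp add: R_def T_def)
  qed
qed

text \<open>Rotating \<open>y\<close> to the positive real axis of the frame shows that \<open>f\<close> is a Euclidean norm.\<close>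

lemma frame_moment_vanish_imp_euclidean:
  assumes f: "plane_gauge f" and h: "\<And>k l. k \<noteq> l \<Longrightarrow> frame_moment k l f = 0"
  obtains c where "c > 0" "\<And>y. f y = c * cmod (iso_frame f y)"
proof (rule that[of "f (iso_frame_inv f 1)"])
  let ?e = "iso_frame_inv f 1"
  have T: "iso_frame f ?e = 1" by (rule iso_frame_inv[OF f])
  have "?e \<noteq> 0" using T linear_0[OF bounded_linear.linear[OF bounded_linear_iso_frame[of f]]] by force
  then show "f ?e > 0" using plane_gaugeD[OF f] by blast
  fix y
  show "f y = f ?e * cmod (iso_frame f y)"
  proof (cases "y = 0")
    case True
    then show ?thesis using plane_gaugeD(4)[OF f] linear_0[OF bounded_linear.linear[OF bounded_linear_iso_frame[of f]]] by simp
  next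
    case False
    then have nz: "iso_frame f y \<noteq> 0" using iso_frame_eq_0[OF f] by blast
    let ?c = "of_real (cmod (iso_frame f y)) / iso_frame f y"
    have "f y = f (iso_frame_inv f (?c * iso_frame f y))"
      by (rule frame_moment_vanish_rotation[OF f h, symmetric]) (use nz in \<open>simp_all add: norm_divide\<close>)
    also have "?c * iso_frame f y = cmod (iso_frame f y) *\<^sub>R 1" using nz by (simp add: scaleR_conv_of_real)
    also have "iso_frame_inv f \<dots> = cmod (iso_frame f y) *\<^sub>R ?e"
      by (rule linear_scale[OF bounded_linear.linear[OF bounded_linear_iso_frame_inv]])
    also have "f \<dots> = cmod (iso_frame f y) * f ?e" using plane_gaugeD(2)[OF f] nz by simp
    finally show ?thesis by simp
  qed
qed

section \<open>Complex line bundles over the Riemann sphere\<close>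

text \<open>
  A nowhere vanishing section of a complex line bundle of degree \<open>m\<close> would be given by functions
  \<open>h1\<close>, \<open>h2\<close> on the two affine charts with this transition rule. As the charts are
  contractible, both functions have continuous logarithms, which on the unit circle would yield a
  continuous logarithm of \<open>z\<^sup>m\<close>.
\<close>

lemma no_nonvanishing_section:
  fixes h1 h2 :: "complex \<Rightarrow> complex"
  assumes "continuous_on UNIV h1" "continuous_on UNIV h2" "\<And>z. h1 z \<noteq> 0" "\<And>z. h2 z \<noteq> 0"
    and tr: "\<And>z. cmod z = 1 \<Longrightarrow> h2 (inverse z) = w * inverse z ^ m * h1 z" and "m > 0"
  shows False
proof -
  have ctr: "contractible (UNIV :: complex set)" by (simp add: convex_imp_contractible)
  obtain g1 where g1: "continuous_on UNIV g1" "\<And>z. h1 z = exp (g1 z)"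
    using continuous_logarithm_on_contractible[OF assms(1) ctr] assms(3) by auto
  obtain g2 where g2: "continuous_on UNIV g2" "\<And>z. h2 z = exp (g2 z)"
    using continuous_logarithm_on_contractible[OF assms(2) ctr] assms(4) by auto
  \<comment> \<open>\<open>q\<close> is a logarithm of the constant \<open>w\<close>, but changes by \<open>2 pi m i\<close> along the circle.\<close>
  define q where "q t = g2 (cis (- t)) - g1 (cis t) + \<i> * of_real (real m * t)" for t
  have cis: "continuous_on UNIV cis" by (simp add: cis_conv_exp continuous_intros)
  have q: "continuous_on {0..2 * pi} q"
    unfolding q_def
    by (intro continuous_intros continuous_on_compose2[OF g1(1)] continuous_on_compose2[OF g2(1)]
        continuous_on_compose2[OF cis]) auto
  have ex: "exp (q t) = w" for t
  proof -
    have "h2 (cis (- t)) = w * cis (- t) ^ m * h1 (cis t)"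
      using tr[of "cis t"] by (simp add: cis_inverse)
    then have "exp (g2 (cis (- t))) = w * cis (- (real m * t)) * exp (g1 (cis t))"
      using Complex.DeMoivre[of "- t" m] by (simp add: g1(2) g2(2))
    moreover have "exp (\<i> * of_real (real m * t)) = cis (real m * t)" by (simp add: cis_conv_exp)
    moreover have "cis (- (real m * t)) * cis (real m * t) = 1" by (simp add: cis_mult)
    ultimately show ?thesis
      unfolding q_def exp_add exp_diff by (simp add: mult.assoc mult.left_commute)
  qed
  have "q constant_on {0..2 * pi}"
  proof (rule continuous_discrete_range_constant[OF _ q])
    show "connected {0..2 * pi}" by simp
    show "\<exists>e>0. \<forall>y. y \<in> {0..2 * pi} \<and> q y \<noteq> q x \<longrightarrow> e \<le> cmod (q y - q x)" for x
    proof (intro exI[of _ 1] conjI allI impI)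
      fix y assume y: "y \<in> {0..2 * pi} \<and> q y \<noteq> q x"
      obtain n :: int where n: "q y = q x + of_real (2 * of_int n * pi) * \<i>"
        using ex[of x] ex[of y] exp_eq[of "q y" "q x"] by auto
      then have "n \<noteq> 0" using y by auto
      then have "\<bar>real_of_int n\<bar> \<ge> 1" by linarith
      moreover have "cmod (q y - q x) = 2 * \<bar>real_of_int n\<bar> * pi"
        unfolding n by (simp add: norm_mult)
      moreover have "pi > 1" using pi_gt3 by simp
      ultimately show "1 \<le> cmod (q y - q x)"
        using mult_mono[of 1 "\<bar>real_of_int n\<bar>" 1 pi] by simp
    qed simp
  qed
  then have "q 0 = q (2 * pi)" unfolding constant_on_def by force
  then show False using \<open>m > 0\<close> by (simp add: q_def cis.code)
qed

section \<open>Finsler metrics in local parametrizations\<close>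

lemma local_param_image_subset: "local_param M W \<phi> \<Longrightarrow> \<phi> ` W \<subseteq> M"
  unfolding local_param_def using openin_imp_subset by blast

lemma local_param_has_derivative:
  "local_param M W \<phi> \<Longrightarrow> x \<in> W \<Longrightarrow> (\<phi> has_derivative frechet_derivative \<phi> (at x)) (at x)"
  unfolding local_param_def using smooth_on_has_derivative by blast

lemma local_param_restrict:
  assumes \<phi>: "local_param M W \<phi>" and U: "openin (top_of_set M) U"
  shows "local_param U (W \<inter> \<phi> -` U) \<phi>"
proof -
  let ?W = "W \<inter> \<phi> -` U"
  have W: "open W" "smooth_on W \<phi>" "openin (top_of_set M) (\<phi> ` W)"
    using \<phi> by (auto simp: local_param_def)
  obtain u where u: "homeomorphism W (\<phi> ` W) \<phi> u" using \<phi> by (auto simp: local_param_def)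
  obtain O1 where O1: "open O1" "U = M \<inter> O1" using U by (auto simp: openin_open)
  obtain O2 where O2: "open O2" "\<phi> ` W = M \<inter> O2" using W(3) by (auto simp: openin_open)
  have "?W = W \<inter> \<phi> -` O1" using O1 local_param_image_subset[OF \<phi>] by auto
  then have "open ?W"
    using continuous_open_preimage[OF smooth_on_imp_continuous_on[OF W(2)] W(1) O1(1)] by simp
  moreover have "smooth_on ?W \<phi>" using W(2) by (rule smooth_on_subset) auto
  moreover have "\<phi> ` ?W = \<phi> ` W \<inter> U" by auto
  then have "\<phi> ` ?W = U \<inter> O2" using O1(2) O2(2) by auto
  then have "openin (top_of_set U) (\<phi> ` ?W)" using O2(1) by (auto simp: openin_open)
  moreover have "homeomorphism ?W (\<phi> ` ?W) \<phi> u" by (rule homeomorphism_of_subsets[OF u]) auto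
  ultimately show ?thesis using \<phi> unfolding local_param_def by blast
qed

lemma tangent_param_in_bundle:
  assumes \<phi>: "local_param M W \<phi>" and x: "x \<in> W"
  shows "tangent_param \<phi> (x, y) \<in> tangent_bundle M"
proof -
  have W: "open W" "smooth_on W \<phi>" using \<phi> by (auto simp: local_param_def)
  have "\<exists>\<epsilon>>0. \<forall>t\<in>{-\<epsilon><..<\<epsilon>}. x + t *\<^sub>R y \<in> W"
  proof -
    have "open ((\<lambda>t::real. x + t *\<^sub>R y) -` W)"
      by (intro open_vimage W continuous_intros)
    moreover have "0 \<in> (\<lambda>t::real. x + t *\<^sub>R y) -` W" using x by simp
    ultimately obtain \<epsilon> where "\<epsilon> > 0" "ball 0 \<epsilon> \<subseteq> (\<lambda>t::real. x + t *\<^sub>R y) -` W"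
      using open_contains_ball by blast
    then show ?thesis by (intro exI[of _ \<epsilon>]) (auto simp: subset_iff)
  qed
  then obtain \<epsilon> where e: "\<epsilon> > 0" "\<And>t. t \<in> {-\<epsilon><..<\<epsilon>} \<Longrightarrow> x + t *\<^sub>R y \<in> W" by blast
  have "smooth_on {-\<epsilon><..<\<epsilon>} (\<lambda>t. \<phi> (x + t *\<^sub>R y))"
    by (rule smooth_on_affine_compose[OF _ W(1) _ _ W(2)]) (use e in \<open>auto intro: bounded_linear_scaleR_left\<close>)
  moreover have "((\<lambda>t. \<phi> (x + t *\<^sub>R y)) has_vector_derivative frechet_derivative \<phi> (at x) y) (at 0)"
  proof -
    have "((\<lambda>t. x + t *\<^sub>R y) has_derivative (\<lambda>t. t *\<^sub>R y)) (at (0::real))"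
      by (auto intro!: derivative_eq_intros)
    moreover have "(\<phi> has_derivative frechet_derivative \<phi> (at x)) (at (x + 0 *\<^sub>R y))"
      using local_param_has_derivative[OF \<phi> x] by simp
    ultimately have "((\<lambda>t. \<phi> (x + t *\<^sub>R y)) has_derivative (\<lambda>t. frechet_derivative \<phi> (at x) (t *\<^sub>R y))) (at 0)"
      by (rule has_derivative_compose)
    then show ?thesis
      by (simp add: has_vector_derivative_def linear_scale[OF has_derivative_linear[OF local_param_has_derivative[OF \<phi> x]]])
  qed
  ultimately have "frechet_derivative \<phi> (at x) y \<in> tangent_space M (\<phi> x)"
    unfolding tangent_space_def mem_Collect_eq
    by (intro exI[of _ \<epsilon>] exI[of _ "\<lambda>t. \<phi> (x + t *\<^sub>R y)"] conjI)
      (use e local_param_image_subset[OF \<phi>] in auto)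
  then show ?thesis
    using x local_param_image_subset[OF \<phi>] by (auto simp: tangent_param_def tangent_bundle_def)
qed

lemma continuous_on_tangent_param:
  assumes \<phi>: "local_param M W (\<phi> :: real^'n \<Rightarrow> 'a::euclidean_space)"
  shows "continuous_on (W \<times> UNIV) (tangent_param \<phi>)"
proof -
  have sm: "smooth_on W \<phi>" using \<phi> by (auto simp: local_param_def)
  have eq: "frechet_derivative \<phi> (at x) y = (\<Sum>i\<in>UNIV. y $ i *\<^sub>R frechet_derivative \<phi> (at x) (axis i 1))"
    if "x \<in> W" for x y
  proof -
    interpret linear "frechet_derivative \<phi> (at x)"
      using has_derivative_linear[OF local_param_has_derivative[OF \<phi> that]] .
    have "frechet_derivative \<phi> (at x) (\<Sum>i\<in>UNIV. y $ i *\<^sub>R axis i 1) =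
        (\<Sum>i\<in>UNIV. y $ i *\<^sub>R frechet_derivative \<phi> (at x) (axis i 1))"
      by (simp add: sum scale)
    then show ?thesis using basis_expansion[of y] by (simp add: scalar_mult_eq_scaleR)
  qed
  have "continuous_on (W \<times> UNIV) (\<lambda>z. (\<phi> (fst z), \<Sum>i\<in>UNIV. snd z $ i *\<^sub>R frechet_derivative \<phi> (at (fst z)) (axis i 1)))"
    by (intro continuous_intros continuous_on_compose2[OF smooth_on_imp_continuous_on[OF sm]]
        continuous_on_compose2[OF smooth_on_imp_continuous_on[OF smooth_on_frechet_derivative[OF sm]]]) auto
  then show ?thesis
    by (rule continuous_on_eq) (auto simp: tangent_param_def eq)
qed

lemma finsler_metric_continuous:
  assumes F: "finsler_metric (TYPE('n::finite)) M F" and \<phi>: "local_param M W (\<phi> :: real^'n \<Rightarrow> 'a::euclidean_space)"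
  shows "continuous_on (W \<times> UNIV) (\<lambda>z. F (tangent_param \<phi> z))"
proof (rule continuous_on_compose2[OF _ continuous_on_tangent_param[OF \<phi>]])
  show "continuous_on (tangent_bundle M) F" using F by (simp add: finsler_metric_def)
qed (use tangent_param_in_bundle[OF \<phi>] in auto)

lemma finsler_metric_homogeneous:
  assumes F: "finsler_metric (TYPE('n::finite)) M F" and \<phi>: "local_param M W (\<phi> :: real^'n \<Rightarrow> 'a::euclidean_space)"
    and x: "x \<in> W" and "t > 0"
  shows "F (tangent_param \<phi> (x, t *\<^sub>R y)) = t * F (tangent_param \<phi> (x, y))"
proof -
  have "\<forall>(p, v)\<in>tangent_bundle M. \<forall>t>0. F (p, t *\<^sub>R v) = t * F (p, v)"
    using F by (simp add: finsler_metric_def)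
  with tangent_param_in_bundle[OF \<phi> x, of y] \<open>t > 0\<close>
  have "F (\<phi> x, t *\<^sub>R frechet_derivative \<phi> (at x) y) = t * F (\<phi> x, frechet_derivative \<phi> (at x) y)"
    by (auto simp: tangent_param_def)
  then show ?thesis
    by (simp add: tangent_param_def linear_scale[OF has_derivative_linear[OF local_param_has_derivative[OF \<phi> x]]])
qed

lemma finsler_metric_nonneg:
  assumes F: "finsler_metric (TYPE('n::finite)) M F" and \<phi>: "local_param M W (\<phi> :: real^'n \<Rightarrow> 'a::euclidean_space)"
    and x: "x \<in> W"
  shows "F (tangent_param \<phi> (x, y)) \<ge> 0"
  using F tangent_param_in_bundle[OF \<phi> x] by (auto simp: finsler_metric_def)

lemma finsler_energy:
  assumes F: "finsler_metric (TYPE('n::finite)) M F" and \<phi>: "local_param M W (\<phi> :: real^'n \<Rightarrow> 'a::euclidean_space)"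
  shows "smooth_on (W \<times> (-{0})) (energy F \<phi>)"
    and "\<And>x y t. x \<in> W \<Longrightarrow> t > 0 \<Longrightarrow> energy F \<phi> (x, t *\<^sub>R y) = t\<^sup>2 * energy F \<phi> (x, y)"
    and "\<And>z w. z \<in> W \<times> (-{0}) \<Longrightarrow> w \<noteq> 0 \<Longrightarrow> w \<bullet> (fundamental_tensor F \<phi> z *v w) > 0"
proof -
  have W: "open W" using \<phi> by (auto simp: local_param_def)
  then have oS: "open (W \<times> (-{0 :: real^'n}))" by (intro open_Times) auto
  have s: "smooth_on (W \<times> (-{0})) (\<lambda>z. F (tangent_param \<phi> z))"
    using F \<phi> by (auto simp: finsler_metric_def o_def)
  have "smooth_on (W \<times> (-{0})) (\<lambda>z. (1/2) * (F (tangent_param \<phi> z) * F (tangent_param \<phi> z)))"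
    by (intro smooth_intros oS s)
  then show "smooth_on (W \<times> (-{0})) (energy F \<phi>)"
    by (rule smooth_on_cong[OF oS, rotated]) (simp add: energy_def power2_eq_square)
  show "energy F \<phi> (x, t *\<^sub>R y) = t\<^sup>2 * energy F \<phi> (x, y)" if "x \<in> W" "t > 0" for x y t
    using finsler_metric_homogeneous[OF F \<phi> that] by (simp add: energy_def power_mult_distrib)
  show "w \<bullet> (fundamental_tensor F \<phi> z *v w) > 0" if "z \<in> W \<times> (-{0})" "w \<noteq> 0" for z w
    using F \<phi> that unfolding finsler_metric_def by blast
qed

lemma finsler_metric_positive:
  assumes F: "finsler_metric (TYPE('n::finite)) M F" and \<phi>: "local_param M W (\<phi> :: real^'n \<Rightarrow> 'a::euclidean_space)"
    and x: "x \<in> W" and y: "y \<noteq> 0"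
  shows "F (tangent_param \<phi> (x, y)) > 0"
proof -
  let ?E = "energy F \<phi>"
  have W: "open W" using \<phi> by (auto simp: local_param_def)
  have z: "(x, y) \<in> W \<times> (-{0})" using x y by simp
  note sm = finsler_energy(1)[OF F \<phi>] and hom = finsler_energy(2)[OF F \<phi>]
  have diff: "f differentiable (at (x, y))" if "smooth_on (W \<times> (-{0})) f" for f :: "_ \<Rightarrow> real"
    using smooth_on_has_derivative[OF that z] differentiableI by blast
  have hy: "partial_y k ?E (x, t *\<^sub>R y) = t ^ 1 * partial_y k ?E (x, y)" if "t > 0" for t k
    using partial_homogeneous(2)[OF W sm hom x y that] that by (simp add: power2_eq_square)
  have e1: "(\<Sum>i\<in>UNIV. y $ i * partial_y i (partial_y j ?E) (x, y)) = partial_y j ?E (x, y)" for j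
    using euler_identity[of "partial_y j ?E" x y 1] diff[OF smooth_on_partial_y[OF sm]] hy by simp
  have e2: "(\<Sum>j\<in>UNIV. y $ j * partial_y j ?E (x, y)) = 2 * ?E (x, y)"
    using euler_identity[of ?E x y 2] diff[OF sm] hom[OF x] by simp
  have "0 < y \<bullet> (fundamental_tensor F \<phi> (x, y) *v y)"
    using finsler_energy(3)[OF F \<phi> z y] .
  also have "\<dots> = (\<Sum>i\<in>UNIV. \<Sum>j\<in>UNIV. y $ j * (y $ i * partial_y i (partial_y j ?E) (x, y)))"
    by (simp add: inner_vec_def matrix_vector_mult_def fundamental_tensor_def sum_distrib_left mult_ac)
  also have "\<dots> = (\<Sum>j\<in>UNIV. y $ j * (\<Sum>i\<in>UNIV. y $ i * partial_y i (partial_y j ?E) (x, y)))"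
    unfolding sum_distrib_left by (rule sum.swap)
  also have "\<dots> = 2 * ?E (x, y)" unfolding e1 e2 ..
  finally have "F (tangent_param \<phi> (x, y)) \<noteq> 0" by (auto simp: energy_def)
  then show ?thesis using finsler_metric_nonneg[OF F \<phi> x, of y] by simp
qed

lemma finsler_plane_gauge:
  assumes F: "finsler_metric TYPE(2) M F" and \<phi>: "local_param M W (\<phi> :: real^2 \<Rightarrow> 'a::euclidean_space)"
    and x: "x \<in> W"
  shows "plane_gauge (\<lambda>y. F (tangent_param \<phi> (x, y)))"
  unfolding plane_gauge_def
proof (intro conjI allI impI)
  show "continuous_on UNIV (\<lambda>y. F (tangent_param \<phi> (x, y)))"
    by (rule continuous_on_compose2[OF finsler_metric_continuous[OF F \<phi>]])
      (use x in \<open>auto intro!: continuous_intros\<close>)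
qed (use finsler_metric_positive[OF F \<phi> x] finsler_metric_homogeneous[OF F \<phi> x] in auto)

text \<open>
  The tangent norms of a locally conformally Berwald metric at nearby points are linearly
  equivalent: compose a parallel transport of the conformal Berwald metric with a homothety.
\<close>

lemma locally_conformally_berwald_equivalence:
  assumes F: "finsler_metric TYPE(2) M F" and \<phi>: "local_param M W (\<phi> :: real^2 \<Rightarrow> 'a::euclidean_space)"
    and cb: "locally_conformally_berwald TYPE(2) M F" and x0: "x0 \<in> W"
  shows "\<exists>\<delta>>0. \<forall>x\<in>ball x0 \<delta>. x \<in> W \<and>
    (\<exists>A. linear A \<and> (\<forall>y. F (tangent_param \<phi> (x, A y)) = F (tangent_param \<phi> (x0, y))))"
proof -
  have "\<phi> x0 \<in> M" using local_param_image_subset[OF \<phi>] x0 by blast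
  then obtain U F' where U: "openin (top_of_set M) U" "\<phi> x0 \<in> U"
    and ce: "conformally_equivalent TYPE(2) U F F'" and B: "berwald_metric TYPE(2) U F'"
    using cb unfolding locally_conformally_berwald_def by blast
  obtain \<alpha> where \<alpha>: "\<And>p v. (p, v) \<in> tangent_bundle U \<Longrightarrow> F' (p, v) = exp (\<alpha> p) * F (p, v)"
    using ce unfolding conformally_equivalent_def by blast
  define V where "V = W \<inter> \<phi> -` U"
  have V: "local_param U V \<phi>" unfolding V_def by (rule local_param_restrict[OF \<phi> U(1)])
  have F': "finsler_metric TYPE(2) U F'" using B by (simp add: berwald_metric_def)
  have oV: "open V" using V by (simp add: local_param_def)
  have x0V: "x0 \<in> V" using x0 U by (simp add: V_def)
  note E = finsler_energy[OF F' V]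
  have mixed: "mixed_curvature F' \<phi> l i j k z = 0" if "z \<in> V \<times> (-{0})" for z l i j k
    using B V that unfolding berwald_metric_def by blast
  obtain \<Gamma> where \<Gamma>: "\<And>l j m. continuous_on V (\<Gamma> l j m)"
    "\<And>x y m. x \<in> V \<Longrightarrow> y \<noteq> 0 \<Longrightarrow> partial_x m (energy F' \<phi>) (x, y) =
       (\<Sum>l\<in>UNIV. \<Sum>j\<in>UNIV. \<Gamma> l j m x * y $ j * partial_y l (energy F' \<phi>) (x, y))"
    using berwald_energy_derivative[OF oV E(1) E(2) E(3) mixed] by auto
  have diff: "energy F' \<phi> differentiable (at z)" if "z \<in> V \<times> (-{0})" for z
    using smooth_on_has_derivative[OF E(1) that] differentiableI by blast
  obtain \<delta> where \<delta>: "\<delta> > 0" "\<And>x. x \<in> ball x0 \<delta> \<Longrightarrow>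
      x \<in> V \<and> (\<exists>A. linear A \<and> (\<forall>y. y \<noteq> 0 \<longrightarrow> energy F' \<phi> (x, A y) = energy F' \<phi> (x0, y)))"
    using parallel_transport_preserves[OF oV x0V diff \<Gamma>] by blast
  have conf: "F' (tangent_param \<phi> (x, y)) = exp (\<alpha> (\<phi> x)) * F (tangent_param \<phi> (x, y))" if "x \<in> V" for x y
    using \<alpha> tangent_param_in_bundle[OF V that, of y] by (simp add: tangent_param_def)
  show ?thesis
  proof (intro exI[of _ \<delta>] conjI ballI \<delta>(1))
    fix x assume x: "x \<in> ball x0 \<delta>"
    then have xV: "x \<in> V" using \<delta> by blast
    then show xW: "x \<in> W" by (simp add: V_def)
    obtain A where A: "linear A" "\<And>y. y \<noteq> 0 \<Longrightarrow> energy F' \<phi> (x, A y) = energy F' \<phi> (x0, y)"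
      using \<delta>(2)[OF x] by blast
    define \<kappa> where "\<kappa> = exp (\<alpha> (\<phi> x) - \<alpha> (\<phi> x0))"
    have \<kappa>: "\<kappa> > 0" by (simp add: \<kappa>_def)
    have z: "F (tangent_param \<phi> (x, 0)) = 0" "F (tangent_param \<phi> (x0, 0)) = 0"
      using plane_gaugeD(4)[OF finsler_plane_gauge[OF F \<phi> xW]] plane_gaugeD(4)[OF finsler_plane_gauge[OF F \<phi> x0]] by auto
    have "F (tangent_param \<phi> (x, \<kappa> *\<^sub>R A y)) = F (tangent_param \<phi> (x0, y))" for y
    proof (cases "y = 0")
      case True
      then show ?thesis using z by (simp add: linear_0[OF A(1)])
    next
      case False
      have "F' (tangent_param \<phi> (x, A y)) = F' (tangent_param \<phi> (x0, y))"
        using A(2)[OF False] finsler_metric_nonneg[OF F' V xV, of "A y"] finsler_metric_nonneg[OF F' V x0V, of y]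
        by (simp add: energy_def)
      then have "exp (\<alpha> (\<phi> x)) * F (tangent_param \<phi> (x, A y)) = exp (\<alpha> (\<phi> x0)) * F (tangent_param \<phi> (x0, y))"
        by (simp add: conf xV x0V)
      then show ?thesis
        unfolding finsler_metric_homogeneous[OF F \<phi> xW \<kappa>] by (simp add: \<kappa>_def exp_diff field_simps)
    qed
    moreover have "linear (\<lambda>y. \<kappa> *\<^sub>R A y)" by (rule linear_compose_scale_right[OF A(1)])
    ultimately show "\<exists>A. linear A \<and> (\<forall>y. F (tangent_param \<phi> (x, A y)) = F (tangent_param \<phi> (x0, y)))" by blast
  qed
qed

lemma frame_moment_vanish_locally_constant:
  assumes F: "finsler_metric TYPE(2) M F" and \<phi>: "local_param M W (\<phi> :: real^2 \<Rightarrow> 'a::euclidean_space)"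
    and cb: "locally_conformally_berwald TYPE(2) M F" and W: "connected W" "x \<in> W" "x' \<in> W"
  shows "frame_moment k l (\<lambda>y. F (tangent_param \<phi> (x, y))) = 0 \<longleftrightarrow> frame_moment k l (\<lambda>y. F (tangent_param \<phi> (x', y))) = 0"
proof (rule connected_local_const[OF W], intro ballI)
  fix a assume a: "a \<in> W"
  obtain \<delta> where \<delta>: "\<delta> > 0" "\<And>x. x \<in> ball a \<delta> \<Longrightarrow> x \<in> W \<and>
    (\<exists>A. linear A \<and> (\<forall>y. F (tangent_param \<phi> (x, A y)) = F (tangent_param \<phi> (a, y))))"
    using locally_conformally_berwald_equivalence[OF F \<phi> cb a] by blast
  have "(frame_moment k l (\<lambda>y. F (tangent_param \<phi> (a, y))) = 0) = (frame_moment k l (\<lambda>y. F (tangent_param \<phi> (b, y))) = 0)"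
    if b: "b \<in> ball a \<delta>" for b
  proof -
    have bW: "b \<in> W" using \<delta>(2)[OF b] by blast
    obtain A where A: "linear A" "\<And>y. F (tangent_param \<phi> (b, A y)) = F (tangent_param \<phi> (a, y))"
      using \<delta>(2)[OF b] by blast
    show ?thesis
      using frame_moment_vanish_invariant[OF A(1) finsler_plane_gauge[OF F \<phi> bW] finsler_plane_gauge[OF F \<phi> a] A(2), of k l] by blast
  qed
  moreover have "eventually (\<lambda>b. b \<in> ball a \<delta>) (at a within W)"
    by (rule eventually_at_in_open'[THEN filter_leD[OF at_le[OF subset_UNIV]]]) (use \<delta> in auto)
  ultimately show "\<forall>\<^sub>F b in at a within W.
      (frame_moment k l (\<lambda>y. F (tangent_param \<phi> (a, y))) = 0) = (frame_moment k l (\<lambda>y. F (tangent_param \<phi> (b, y))) = 0)"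
    by (rule eventually_mono[rotated])
qed

section \<open>Stereographic parametrizations of the sphere\<close>

text \<open>
  For \<open>s = 1\<close> the inverse of the stereographic projection from the north pole; for \<open>s = - 1\<close>
  the inverse of the one from the south pole, composed with a reflection of the plane, which makes the
  transition map holomorphic.
\<close>

definition stereo :: "real \<Rightarrow> real^2 \<Rightarrow> real^3" where
  "stereo s x = inverse (1 + (x $ 1 * x $ 1 + x $ 2 * x $ 2)) *\<^sub>R
     ((2 * x $ 1) *\<^sub>R axis 1 1 + (2 * s * x $ 2) *\<^sub>R axis 2 1 + (s * (x $ 1 * x $ 1 + x $ 2 * x $ 2 - 1)) *\<^sub>R axis 3 1)"

text \<open>The inverse of \<open>stereo s\<close>, on the sphere without the pole \<open>s * p $ 3 = 1\<close>.\<close>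

definition stereo_inv :: "real \<Rightarrow> real^3 \<Rightarrow> real^2" where
  "stereo_inv s p = inverse (1 - s * p $ 3) *\<^sub>R (p $ 1 *\<^sub>R axis 1 1 + (s * p $ 2) *\<^sub>R axis 2 1)"

lemma stereo_nth:
  "stereo s x $ 1 = 2 * x $ 1 / (1 + (x $ 1 * x $ 1 + x $ 2 * x $ 2))"
  "stereo s x $ 2 = 2 * s * x $ 2 / (1 + (x $ 1 * x $ 1 + x $ 2 * x $ 2))"
  "stereo s x $ 3 = s * (x $ 1 * x $ 1 + x $ 2 * x $ 2 - 1) / (1 + (x $ 1 * x $ 1 + x $ 2 * x $ 2))"
  by (simp_all add: stereo_def axis_def divide_inverse)

lemma stereo_denominator: "1 + (x $ 1 * x $ 1 + x $ 2 * x $ 2) > (0::real)"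
  using zero_le_square[of "x $ 1"] zero_le_square[of "x $ 2"] by linarith

lemma sphere3_iff: "p \<in> sphere (0::real^3) 1 \<longleftrightarrow> p $ 1 * p $ 1 + p $ 2 * p $ 2 + p $ 3 * p $ 3 = 1"
  by (simp add: norm_eq_1 inner_vec_def sum_3)

lemma stereo_in_sphere:
  assumes "s * s = 1" shows "stereo s x \<in> sphere 0 1"
proof -
  define a b d where "a = x $ 1" and "b = x $ 2" and "d = 1 + (a * a + b * b)"
  have d: "d > 0" using stereo_denominator[of x] by (simp add: a_def b_def d_def)
  have "(2 * a) * (2 * a) + (2 * s * b) * (2 * s * b) + (s * (a * a + b * b - 1)) * (s * (a * a + b * b - 1)) =
      4 * a * a + 4 * (s * s) * b * b + (s * s) * ((a * a + b * b - 1) * (a * a + b * b - 1))"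
    by (simp add: mult_ac)
  also have "\<dots> = d * d" unfolding assms by (simp add: d_def algebra_simps)
  finally have eq: "(2 * a) * (2 * a) + (2 * s * b) * (2 * s * b) + (s * (a * a + b * b - 1)) * (s * (a * a + b * b - 1)) = d * d" .
  have "stereo s x $ 1 * stereo s x $ 1 + stereo s x $ 2 * stereo s x $ 2 + stereo s x $ 3 * stereo s x $ 3 =
      ((2 * a) * (2 * a) + (2 * s * b) * (2 * s * b) + (s * (a * a + b * b - 1)) * (s * (a * a + b * b - 1))) / (d * d)"
    unfolding stereo_nth a_def[symmetric] b_def[symmetric] d_def[symmetric] by (simp add: add_divide_distrib)
  then show ?thesis unfolding sphere3_iff eq using d by simp
qed

lemma stereo_inv_stereo:
  assumes "s * s = 1"
  shows "1 - s * stereo s x $ 3 = 2 / (1 + (x $ 1 * x $ 1 + x $ 2 * x $ 2))" and "stereo_inv s (stereo s x) = x"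
proof -
  define a b d where "a = x $ 1" and "b = x $ 2" and "d = 1 + (a * a + b * b)"
  have d: "d > 0" using stereo_denominator[of x] by (simp add: a_def b_def d_def)
  have "1 - s * stereo s x $ 3 = 1 - (s * s) * (a * a + b * b - 1) / d"
    unfolding stereo_nth by (simp add: a_def b_def d_def)
  also have "\<dots> = 2 / d" unfolding assms using d by (simp add: field_simps) (simp add: d_def)
  finally show 1: "1 - s * stereo s x $ 3 = 2 / (1 + (x $ 1 * x $ 1 + x $ 2 * x $ 2))"
    by (simp add: a_def b_def d_def)
  have "s * stereo s x $ 2 = (s * s) * (2 * b) / d" unfolding stereo_nth by (simp add: a_def b_def d_def)
  then have 2: "s * stereo s x $ 2 = 2 * b / d" by (simp add: assms)
  show "stereo_inv s (stereo s x) = x"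
    unfolding stereo_inv_def 1 2 unfolding stereo_nth
    using d by (simp add: vec_eq_iff forall_2 axis_def a_def[symmetric] b_def[symmetric] d_def[symmetric])
qed

lemma stereo_stereo_inv:
  assumes s: "s * s = 1" and p: "p \<in> sphere 0 1" "s * p $ 3 \<noteq> 1"
  shows "stereo s (stereo_inv s p) = p"
proof -
  define d where "d = 1 - s * p $ 3"
  have d: "d \<noteq> 0" using p by (simp add: d_def)
  have x: "stereo_inv s p $ 1 = p $ 1 / d" "stereo_inv s p $ 2 = s * p $ 2 / d"
    by (simp_all add: stereo_inv_def axis_def d_def divide_inverse)
  have "p $ 1 * p $ 1 + (s * p $ 2) * (s * p $ 2) = p $ 1 * p $ 1 + (s * s) * (p $ 2 * p $ 2)"
    by (simp add: mult_ac)
  also have "\<dots> = 1 - (s * s) * (p $ 3 * p $ 3)" using p(1) unfolding sphere3_iff s by simp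
  also have "\<dots> = d * (1 + s * p $ 3)" by (simp add: d_def algebra_simps)
  finally have "stereo_inv s p $ 1 * stereo_inv s p $ 1 + stereo_inv s p $ 2 * stereo_inv s p $ 2 = (1 + s * p $ 3) / d"
    unfolding x using d by (simp add: field_simps)
  moreover have "1 + (1 + s * p $ 3) / d = 2 / d" using d by (simp add: field_simps) (simp add: d_def)
  moreover have "(1 + s * p $ 3) / d - 1 = 2 * (s * p $ 3) / d" using d by (simp add: field_simps) (simp add: d_def)
  moreover have "s * (s * q) = q" for q :: real using s by (metis mult.assoc mult_1)
  ultimately show ?thesis
    using d unfolding vec_eq_iff forall_3 stereo_nth by (simp add: x)
qed

lemma smooth_on_vec_nth: "open S \<Longrightarrow> smooth_on S (\<lambda>x :: real^'n. x $ i)"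
  by (rule smooth_on_bounded_linear[OF _ bounded_linear_vec_nth])

lemma smooth_on_stereo: "smooth_on UNIV (stereo s)"
  unfolding stereo_def[abs_def]
  by (intro smooth_intros smooth_on_vec_nth open_UNIV) (metis stereo_denominator less_irrefl)

lemma smooth_on_stereo_inv: "smooth_on {p. s * p $ 3 \<noteq> 1} (stereo_inv s)"
  and open_stereo_domain: "open {p :: real^3. s * p $ 3 \<noteq> 1}"
proof -
  show o: "open {p :: real^3. s * p $ 3 \<noteq> 1}"
    by (intro open_Collect_neq continuous_intros)
  show "smooth_on {p. s * p $ 3 \<noteq> 1} (stereo_inv s)"
    unfolding stereo_inv_def[abs_def]
    by (intro smooth_intros smooth_on_vec_nth o) auto
qed

lemma image_stereo:
  assumes "s * s = 1" shows "stereo s ` UNIV = sphere 0 1 \<inter> {p. s * p $ 3 \<noteq> 1}"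
proof (intro equalityI subsetI)
  fix p assume "p \<in> stereo s ` UNIV"
  then obtain x where x: "p = stereo s x" by blast
  have "1 - s * stereo s x $ 3 > 0"
    unfolding stereo_inv_stereo(1)[OF assms] using stereo_denominator[of x] by simp
  then show "p \<in> sphere 0 1 \<inter> {p. s * p $ 3 \<noteq> 1}"
    using stereo_in_sphere[OF assms, of x] x by auto
next
  fix p assume "p \<in> sphere (0::real^3) 1 \<inter> {p. s * p $ 3 \<noteq> 1}"
  then have "stereo s (stereo_inv s p) = p" using stereo_stereo_inv[OF assms, of p] by auto
  then show "p \<in> stereo s ` UNIV" by (metis rangeI)
qed

lemma local_param_stereo:
  assumes "s * s = 1" shows "local_param (sphere 0 1) UNIV (stereo s)"
  unfolding local_param_def
proof (intro conjI ballI)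
  show "smooth_on UNIV (stereo s)" by (rule smooth_on_stereo)
  have im: "stereo s x \<in> {p. s * p $ 3 \<noteq> 1}" for x using image_stereo[OF assms] by blast
  show "inj (frechet_derivative (stereo s) (at x))" for x
  proof -
    have "((\<lambda>x. stereo_inv s (stereo s x)) has_derivative
        (\<lambda>v. frechet_derivative (stereo_inv s) (at (stereo s x)) (frechet_derivative (stereo s) (at x) v))) (at x)"
      by (rule has_derivative_compose[OF smooth_on_has_derivative[OF smooth_on_stereo]
            smooth_on_has_derivative[OF smooth_on_stereo_inv im]]) simp
    then have "((\<lambda>x. x) has_derivative
        (\<lambda>v. frechet_derivative (stereo_inv s) (at (stereo s x)) (frechet_derivative (stereo s) (at x) v))) (at x)"
      by (simp add: stereo_inv_stereo(2)[OF assms])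
    from has_derivative_unique[OF this has_derivative_ident]
    show ?thesis by (metis injI)
  qed
  show "openin (top_of_set (sphere 0 1)) (stereo s ` UNIV)"
    unfolding image_stereo[OF assms] by (intro openin_open_Int open_stereo_domain)
  show "\<exists>u. homeomorphism UNIV (stereo s ` UNIV) (stereo s) u"
  proof (intro exI[of _ "stereo_inv s"] homeomorphismI)
    show "continuous_on (stereo s ` UNIV) (stereo_inv s)"
      using smooth_on_imp_continuous_on[OF smooth_on_stereo_inv] by (rule continuous_on_subset) (use im in blast)
  qed (auto simp: stereo_inv_stereo(2)[OF assms] intro: smooth_on_imp_continuous_on[OF smooth_on_stereo])
qed auto

text \<open>With the identification of the plane with \<open>\<complex>\<close> the change of coordinates is the inversion.\<close>

lemma stereo_transition:
  assumes "z \<noteq> 0" shows "stereo 1 (vec2 z) = stereo (-1) (vec2 (inverse z))"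
proof -
  define a b r where "a = Re z" and "b = Im z" and "r = a * a + b * b"
  have r: "r > 0"
    using assms unfolding r_def a_def b_def by (metis complex_neq_0 power2_eq_square)
  have v: "vec2 z $ 1 = a" "vec2 z $ 2 = b" by (simp_all add: vec2_def a_def b_def)
  have w: "vec2 (inverse z) $ 1 = a / r" "vec2 (inverse z) $ 2 = - b / r"
    by (simp_all add: vec2_def a_def b_def r_def power2_eq_square)
  have "a / r * (a / r) + - b / r * (- b / r) = r / (r * r)"
    by (simp add: r_def add_divide_distrib)
  then have q: "a / r * (a / r) + - b / r * (- b / r) = 1 / r" using r by simp
  have d: "1 + 1 / r = (1 + r) / r" "1 / r - 1 = (1 - r) / r" using r by (simp_all add: field_simps)
  have c: "2 * (a / r) * r = 2 * a" "2 * - 1 * (- b / r) * r = 2 * 1 * b" "- 1 * ((1 - r) / r) * r = 1 * (r - 1)"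
    using r by simp_all
  show ?thesis
    unfolding vec_eq_iff forall_3 stereo_nth v w q r_def[symmetric] d divide_divide_eq_right c by simp
qed

lemma tangent_param_stereo_transition:
  assumes z: "z \<noteq> 0"
  shows "tangent_param (stereo 1) (vec2 z, y) =
    tangent_param (stereo (-1)) (vec2 (inverse z), vec2 (- (inverse z)\<^sup>2 * cpx y))"
proof -
  let ?\<tau> = "\<lambda>x. vec2 (inverse (cpx x))" and ?x = "vec2 z"
  let ?D = "\<lambda>s x. frechet_derivative (stereo s) (at x)"
  have D: "(stereo s has_derivative ?D s x) (at x)" for s x
    by (rule smooth_on_has_derivative[OF smooth_on_stereo]) simp
  have "((\<lambda>x. inverse (cpx x)) has_derivative (\<lambda>v. - (inverse (cpx ?x) * cpx v * inverse (cpx ?x)))) (at ?x)"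
    by (rule Deriv.has_derivative_inverse) (use z in \<open>auto intro: bounded_linear_imp_has_derivative bounded_linear_cpx\<close>)
  from bounded_linear.has_derivative[OF bounded_linear_vec2 this]
  have "(?\<tau> has_derivative (\<lambda>v. vec2 (- (inverse z)\<^sup>2 * cpx v))) (at ?x)"
    by (simp add: power2_eq_square mult_ac)
  from has_derivative_compose[OF this D[of "-1" "?\<tau> ?x"]]
  have 1: "((\<lambda>x. stereo (-1) (?\<tau> x)) has_derivative (\<lambda>v. ?D (-1) (vec2 (inverse z)) (vec2 (- (inverse z)\<^sup>2 * cpx v)))) (at ?x)"
    by simp
  have "(stereo 1 has_derivative (\<lambda>v. ?D (-1) (vec2 (inverse z)) (vec2 (- (inverse z)\<^sup>2 * cpx v)))) (at ?x)"
  proof (rule has_derivative_transform_within_open[OF 1])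
    show "open (- {0 :: real^2})" by (intro open_Compl closed_singleton)
    show "?x \<in> - {0}" using z by (simp flip: cpx_eq_0_iff)
    show "stereo (-1) (?\<tau> x) = stereo 1 x" if "x \<in> - {0}" for x
      using stereo_transition[of "cpx x"] that by simp
  qed
  from has_derivative_unique[OF D this]
  show ?thesis by (simp add: tangent_param_def stereo_transition[OF z] fun_eq_iff)
qed

section \<open>Locally conformally Berwald metrics on the sphere\<close>

text \<open>The derivative of a stereographic parametrization maps onto the tangent plane, by counting dimensions
  in the orthogonal complement of the point.\<close>

lemma range_derivative_stereo:
  assumes s: "s * s = 1" and v: "v \<in> tangent_space (sphere 0 1) (stereo s x)"
  shows "v \<in> range (frechet_derivative (stereo s) (at x))"
proof -
  let ?D = "frechet_derivative (stereo s) (at x)" and ?p = "stereo s x"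
  have lin: "linear ?D"
    using has_derivative_linear[OF local_param_has_derivative[OF local_param_stereo[OF s]]] by simp
  have inj: "inj ?D" using local_param_stereo[OF s] by (simp add: local_param_def)
  have orth: "?p \<bullet> v = 0" if v: "v \<in> tangent_space (sphere 0 1) ?p" for v
  proof -
    obtain \<epsilon> c where c: "\<epsilon> > 0" "c ` {-\<epsilon><..<\<epsilon>} \<subseteq> sphere 0 1" "c 0 = ?p" "(c has_vector_derivative v) (at (0::real))"
      using v unfolding tangent_space_def by blast
    have "((\<lambda>t. c t \<bullet> c t) has_vector_derivative (c 0 \<bullet> v + v \<bullet> c 0)) (at 0)"
      by (rule bounded_bilinear.has_vector_derivative[OF bounded_bilinear_inner c(4) c(4)])
    moreover have "((\<lambda>t. c t \<bullet> c t) has_vector_derivative 0) (at 0)"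
    proof (rule has_vector_derivative_transform_within_open[OF has_vector_derivative_const])
      show "open {-\<epsilon><..<\<epsilon>}" "0 \<in> {-\<epsilon><..<\<epsilon>}" using c(1) by auto
      show "1 = c t \<bullet> c t" if "t \<in> {-\<epsilon><..<\<epsilon>}" for t
        using c(2) that by (auto simp: norm_eq_1 image_subset_iff)
    qed
    ultimately have "c 0 \<bullet> v + v \<bullet> c 0 = 0" by (rule vector_derivative_unique_at)
    then show ?thesis by (simp add: c(3) inner_commute)
  qed
  have sub: "range ?D \<subseteq> {v. ?p \<bullet> v = 0}"
    using orth tangent_param_in_bundle[OF local_param_stereo[OF s], of x]
    by (auto simp: tangent_bundle_def tangent_param_def)
  have p: "?p \<noteq> 0" using stereo_in_sphere[OF s, of x] by auto
  have "dim (range ?D) = dim (UNIV :: (real^2) set)"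
    using dim_image_eq[OF lin, of UNIV] inj by simp
  then have "dim (range ?D) = 2" by simp
  moreover have "dim {v. ?p \<bullet> v = 0} = 2" using dim_hyperplane[OF p] by simp
  ultimately have "range ?D = {v. ?p \<bullet> v = 0}"
    by (intro subspace_dim_equal linear_subspace_image lin subspace_UNIV subspace_hyperplane sub) auto
  then show ?thesis using orth[OF v] by blast
qed

lemma sphere_covered_by_stereo:
  assumes "p \<in> sphere (0 :: real^3) 1" obtains s x where "s * s = 1" "p = stereo s x"
proof -
  obtain s :: real where s: "s * s = 1" "s * p $ 3 \<noteq> 1"
  proof (cases "p $ 3 = 1")
    case True
    then show ?thesis using that[of "-1"] by simp
  next
    case False
    then show ?thesis using that[of 1] by simp
  qed
  then have "p \<in> range (stereo s)" using assms image_stereo by blast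
  then show ?thesis using s that by blast
qed

text \<open>
  A Finsler metric on the sphere whose tangent norms are pulled back from \<open>\<complex>\<close> by linear maps is
  Riemannian: the metric tensor is found by polarization. It is smooth in every parametrization, since
  the vectors at which the energy is evaluated are nonzero.
\<close>

lemma finsler_euclidean_imp_riemannian:
  fixes F :: "(real^3) \<times> (real^3) \<Rightarrow> real"
  assumes F: "finsler_metric TYPE(2) (sphere 0 1) F"
    and euc: "\<And>s x. s * s = 1 \<Longrightarrow> \<exists>T. linear T \<and> (\<forall>y. F (tangent_param (stereo s) (x, y)) = cmod (T y))"
  shows "is_riemannian TYPE(2) (sphere 0 1) F"
proof -
  let ?S = "sphere (0 :: real^3) 1"
  define g where "g p u v = ((F (p, u + v))\<^sup>2 - (F (p, u))\<^sup>2 - (F (p, v))\<^sup>2) / 2" for p u v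
  have rep: "\<exists>D T. linear D \<and> linear T \<and> tangent_space ?S p \<subseteq> range D \<and> inj D \<and>
      (\<forall>y. F (p, D y) = cmod (T y :: complex)) \<and> (\<forall>y :: real^2. y \<noteq> 0 \<longrightarrow> T y \<noteq> 0)" if p: "p \<in> ?S" for p
  proof -
    obtain s x where s: "s * s = 1" "p = stereo s x" using sphere_covered_by_stereo[OF p] by blast
    note \<phi> = local_param_stereo[OF s(1)]
    let ?D = "frechet_derivative (stereo s) (at x)"
    obtain T where T: "linear T" "\<And>y. F (tangent_param (stereo s) (x, y)) = cmod (T y)"
      using euc[OF s(1)] by blast
    have "T y \<noteq> 0" if "y \<noteq> 0" for y
      using finsler_metric_positive[OF F \<phi> UNIV_I that, of x] T(2)[of y] by auto
    moreover have "linear ?D" using has_derivative_linear[OF local_param_has_derivative[OF \<phi>]] by simp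
    moreover have "inj ?D" using \<phi> by (simp add: local_param_def)
    moreover have "F (p, ?D y) = cmod (T y)" for y
      using T(2)[of y] by (simp add: tangent_param_def s(2))
    ultimately show ?thesis using T(1) range_derivative_stereo[OF s(1)] s(2) by blast
  qed
  have Re: "((cmod (a + b))\<^sup>2 - (cmod a)\<^sup>2 - (cmod b)\<^sup>2) / 2 = a \<bullet> b" for a b :: complex
    by (simp add: power2_norm_eq_inner inner_add inner_commute)
  have tensor: "g p u v = g p v u \<and> (\<forall>w\<in>tangent_space ?S p. g p (u + v) w = g p u w + g p v w) \<and>
        (\<forall>t. g p (t *\<^sub>R u) v = t * g p u v) \<and> (u \<noteq> 0 \<longrightarrow> g p u u > 0)"
    if p: "p \<in> ?S" "u \<in> tangent_space ?S p" "v \<in> tangent_space ?S p" for p u v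
  proof -
    obtain D T where D: "linear D" "linear T" "tangent_space ?S p \<subseteq> range D" "inj D"
      "\<And>y. F (p, D y) = cmod (T y :: complex)" "\<And>y :: real^2. y \<noteq> 0 \<Longrightarrow> T y \<noteq> 0"
      using rep[OF p(1)] by blast
    have gD: "g p (D a) (D b) = T a \<bullet> T b" for a b
      unfolding g_def linear_add[OF D(1), symmetric] D(5) linear_add[OF D(2)] by (rule Re)
    obtain a b where ab: "u = D a" "v = D b" using p D(3) by blast
    have "\<forall>w\<in>tangent_space ?S p. g p (u + v) w = g p u w + g p v w"
    proof
      fix w assume "w \<in> tangent_space ?S p"
      then obtain c where "w = D c" using D(3) by blast
      then show "g p (u + v) w = g p u w + g p v w"
        unfolding ab linear_add[OF D(1), symmetric] by (simp add: gD linear_add[OF D(2)] inner_add)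
    qed
    moreover have "g p (t *\<^sub>R u) v = t * g p u v" for t
      unfolding ab linear_scale[OF D(1), symmetric] by (simp add: gD linear_scale[OF D(2)])
    moreover have "g p u v = g p v u" by (simp add: ab gD inner_commute)
    moreover have "g p u u > 0" if "u \<noteq> 0"
      using D(6)[of a] that linear_0[OF D(1)] by (auto simp: ab gD)
    ultimately show ?thesis by blast
  qed
  have smooth: "smooth_on W (\<lambda>x. g (\<phi> x) (frechet_derivative \<phi> (at x) (axis i 1)) (frechet_derivative \<phi> (at x) (axis j 1)))"
    if \<phi>: "local_param ?S W \<phi>" for W and \<phi> :: "real^2 \<Rightarrow> real^3" and i j
  proof -
    have W: "open W" using \<phi> by (simp add: local_param_def)
    have sE: "smooth_on W (\<lambda>x. energy F \<phi> (x, e))" if "e \<noteq> 0" for e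
    proof -
      have "smooth_on W (\<lambda>x. energy F \<phi> ((0, e) + (x, 0)))"
      proof (rule smooth_on_affine_compose[OF W _ _ _ finsler_energy(1)[OF F \<phi>]])
        show "open (W \<times> (- {0 :: real^2}))" by (intro open_Times W open_Compl closed_singleton)
        show "bounded_linear (\<lambda>x :: real^2. (x, 0 :: real^2))"
          by (intro bounded_linear_Pair bounded_linear_ident bounded_linear_zero)
      qed (use that in auto)
      then show ?thesis by simp
    qed
    have "(axis i 1 + axis j 1 :: real^2) $ i \<noteq> 0" by (simp add: axis_def)
    then have ne: "axis i 1 + axis j 1 \<noteq> (0 :: real^2)" by (metis zero_index)
    have "smooth_on W (\<lambda>x. energy F \<phi> (x, axis i 1 + axis j 1) - energy F \<phi> (x, axis i 1) - energy F \<phi> (x, axis j 1))"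
      by (intro smooth_intros W sE ne) (auto simp: axis_eq_0_iff)
    then show ?thesis
    proof (rule smooth_on_cong[OF W, rotated])
      fix x assume "x \<in> W"
      note lin = has_derivative_linear[OF local_param_has_derivative[OF \<phi> this]]
      show "energy F \<phi> (x, axis i 1 + axis j 1) - energy F \<phi> (x, axis i 1) - energy F \<phi> (x, axis j 1) =
          g (\<phi> x) (frechet_derivative \<phi> (at x) (axis i 1)) (frechet_derivative \<phi> (at x) (axis j 1))"
        by (simp add: g_def energy_def tangent_param_def linear_add[OF lin] diff_divide_distrib)
    qed
  qed
  have norm: "F (p, v) = sqrt (g p v v)" if "(p, v) \<in> tangent_bundle ?S" for p v
  proof -
    have "F (p, 2 *\<^sub>R v) = 2 * F (p, v)" "F (p, v) \<ge> 0"
      using F that by (auto simp: finsler_metric_def)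
    moreover from this have "g p v v = (F (p, v))\<^sup>2"
      by (simp add: g_def scaleR_2[symmetric] power_mult_distrib)
    ultimately show ?thesis by simp
  qed
  have "riemannian_metric_tensor TYPE(2) ?S g"
    unfolding riemannian_metric_tensor_def
    using F tensor smooth by (simp add: finsler_metric_def)
  then show ?thesis
    unfolding is_riemannian_def using norm by blast
qed

text \<open>
  A nonzero \<open>frame_moment k l\<close> with \<open>l < k\<close> would give a nowhere vanishing section of a
  line bundle of degree \<open>2 (k - l)\<close>. Only the direction of the moment is used, because its absolute value
  changes by an unspecified positive factor between the charts.
\<close>

theorem locally_conformally_berwald_sphere:
  fixes F :: "(real^3) \<times> (real^3) \<Rightarrow> real"
  assumes F: "finsler_metric TYPE(2) (sphere 0 1) F"
    and cb: "locally_conformally_berwald TYPE(2) (sphere 0 1) F"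
  shows "is_riemannian TYPE(2) (sphere 0 1) F"
proof -
  define f where "f s z y = F (tangent_param (stereo s) (vec2 z, y))" for s z y
  have one: "(1::real) * 1 = 1" "(-1::real) * (-1) = 1" by simp_all
  note lp = local_param_stereo
  have gauge: "plane_gauge (f s z)" if "s * s = 1" for s z
    unfolding f_def[abs_def] by (rule finsler_plane_gauge[OF F lp[OF that]]) simp
  have cont: "continuous_on UNIV (\<lambda>z. frame_moment k l (f s z))" if "s * s = 1" for s k l
  proof (rule continuous_on_frame_moment[OF _ gauge[OF that]])
    show "continuous_on UNIV (\<lambda>(z, y). f s z y)"
      unfolding f_def split_def
      by (rule continuous_on_compose2[OF finsler_metric_continuous[OF F lp[OF that]]])
        (auto intro!: continuous_intros)
  qed
  have inv: "frame_moment k l (f s z) = 0 \<longleftrightarrow> frame_moment k l (f s z') = 0" if "s * s = 1" for s z z' k l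
    unfolding f_def[abs_def] by (rule frame_moment_vanish_locally_constant[OF F lp[OF that] cb]) auto
  have trans: "\<exists>c::real>0. frame_moment k l (f (-1) (inverse z)) =
      of_real c * (- (inverse z)\<^sup>2) ^ k * cnj (- (inverse z)\<^sup>2) ^ l * frame_moment k l (f 1 z)" if "z \<noteq> 0" for k l z
    by (rule frame_moment_complex_linear[OF gauge[OF one(2)] gauge[OF one(1)], where A = "\<lambda>y. vec2 (- (inverse z)\<^sup>2 * cpx y)"])
      (auto simp: f_def tangent_param_stereo_transition[OF that])
  have eq: "frame_moment k l (f (-1) z) = 0 \<longleftrightarrow> frame_moment k l (f 1 z') = 0" for k l z z'
  proof -
    obtain c :: real where "c > 0" "frame_moment k l (f (-1) (inverse 1)) =
      of_real c * (- (inverse 1)\<^sup>2) ^ k * cnj (- (inverse 1)\<^sup>2) ^ l * frame_moment k l (f 1 1)"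
      using trans[of 1 k l] by auto
    then have "frame_moment k l (f (-1) 1) = 0 \<longleftrightarrow> frame_moment k l (f 1 1) = 0" by simp
    then show ?thesis using inv[OF one(1)] inv[OF one(2)] by blast
  qed
  have vanish: "frame_moment k l (f 1 z) = 0" if "l < k" for k l z
  proof (rule ccontr)
    assume nz: "frame_moment k l (f 1 z) \<noteq> 0"
    define h where "h s z = sgn (frame_moment k l (f s z))" for s z
    have nz1: "frame_moment k l (f 1 z) \<noteq> 0" "frame_moment k l (f (-1) z) \<noteq> 0" for z
      using nz inv[OF one(1)] eq by blast+
    have ch: "continuous_on UNIV (h s)" if "s * s = 1" "\<And>z. frame_moment k l (f s z) \<noteq> 0" for s
      unfolding h_def[abs_def] sgn_div_norm divide_inverse
      using cont[OF that(1)] that(2) by (intro continuous_intros) auto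
    show False
    proof (rule no_nonvanishing_section[of "h 1" "h (-1)"])
      show "continuous_on UNIV (h 1)" "continuous_on UNIV (h (-1))"
        using ch nz1 one by blast+
      show "h 1 z \<noteq> 0" "h (-1) z \<noteq> 0" for z using nz1 by (simp_all add: h_def sgn_zero_iff)
      show "2 * (k - l) > 0" using \<open>l < k\<close> by simp
      fix z :: complex assume z: "cmod z = 1"
      define d where "d = - (inverse z)\<^sup>2"
      have "cmod d = 1" using z by (simp add: d_def norm_power norm_inverse)
      then have dd: "d * cnj d = 1" by (simp add: complex_norm_square[symmetric])
      have "d ^ k * cnj d ^ l = d ^ (k - l) * (d * cnj d) ^ l"
        using \<open>l < k\<close> by (simp add: power_mult_distrib power_add[symmetric] mult.assoc[symmetric])
      then have dkl: "d ^ k * cnj d ^ l = d ^ (k - l)" by (simp add: dd)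
      have "z \<noteq> 0" using z by auto
      then obtain c :: real where c: "c > 0" "frame_moment k l (f (-1) (inverse z)) = of_real c * d ^ k * cnj d ^ l * frame_moment k l (f 1 z)"
        using trans[of z k l] unfolding d_def by blast
      have "sgn (of_real c :: complex) = 1" using c(1) by (simp add: sgn_of_real)
      moreover have "sgn (d ^ (k - l)) = d ^ (k - l)"
        using \<open>cmod d = 1\<close> by (simp add: sgn_div_norm norm_power)
      ultimately have "h (-1) (inverse z) = d ^ (k - l) * h 1 z"
        unfolding h_def c(2) by (simp add: mult.assoc dkl sgn_mult flip: mult.assoc[of "d ^ k"])
      also have "d ^ (k - l) = (-1) ^ (k - l) * inverse z ^ (2 * (k - l))"
        unfolding d_def power_minus[of "(inverse z)\<^sup>2"] power_mult ..
      finally show "h (-1) (inverse z) = (-1) ^ (k - l) * inverse z ^ (2 * (k - l)) * h 1 z" .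
    qed
  qed
  have vanish': "frame_moment k l (f s z) = 0" if "k \<noteq> l" "s * s = 1" for k l s z
  proof -
    have 1: "frame_moment k l (f 1 z) = 0"
    proof (cases "l < k")
      case True
      then show ?thesis by (rule vanish)
    next
      case False
      then have "frame_moment l k (f 1 z) = 0" using that vanish by simp
      then show ?thesis using frame_moment_swap[of k l "f 1 z"] by simp
    qed
    have "s = 1 \<or> s = -1" using that(2) by (simp add: square_eq_1_iff)
    then show ?thesis using 1 eq by blast
  qed
  show ?thesis
  proof (rule finsler_euclidean_imp_riemannian[OF F])
    fix s :: real and x assume s: "s * s = 1"
    obtain c where c: "c > 0" "\<And>y. f s (cpx x) y = c * cmod (iso_frame (f s (cpx x)) y)"
      using frame_moment_vanish_imp_euclidean[OF gauge[OF s] vanish'[OF _ s]] by metis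
    show "\<exists>T. linear T \<and> (\<forall>y. F (tangent_param (stereo s) (x, y)) = cmod (T y))"
    proof (intro exI conjI allI)
      show "linear (\<lambda>y. c *\<^sub>R iso_frame (f s (cpx x)) y)"
        by (intro linear_compose_scale_right bounded_linear.linear bounded_linear_iso_frame)
      show "F (tangent_param (stereo s) (x, y)) = cmod (c *\<^sub>R iso_frame (f s (cpx x)) y)" for y
        using c by (simp add: f_def)
    qed
  qed
qed

lemma locally_conformally_flat_imp_berwald:
  "locally_conformally_flat T M F \<Longrightarrow> locally_conformally_berwald T M F"
  unfolding locally_conformally_flat_def locally_conformally_berwald_def locally_minkowski_def by meson

theorem corollary7:
  shows "(\<nexists>F. finsler_metric TYPE(2) (sphere (0 :: real^3) 1) F \<and>
              \<not> is_riemannian TYPE(2) (sphere (0 :: real^3) 1) F \<and>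
              locally_conformally_berwald TYPE(2) (sphere (0 :: real^3) 1) F) \<and>
         (\<nexists>F. finsler_metric TYPE(2) (sphere (0 :: real^3) 1) F \<and>
              \<not> is_riemannian TYPE(2) (sphere (0 :: real^3) 1) F \<and>
              locally_conformally_flat TYPE(2) (sphere (0 :: real^3) 1) F)"
  using locally_conformally_berwald_sphere locally_conformally_flat_imp_berwald by blast

end
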